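(* Let $a,b,c,q\ge1$ and $d,e\ge0$ be integers, and let $x_i=a+b(e+i-1)$ for $i\ge1$. Let $(l_1,\dots,l_c)$ be positive integers with $l_1+\dots+l_c>d$. Let $f_1,\dots,f_c\in\mathcal{C}$ be distinct, multiplicative, and increasing on the sequence $\{p_i(b)\}_{i=1}^\infty$. Put $h=f_1^{(l_1)}*\dots*f_c^{(l_c)}*\mu^{(d)}$ and let $\lambda_n^{(1)}\le\dots\le\lambda_n^{(n)}$ be the eigenvalues of the $n\times n$ matrix $\big(h(\gcd(x_i,x_j))\big)_{1\le i,j\le n}$ defined on the set $\{a+be,a+b(e+1),\dots,a+b(e+n-1)\}$. Then: (i) if $h(p_i(b))=0$ for some $i\ge1$, then $\lambda_n^{(q)}=0$ for all sufficiently large $n$; (ii) if $h(p_i(b))\ne0$ for all $i\ge1$ and $\sum_{i=1}^\infty\frac{1}{f_1(p_i(b))+\dots+f_c(p_i(b))}=\infty$, then $\lim_{n\to\infty}\lambda_n^{(q)}=0$; (iii) in particular, if for each $1\le j\le c$ there is a constant $C_j>0$ with $f_j(p_i(b))\le C_j p_i(b)$ for all $i\ge1$, then $\lim_{n\to\infty}\lambda_n^{(q)}=0$.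
   Context: An arithmetical function is a complex-valued function on the positive integers; $*$ denotes Dirichlet convolution $(f*g)(m)=\sum_{e\mid m}f(e)g(m/e)$, and $\mu$ is the Möbius function. For an arithmetical function $f$, $f^{(0)}=\delta$ (where $\delta(1)=1$, $\delta(m)=0$ for $m>1$) and $f^{(c)}=f^{(c-1)}*f$ for $c\ge1$. For the sequence $\{x_i\}$, $\mathcal{C}$ is the class of arithmetical functions $f$ such that $(f*\mu)(d')\ge0$ (in particular is real) whenever $d'\mid x_i$ for some $i\ge1$. A function $f$ is multiplicative if $f(mn)=f(m)f(n)$ whenever $\gcd(m,n)=1$. $p_1(b)<p_2(b)<\cdots$ denote the primes in the arithmetic progression $\{1+bi\}_{i=0}^\infty$ listed in increasing order. $f$ is increasing on a sequence $\{y_i\}$ means $f(y_i)\le f(y_j)$ whenever $i<j$. *)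

theory Defs
  imports
    "HOL-Analysis.Analysis"
    "HOL-Computational_Algebra.Computational_Algebra"
    "HOL-Library.Infinite_Set"
    "HOL-Library.Complex_Order"
    "Jordan_Normal_Form.Char_Poly"
begin

text \<open>
  Arithmetical functions have type \<^typ>\<open>nat \<Rightarrow> complex\<close>; the value at 0 is irrelevant.
  The order on \<^typ>\<open>complex\<close> is the one of \<^theory>\<open>HOL-Library.Complex_Order\<close>: an inequality
  \<open>z \<le> w\<close> includes the assertion that the imaginary parts agree.
\<close>

definition dirichlet_conv :: "(nat \<Rightarrow> complex) \<Rightarrow> (nat \<Rightarrow> complex) \<Rightarrow> nat \<Rightarrow> complex" where
  "dirichlet_conv f g m = (\<Sum>e | e dvd m. f e * g (m div e))"

definition dirichlet_delta :: "nat \<Rightarrow> complex" where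
  "dirichlet_delta m = (if m = 1 then 1 else 0)"

primrec dirichlet_power :: "(nat \<Rightarrow> complex) \<Rightarrow> nat \<Rightarrow> nat \<Rightarrow> complex" where
  "dirichlet_power f 0 = dirichlet_delta"
| "dirichlet_power f (Suc k) = dirichlet_conv (dirichlet_power f k) f"

definition moebius_mu :: "nat \<Rightarrow> complex" where
  "moebius_mu m = (if squarefree m then (-1) ^ card (prime_factors m) else 0)"

definition multiplicative :: "(nat \<Rightarrow> complex) \<Rightarrow> bool" where
  "multiplicative f \<longleftrightarrow> (\<forall>m>0. \<forall>n>0. coprime m n \<longrightarrow> f (m * n) = f m * f n)"

text \<open>Sequences are indexed from 1; their value at index 0 is never used.\<close>

definition class_C :: "(nat \<Rightarrow> nat) \<Rightarrow> (nat \<Rightarrow> complex) set" where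
  "class_C x = {f. \<forall>i\<ge>1. \<forall>k. k dvd x i \<longrightarrow> dirichlet_conv f moebius_mu k \<ge> 0}"

definition increasing_on_seq :: "(nat \<Rightarrow> nat) \<Rightarrow> (nat \<Rightarrow> complex) \<Rightarrow> bool" where
  "increasing_on_seq y f \<longleftrightarrow> (\<forall>i\<ge>1. \<forall>j>i. f (y i) \<le> f (y j))"

text \<open>The function \<^const>\<open>enumerate\<close> counts from 0, hence the shift. By Dirichlet's theorem
  the set of primes is infinite for \<open>b \<ge> 1\<close>.\<close>

definition ap_prime :: "nat \<Rightarrow> nat \<Rightarrow> nat" where
  "ap_prime b i = enumerate {p. prime p \<and> (\<exists>k. p = 1 + b * k)} (i - 1)"

text \<open>Matrices are indexed from 0, hence the shift.\<close>

definition gcd_matrix :: "(nat \<Rightarrow> complex) \<Rightarrow> (nat \<Rightarrow> nat) \<Rightarrow> nat \<Rightarrow> complex mat" where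
  "gcd_matrix h x n = mat n n (\<lambda>(i, j). h (gcd (x (i + 1)) (x (j + 1))))"

text \<open>
  The nondecreasing list of eigenvalues, repeated according to algebraic multiplicity, of a
  matrix whose eigenvalues are all real. It is unspecified if some eigenvalue is not real.
\<close>

definition ordered_eigenvalues :: "complex mat \<Rightarrow> real list" where
  "ordered_eigenvalues A =
     (THE xs. sorted xs \<and> char_poly A = (\<Prod>x\<leftarrow>xs. [:- complex_of_real x, 1:]))"

lemma ordered_eigenvalues_eqI:
  assumes "sorted xs" and "char_poly A = (\<Prod>x\<leftarrow>xs. [:- complex_of_real x, 1:])"
  shows "ordered_eigenvalues A = xs"
proof -
  have ord: "order (complex_of_real r) (\<Prod>x\<leftarrow>ys. [:- complex_of_real x, 1:]) = count (mset ys) r"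
    for r ys
  proof (induction ys)
    case Nil
    show ?case by (simp add: order_0I)
  next
    case (Cons y ys)
    have nz: "(\<Prod>x\<leftarrow>zs. [:- complex_of_real x, 1:]) \<noteq> 0" for zs
      by (auto simp: prod_list_zero_iff)
    have "order (complex_of_real r) [:- complex_of_real y, 1:] = (if r = y then 1 else 0)"
      using order_power_n_n[of "complex_of_real y" 1] by (auto intro: order_0I)
    moreover have "order (complex_of_real r) (\<Prod>x\<leftarrow>y # ys. [:- complex_of_real x, 1:]) =
        order (complex_of_real r) [:- complex_of_real y, 1:] +
        order (complex_of_real r) (\<Prod>x\<leftarrow>ys. [:- complex_of_real x, 1:])"
      using nz[of "y # ys"] unfolding list.map prod_list.Cons by (rule order_mult)
    ultimately show ?case
      unfolding Cons.IH by simp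
  qed
  show ?thesis
    unfolding ordered_eigenvalues_def
  proof (rule the_equality)
    show "sorted xs \<and> char_poly A = (\<Prod>x\<leftarrow>xs. [:- complex_of_real x, 1:])"
      using assms by simp
  next
    fix ys
    assume ys: "sorted ys \<and> char_poly A = (\<Prod>x\<leftarrow>ys. [:- complex_of_real x, 1:])"
    have "mset ys = mset xs"
      by (rule multiset_eqI) (metis ord ys assms(2))
    then show "ys = xs"
      using ys assms(1) by (metis properties_for_sort)
  qed
qed

end

theory Submission
  imports Defs "HOL-Number_Theory.Number_Theory" "Jordan_Normal_Form.Schur_Decomposition"
begin

unbundle no vec_syntax

text \<open>
  Since \<open>l\<^sub>1 + \<dots> + l\<^sub>c > d\<close>, the function \<open>h * \<mu>\<close> is a convolution of functions \<open>f\<^sub>j * \<mu>\<close> and \<open>f\<^sub>j\<close>,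
  hence nonnegative on the divisors of the \<open>x\<^sub>i\<close>, and
  \<open>h (gcd x\<^sub>i x\<^sub>j) = \<Sum>k. (h * \<mu>) k [k | x\<^sub>i] [k | x\<^sub>j]\<close> is positive semidefinite. A multiplicative \<open>f\<close>
  vanishes or has \<open>f 1 = 1\<close>. If some \<open>f\<^sub>j\<close> vanishes, then so does \<open>h\<close>; otherwise \<open>h p \<ge> 1\<close> at the
  primes \<open>p \<equiv> 1 (mod b)\<close>, so that (i) only concerns \<open>h = 0\<close>.

  If \<open>p \<equiv> 1 (mod b)\<close>, then \<open>x\<^sub>r p\<close> again belongs to the sequence. For weights \<open>w\<^sub>p\<close> of sum 1 the
  vectors \<open>v\<^sub>r = \<Sum>p. w\<^sub>p e(x\<^sub>r p) - e(x\<^sub>r)\<close> with \<open>r \<le> q\<close> have form value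
  \<open>h x\<^sub>r \<Sum>p. w\<^sub>p\<^sup>2 (h p - 1)\<close>, and their span has dimension \<open>q\<close>. With \<open>w\<^sub>p\<close> proportional to
  \<open>1 / \<Sum>j. f\<^sub>j p\<close> this value is \<open>O(1 / \<Sum>p. 1 / \<Sum>j. f\<^sub>j p)\<close>, and the min-max principle yields (ii).

  Part (iii) reduces to (ii) by the divergence of \<open>\<Sum> 1 / p\<close> over the primes \<open>p \<equiv> 1 (mod b)\<close>. This is
  proved with Dirichlet L-functions at real \<open>s \<rightarrow> 1\<^sup>+\<close>: the product of all \<open>|L(\<chi>, s)|\<close> is bounded
  below by the Euler product, so at most one nonprincipal \<open>L(\<chi>, 1)\<close> vanishes; such a \<open>\<chi>\<close> would be
  real, which Monsky's Lambert series argument excludes. Hence the product tends to infinity,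
  whereas it would stay bounded if \<open>\<Sum> 1 / p\<close> converged.
\<close>

section \<open>Dirichlet convolution and multiplicative functions\<close>

text \<open>The choice of test vectors rests on the form being diagonal in the divisor sums.
  Subtracting e(x_r) from a weighted mean of the e(x_r p) kills every divisor of x_r, and any other
  k divides x_r p for at most one p; so there are no cross terms between primes and only the squares
  of the weights remain. Minimizing the sum of w_p^2 F(p) under the constraint that the w_p sum to
  1, with F(p) the sum of the f_j(p), gives w_p proportional to 1 / F(p) and the minimum 1 / (sum of
  1 / F(p)). The passage from h(p) - 1 to F(p) costs only the factor l_1 + ... + l_c.

  The bound h(p) >= 1 comes from (f_j * mu)(p) = f_j(p) - 1 >= 0 together with h(p) = l_1 f_1(p) +
  ... + l_c f_c(p) - d.

  For the L-functions everything is done by real estimates. Near 1 the principal L-value is at most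
  2 / (s - 1), while a zero at 1 contributes at most C (s - 1): one zero can balance that growth,
  two cannot, and a nonreal character brings its conjugate as a second zero. A Lipschitz bound at 1
  takes the place of analyticity.\<close>

lemma dirichlet_conv_0 [simp]: "dirichlet_conv f g 0 = 0"
  by (simp add: dirichlet_conv_def)

lemma dirichlet_conv_1 [simp]: "dirichlet_conv f g (Suc 0) = f 1 * g 1"
  by (simp add: dirichlet_conv_def)

lemma finite_factorizations:
  assumes "m > 0" shows "finite {(a, b). a * b = (m::nat)}"
proof (rule finite_subset)
  show "{(a, b). a * b = m} \<subseteq> {..m} \<times> {..m}"
    using assms by (auto intro!: dvd_imp_le simp: dvd_triv_left dvd_triv_right)
qed simp

text \<open>Ordered factorizations are symmetric in the two factors, so that commutativity and
  associativity become reindexings of a sum.\<close>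

lemma dirichlet_conv_pairs:
  assumes "m > 0"
  shows "dirichlet_conv f g m = (\<Sum>(a, b) | a * b = m. f a * g b)"
  unfolding dirichlet_conv_def
  by (rule sum.reindex_bij_witness[of _ fst "\<lambda>e. (e, m div e)"]) (use assms in \<open>auto elim!: dvdE\<close>)

lemma dirichlet_conv_commute: "dirichlet_conv f g = dirichlet_conv g f"
proof
  fix m
  show "dirichlet_conv f g m = dirichlet_conv g f m"
  proof (cases "m = 0")
    case False
    then show ?thesis unfolding dirichlet_conv_pairs[OF False[unfolded neq0_conv]]
      by (intro sum.reindex_bij_witness[of _ prod.swap prod.swap]) (auto simp: mult.commute)
  qed simp
qed

lemma dirichlet_conv_assoc:
  "dirichlet_conv (dirichlet_conv f g) h = dirichlet_conv f (dirichlet_conv g h)"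
proof
  fix m :: nat
  show "dirichlet_conv (dirichlet_conv f g) h m = dirichlet_conv f (dirichlet_conv g h) m"
  proof (cases "m = 0")
    case False
    then have m: "m > 0" by simp
    have fin: "finite {(a, b). a * b = k}" if "(k, c) \<in> {(a, b). a * b = m} \<or> (c, k) \<in> {(a, b). a * b = m}"
      for k c using that m by (intro finite_factorizations) (auto intro: Nat.gr0I)
    have "dirichlet_conv (dirichlet_conv f g) h m =
        (\<Sum>(k, c) | k * c = m. \<Sum>(a, b) | a * b = k. f a * g b * h c)"
      unfolding dirichlet_conv_pairs[OF m]
      by (intro sum.cong refl) (use m in \<open>auto simp: dirichlet_conv_pairs sum_distrib_right split_def\<close>)
    also have "\<dots> = (\<Sum>((k, c), a, b) \<in> Sigma {(k, c). k * c = m} (\<lambda>(k, c). {(a, b). a * b = k}). f a * g b * h c)"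
      by (subst sum.Sigma[symmetric]) (use finite_factorizations[OF m] fin in \<open>auto simp: split_def\<close>)
    \<comment> \<open>Both sides range over the triples with \<open>a * b * c = m\<close>; only the
      bracketing changes.\<close>
    also have "\<dots> = (\<Sum>((a, k), b, c) \<in> Sigma {(a, k). a * k = m} (\<lambda>(a, k). {(b, c). b * c = k}). f a * (g b * h c))"
      by (intro sum.reindex_bij_witness[of _ "\<lambda>((a, k), b, c). ((a * b, c), a, b)" "\<lambda>((k, c), a, b). ((a, b * c), b, c)"])
         (auto simp: mult.assoc)
    also have "\<dots> = (\<Sum>(a, k) | a * k = m. \<Sum>(b, c) | b * c = k. f a * (g b * h c))"
      by (subst sum.Sigma[symmetric]) (use finite_factorizations[OF m] fin in \<open>auto simp: split_def\<close>)
    also have "\<dots> = dirichlet_conv f (dirichlet_conv g h) m"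
      unfolding dirichlet_conv_pairs[OF m]
      by (intro sum.cong refl) (use m in \<open>auto simp: dirichlet_conv_pairs sum_distrib_left split_def\<close>)
    finally show ?thesis .
  qed simp
qed

interpretation dirichlet_conv: abel_semigroup dirichlet_conv
  by standard (fact dirichlet_conv_assoc dirichlet_conv_commute)+

lemma dirichlet_conv_cong:
  assumes "\<And>n. n > 0 \<Longrightarrow> f n = f' n" "\<And>n. n > 0 \<Longrightarrow> g n = g' n"
  shows "dirichlet_conv f g = dirichlet_conv f' g'"
proof
  fix m
  show "dirichlet_conv f g m = dirichlet_conv f' g' m"
  proof (cases "m = 0")
    case False
    then show ?thesis unfolding dirichlet_conv_def
      by (intro sum.cong refl arg_cong2[where f = "(*)"] assms)
         (auto simp: dvd_div_eq_0_iff intro!: Nat.gr0I)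
  qed simp
qed

lemma dirichlet_conv_delta:
  assumes "m > 0"
  shows "dirichlet_conv f dirichlet_delta m = f m"
proof -
  have "dirichlet_conv f dirichlet_delta m = (\<Sum>e | e dvd m. if e = m then f m else 0)"
    unfolding dirichlet_conv_def dirichlet_delta_def
    using assms by (intro sum.cong) (auto elim!: dvdE)
  also have "\<dots> = f m" using assms by simp
  finally show ?thesis .
qed

text \<open>At 0 every convolution is 0, because 0 has infinitely many divisors. Hence
  \<open>dirichlet_delta\<close> is neutral only at positive arguments for a general function, but
  everywhere for a function that is itself a convolution.\<close>

lemma dirichlet_conv_conv_delta:
  "dirichlet_conv (dirichlet_conv f g) dirichlet_delta = dirichlet_conv f g"
  by (metis dirichlet_conv_0 dirichlet_conv_delta ext neq0_conv)

lemma dirichlet_conv_prime: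
  assumes "prime p"
  shows "dirichlet_conv f g p = f 1 * g p + f p * g 1"
proof -
  have "{e. e dvd p} = {1, p}" using assms by (auto simp: prime_nat_iff)
  moreover have "p \<noteq> 1" "p > 0" using assms prime_gt_0_nat by auto
  ultimately show ?thesis by (simp add: dirichlet_conv_def)
qed

text \<open>For coprime \<open>m\<close> and \<open>n\<close>, multiplication is a bijection from
  pairs of divisors to the divisors of \<open>m * n\<close>, and it respects complementary
  divisors.\<close>

lemma multiplicative_dirichlet_conv:
  assumes f: "multiplicative f" and g: "multiplicative g"
  shows "multiplicative (dirichlet_conv f g)"
  unfolding multiplicative_def
proof (intro allI impI)
  fix m n :: nat
  assume m: "m > 0" and n: "n > 0" and cop: "coprime m n"
  let ?D = "\<lambda>m. {e::nat. e dvd m}"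
  have inj: "inj_on (\<lambda>(a, b). a * b) (?D m \<times> ?D n)"
  proof (rule inj_onI, clarsimp)
    fix a b a' b'
    assume *: "a dvd m" "a' dvd m" "b dvd n" "b' dvd n" "a * b = a' * b'"
    have "coprime a b'" "coprime a' b" using * cop by (meson coprime_divisors)+
    then have "a dvd a'" "a' dvd a"
      using * by (metis coprime_dvd_mult_left_iff dvd_triv_left)+
    then have "a = a'" by (rule dvd_antisym)
    moreover have "a > 0" using * m by (auto intro: Nat.gr0I)
    ultimately show "a = a' \<and> b = b'" using * by auto
  qed
  have img: "(\<lambda>(a, b). a * b) ` (?D m \<times> ?D n) = ?D (m * n)"
    by (auto simp: image_iff mult_dvd_mono) (metis dvd_productE)
  have "dirichlet_conv f g (m * n) = (\<Sum>(a, b)\<in>?D m \<times> ?D n. f (a * b) * g (m * n div (a * b)))"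
    unfolding dirichlet_conv_def img[symmetric] sum.reindex[OF inj] by (simp add: split_def o_def)
  also have "\<dots> = (\<Sum>(a, b)\<in>?D m \<times> ?D n. f a * g (m div a) * (f b * g (n div b)))"
  proof (rule sum.cong[OF refl], clarsimp)
    fix a b assume *: "a dvd m" "b dvd n"
    then have pos: "a > 0" "b > 0" "m div a > 0" "n div b > 0"
      using m n by (auto simp: dvd_div_eq_0_iff intro!: Nat.gr0I)
    have "m div a dvd m" "n div b dvd n" using * by (auto elim!: dvdE)
    then have "coprime a b" "coprime (m div a) (n div b)"
      using cop * by (auto intro: coprime_divisors[of _ m _ n])
    moreover have "m * n div (a * b) = (m div a) * (n div b)"
      using * by (simp add: div_mult_div_if_dvd)
    ultimately show "f (a * b) * g (m * n div (a * b)) = f a * g (m div a) * (f b * g (n div b))"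
      using f g pos unfolding multiplicative_def by simp
  qed
  also have "\<dots> = dirichlet_conv f g m * dirichlet_conv f g n"
    unfolding dirichlet_conv_def sum_product sum.cartesian_product by simp
  finally show "dirichlet_conv f g (m * n) = dirichlet_conv f g m * dirichlet_conv f g n" .
qed

lemma multiplicative_delta: "multiplicative dirichlet_delta"
  by (auto simp: multiplicative_def dirichlet_delta_def)

lemma multiplicative_moebius: "multiplicative moebius_mu"
  unfolding multiplicative_def
proof (intro allI impI)
  fix m n :: nat
  assume mn: "m > 0" "n > 0" "coprime m n"
  have "prime_factors (m * n) = prime_factors m \<union> prime_factors n"
    using mn by (simp add: prime_factors_product)
  moreover have "prime_factors m \<inter> prime_factors n = {}"
    using mn(3) by (meson coprime_common_divisor disjoint_iff in_prime_factors_iff not_prime_unit)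
  ultimately have "card (prime_factors (m * n)) = card (prime_factors m) + card (prime_factors n)"
    by (simp add: card_Un_disjoint)
  moreover have "squarefree (m * n) \<longleftrightarrow> squarefree m \<and> squarefree n"
    using mn(3) squarefree_mult_coprime squarefree_multD by blast
  ultimately show "moebius_mu (m * n) = moebius_mu m * moebius_mu n"
    by (auto simp: moebius_mu_def power_add)
qed

lemma moebius_1 [simp]: "moebius_mu (Suc 0) = 1"
  by (simp add: moebius_mu_def)

lemma moebius_prime: "prime p \<Longrightarrow> moebius_mu p = -1"
  by (simp add: moebius_mu_def squarefree_prime prime_factorization_prime)

lemma moebius_prime_power:
  assumes "prime p" "k \<ge> 2" shows "moebius_mu (p ^ k) = 0"
proof -
  have "\<not> squarefree (p ^ k)"
    using assms not_prime_unit by (auto simp: squarefree_power_iff)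
  then show ?thesis by (simp add: moebius_mu_def)
qed

lemma dirichlet_conv_prime_power:
  assumes "prime p"
  shows "dirichlet_conv f g (p ^ k) = (\<Sum>i\<le>k. f (p ^ i) * g (p ^ (k - i)))"
  unfolding dirichlet_conv_def
proof (rule sum.reindex_bij_witness[of _ "\<lambda>i. p ^ i" "\<lambda>e. multiplicity p e"])
  fix e assume "e \<in> {e. e dvd p ^ k}"
  then obtain i where i: "i \<le> k" "e = p ^ i" using assms by (auto simp: divides_primepow_nat)
  have "multiplicity p e = i" using i assms by simp
  moreover have "p ^ k div e = p ^ (k - i)" using i assms prime_gt_0_nat by (simp add: power_diff)
  ultimately show "p ^ multiplicity p e = e" "multiplicity p e \<in> {..k}"
    "f (p ^ multiplicity p e) * g (p ^ (k - multiplicity p e)) = f e * g (p ^ k div e)"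
    using i by auto
next
  fix i assume "i \<in> {..k}"
  then show "multiplicity p (p ^ i) = i" "p ^ i \<in> {e. e dvd p ^ k}"
    using assms by (auto simp: le_imp_power_dvd)
qed

text \<open>Splitting off the full power of one prime leaves a smaller coprime cofactor. For
  multiplicative functions this reduces a claim to prime powers.\<close>

lemma coprime_prime_power_induct [consumes 1, case_names one prime_power coprime]:
  fixes m :: nat
  assumes "m > 0" and one: "P 1" and pp: "\<And>p k. prime p \<Longrightarrow> k > 0 \<Longrightarrow> P (p ^ k)"
    and cop: "\<And>m n. m > 0 \<Longrightarrow> n > 0 \<Longrightarrow> coprime m n \<Longrightarrow> P m \<Longrightarrow> P n \<Longrightarrow> P (m * n)"
  shows "P m"
  using assms(1)
proof (induction m rule: less_induct)
  case (less m)
  show ?case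
  proof (cases "m = 1")
    case True
    then show ?thesis using one by simp
  next
    case False
    then obtain p where p: "prime p" "p dvd m" using prime_factor_nat by blast
    have m: "m \<noteq> 0" using less.prems by simp
    have "\<not> is_unit p" using p by auto
    then obtain r where r: "m = p ^ multiplicity p m * r" "\<not> p dvd r"
      using multiplicity_decompose'[OF m] by metis
    define k where "k = multiplicity p m"
    have k: "k > 0" unfolding k_def using p m by (simp add: prime_multiplicity_gt_zero_iff)
    have m_eq: "m = p ^ k * r" using r(1) by (simp add: k_def)
    have r0: "r > 0" using m_eq m by (intro Nat.gr0I) simp
    have "p ^ k > 1" using k prime_gt_1_nat[OF p(1)] by (intro one_less_power)
    then have "p ^ k > 0" by linarith
    have "r < m" unfolding m_eq using \<open>p ^ k > 1\<close> r0 by (intro n_less_m_mult_n) simp_all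
    have "coprime (p ^ k) r" using p r(2) by (simp add: prime_imp_coprime)
    then show ?thesis
      unfolding m_eq by (intro cop \<open>p ^ k > 0\<close> r0 pp p k less.IH \<open>r < m\<close>)
  qed
qed

text \<open>On a prime power only the exponents 0 and 1 contribute, with values 1 and -1;
  multiplicativity does the rest.\<close>

lemma dirichlet_conv_moebius_one:
  "dirichlet_conv moebius_mu (\<lambda>_. 1) m = dirichlet_delta m"
proof (cases "m = 0")
  case False
  then have "m > 0" by simp
  then show ?thesis
  proof (induction m rule: coprime_prime_power_induct)
    case one
    then show ?case by (simp add: dirichlet_delta_def)
  next
    case (prime_power p k)
    have "dirichlet_conv moebius_mu (\<lambda>_. 1) (p ^ k) = (\<Sum>i\<le>k. moebius_mu (p ^ i))"
      using dirichlet_conv_prime_power[OF prime_power(1)] by simp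
    also have "\<dots> = (\<Sum>i\<in>{0, 1}. moebius_mu (p ^ i))"
      using prime_power by (intro sum.mono_neutral_right) (auto intro!: moebius_prime_power)
    also have "\<dots> = 0" using prime_power by (simp add: moebius_prime)
    also have "\<dots> = dirichlet_delta (p ^ k)"
      using prime_power not_prime_1 by (auto simp: dirichlet_delta_def)
    finally show ?case .
  next
    case (coprime m n)
    have "multiplicative (dirichlet_conv moebius_mu (\<lambda>_. 1))"
      by (intro multiplicative_dirichlet_conv multiplicative_moebius) (simp add: multiplicative_def)
    then have "dirichlet_conv moebius_mu (\<lambda>_. 1) (m * n) =
        dirichlet_conv moebius_mu (\<lambda>_. 1) m * dirichlet_conv moebius_mu (\<lambda>_. 1) n"
      using coprime(1-3) unfolding multiplicative_def by blast
    also have "\<dots> = dirichlet_delta m * dirichlet_delta n" by (simp only: coprime)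
    also have "\<dots> = dirichlet_delta (m * n)"
      using multiplicative_delta coprime(1-3) unfolding multiplicative_def by simp
    finally show ?case .
  qed
qed (simp add: dirichlet_delta_def)

lemma dirichlet_conv_moebius_inversion:
  assumes "m > 0"
  shows "f m = (\<Sum>k | k dvd m. dirichlet_conv f moebius_mu k)"
proof -
  have "dirichlet_conv (dirichlet_conv f moebius_mu) (\<lambda>_. 1) = dirichlet_conv f dirichlet_delta"
    unfolding dirichlet_conv_assoc
    by (rule arg_cong[where f = "dirichlet_conv f"]) (simp add: fun_eq_iff dirichlet_conv_moebius_one)
  then show ?thesis using dirichlet_conv_delta[OF assms, of f]
    by (simp add: dirichlet_conv_def fun_eq_iff)
qed

text \<open>Since \<open>f n = f 1 * f n\<close>, the value \<open>f 1\<close> is idempotent, and if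
  it is 0 then so is every value at a positive argument. The vanishing alternative is the degenerate
  case of the theorem.\<close>

lemma multiplicative_1_cases:
  assumes "multiplicative f" shows "f 1 = 1 \<or> (\<forall>n>0. f n = 0)"
proof -
  have *: "f n = f 1 * f n" if "n > 0" for n
    using assms[unfolded multiplicative_def, rule_format, of 1 n] that by simp
  show ?thesis
  proof (cases "f 1 = 0")
    case True
    then show ?thesis using * by auto
  next
    case False
    then show ?thesis using *[of 1] by simp
  qed
qed

lemma multiplicative_dirichlet_power:
  assumes "multiplicative f" shows "multiplicative (dirichlet_power f k)"
  by (induction k) (simp_all add: multiplicative_delta multiplicative_dirichlet_conv assms)

lemma dirichlet_power_1:
  assumes "f 1 = 1" shows "dirichlet_power f k (Suc 0) = 1"
  by (induction k) (use assms in \<open>simp_all add: dirichlet_delta_def\<close>)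

lemma dirichlet_power_prime:
  assumes "f 1 = 1" "prime p" shows "dirichlet_power f k p = of_nat k * f p"
proof (induction k)
  case 0
  then show ?case using assms not_prime_1 by (auto simp: dirichlet_delta_def)
next
  case (Suc k)
  then show ?case using assms(1) dirichlet_power_1[of f k]
    by (simp add: dirichlet_conv_prime[OF assms(2)] algebra_simps)
qed

section \<open>Nonnegativity of convolutions with powers of the Moebius function\<close>

definition nonneg_on :: "nat set \<Rightarrow> (nat \<Rightarrow> complex) \<Rightarrow> bool" where
  "nonneg_on D f \<longleftrightarrow> (\<forall>k\<in>D. f k \<ge> 0)"

definition divisor_closed :: "nat set \<Rightarrow> bool" where
  "divisor_closed D \<longleftrightarrow> (\<forall>m\<in>D. m > 0 \<and> (\<forall>k. k dvd m \<longrightarrow> k \<in> D))"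

lemma nonneg_on_dirichlet_conv:
  assumes "divisor_closed D" "nonneg_on D f" "nonneg_on D g"
  shows "nonneg_on D (dirichlet_conv f g)"
  unfolding nonneg_on_def dirichlet_conv_def
proof (intro ballI sum_nonneg)
  fix m e assume "m \<in> D" "e \<in> {e. e dvd m}"
  then have "e \<in> D" "m div e \<in> D"
    using assms(1) unfolding divisor_closed_def by (auto elim!: dvdE)
  then show "0 \<le> f e * g (m div e)"
    using assms(2,3) by (simp add: nonneg_on_def)
qed

text \<open>\<open>t\<close> counts the factors \<open>moebius_mu\<close> that \<open>f\<close> can
  absorb while staying nonnegative on \<open>D\<close>. All smaller counts are included, so that any
  number of factors up to \<open>s + t\<close> can be shared out between two functions.\<close>

definition moebius_nonneg :: "nat set \<Rightarrow> nat \<Rightarrow> (nat \<Rightarrow> complex) \<Rightarrow> bool" where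
  "moebius_nonneg D t f \<longleftrightarrow> (\<forall>s\<le>t. nonneg_on D (dirichlet_conv f (dirichlet_power moebius_mu s)))"

lemma dirichlet_power_add:
  "dirichlet_conv f (dirichlet_conv (dirichlet_power g s) (dirichlet_power g t)) =
   dirichlet_conv f (dirichlet_power g (s + t))"
proof (induction t)
  case 0
  have "dirichlet_conv f (dirichlet_conv (dirichlet_power g s) dirichlet_delta) =
      dirichlet_conv f (dirichlet_power g s)"
    by (rule dirichlet_conv_cong) (simp_all add: dirichlet_conv_delta)
  then show ?case by simp
next
  case (Suc t)
  then show ?case
    by (simp add: dirichlet_conv_assoc[symmetric])
qed

lemma moebius_nonneg_dirichlet_conv:
  assumes D: "divisor_closed D" and f: "moebius_nonneg D s f" and g: "moebius_nonneg D t g"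
  shows "moebius_nonneg D (s + t) (dirichlet_conv f g)"
  unfolding moebius_nonneg_def
proof (intro allI impI)
  fix u assume "u \<le> s + t"
  then obtain u1 u2 where u: "u = u1 + u2" "u1 \<le> s" "u2 \<le> t"
    by (metis le_add_diff_inverse le_add_diff_inverse2 le_diff_conv add.commute nat_le_linear zero_le add_0)
  have "dirichlet_conv (dirichlet_conv f g) (dirichlet_power moebius_mu u) =
     dirichlet_conv (dirichlet_conv f (dirichlet_power moebius_mu u1))
       (dirichlet_conv g (dirichlet_power moebius_mu u2))"
    unfolding u dirichlet_power_add[symmetric] by (simp only: dirichlet_conv.commute dirichlet_conv.left_commute dirichlet_conv.assoc)
  then show "nonneg_on D (dirichlet_conv (dirichlet_conv f g) (dirichlet_power moebius_mu u))"
    using nonneg_on_dirichlet_conv[OF D] f g u unfolding moebius_nonneg_def by auto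
qed

lemma moebius_nonneg_delta: "divisor_closed D \<Longrightarrow> moebius_nonneg D 0 dirichlet_delta"
  by (simp add: moebius_nonneg_def nonneg_on_def dirichlet_conv_delta divisor_closed_def)
     (simp add: dirichlet_delta_def less_eq_complex_def)

text \<open>One factor is the hypothesis; with no factor, Moebius inversion writes \<open>f\<close>
  as a divisor sum of the nonnegative function in the hypothesis.\<close>

lemma moebius_nonneg_1I:
  assumes D: "divisor_closed D" and f: "nonneg_on D (dirichlet_conv f moebius_mu)"
  shows "moebius_nonneg D 1 f"
proof -
  have "nonneg_on D f" unfolding nonneg_on_def
  proof
    fix m assume m: "m \<in> D"
    then have "(\<Sum>k | k dvd m. dirichlet_conv f moebius_mu k) \<ge> 0"
      using D f unfolding divisor_closed_def nonneg_on_def by (intro sum_nonneg) auto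
    moreover have "m > 0" using m D by (auto simp: divisor_closed_def)
    ultimately show "f m \<ge> 0" using dirichlet_conv_moebius_inversion by metis
  qed
  then have "nonneg_on D (dirichlet_conv f dirichlet_delta)"
    using D by (auto simp: nonneg_on_def dirichlet_conv_delta divisor_closed_def)
  moreover have "dirichlet_conv f (dirichlet_conv dirichlet_delta moebius_mu) = dirichlet_conv f moebius_mu"
    by (metis dirichlet_conv_conv_delta dirichlet_conv_assoc dirichlet_conv_commute)
  ultimately show ?thesis
    unfolding moebius_nonneg_def by (auto simp: le_Suc_eq f)
qed

lemma moebius_nonneg_dirichlet_power:
  assumes "divisor_closed D" "moebius_nonneg D 1 f"
  shows "moebius_nonneg D k (dirichlet_power f k)"
  by (induction k)
     (use assms moebius_nonneg_dirichlet_conv[OF assms(1) _ assms(2)] in \<open>auto simp: moebius_nonneg_delta\<close>)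

lemma foldr_dirichlet_conv_append:
  "dirichlet_conv (foldr dirichlet_conv fs g) u = foldr dirichlet_conv fs (dirichlet_conv g u)"
  by (induction fs) (simp_all add: dirichlet_conv_assoc)

text \<open>Here the excess of the total exponent over \<open>d\<close> enters: besides the
  \<open>d\<close> factors \<open>moebius_mu\<close> inside the product, the final convolution
  brings one more, and all \<open>Suc d\<close> of them have to be absorbed.\<close>

lemma nonneg_on_foldr_dirichlet_conv:
  assumes D: "divisor_closed D" and f: "\<And>j. j \<in> set js \<Longrightarrow> moebius_nonneg D (l j) (f j)"
    and d: "(\<Sum>j\<leftarrow>js. l j) > d"
  shows "nonneg_on D (dirichlet_conv (foldr dirichlet_conv (map f js) (dirichlet_power moebius_mu d)) moebius_mu)"
proof -
  have "moebius_nonneg D (\<Sum>j\<leftarrow>js. l j) (foldr dirichlet_conv (map f js) dirichlet_delta)"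
    using f by (induction js) (auto simp: moebius_nonneg_delta D intro!: moebius_nonneg_dirichlet_conv)
  then have "nonneg_on D (dirichlet_conv (foldr dirichlet_conv (map f js) dirichlet_delta) (dirichlet_power moebius_mu (Suc d)))"
    using d unfolding moebius_nonneg_def by (auto simp del: dirichlet_power.simps)
  also have "dirichlet_conv (foldr dirichlet_conv (map f js) dirichlet_delta) (dirichlet_power moebius_mu (Suc d)) =
      foldr dirichlet_conv (map f js) (dirichlet_conv (dirichlet_conv (dirichlet_power moebius_mu d) moebius_mu) dirichlet_delta)"
    unfolding foldr_dirichlet_conv_append dirichlet_power.simps
    by (rule arg_cong[where f = "foldr dirichlet_conv (map f js)"]) (rule dirichlet_conv_commute)
  also have "\<dots> = dirichlet_conv (foldr dirichlet_conv (map f js) (dirichlet_power moebius_mu d)) moebius_mu"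
    by (simp add: foldr_dirichlet_conv_append dirichlet_conv_conv_delta)
  finally show ?thesis .
qed

lemma multiplicative_foldr_dirichlet_conv:
  assumes "\<And>f. f \<in> set fs \<Longrightarrow> multiplicative f" "multiplicative g"
  shows "multiplicative (foldr dirichlet_conv fs g)"
  using assms by (induction fs) (auto intro!: multiplicative_dirichlet_conv)

lemma foldr_dirichlet_conv_1:
  assumes "\<And>f. f \<in> set fs \<Longrightarrow> f 1 = 1" "g 1 = 1"
  shows "foldr dirichlet_conv fs g (Suc 0) = 1"
  using assms by (induction fs) auto

lemma foldr_dirichlet_conv_prime:
  assumes "\<And>f. f \<in> set fs \<Longrightarrow> f 1 = 1" "g 1 = 1" "prime p"
  shows "foldr dirichlet_conv fs g p = (\<Sum>f\<leftarrow>fs. f p) + g p"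
  using assms(1)
proof (induction fs)
  case (Cons f fs)
  then show ?case using foldr_dirichlet_conv_1[of fs g] assms(2)
    by (simp add: dirichlet_conv_prime[OF assms(3)])
qed simp

section \<open>Eigenvalues of Hermitian matrices\<close>

lemma dim_mat_adjoint [simp]: "dim_row (mat_adjoint A) = dim_col A" "dim_col (mat_adjoint A) = dim_row A"
  by (simp_all add: mat_adjoint_def)

lemma mat_adjoint_carrier: "A \<in> carrier_mat n m \<Longrightarrow> mat_adjoint A \<in> carrier_mat m n"
  by auto

lemma index_mat_adjoint [simp]:
  fixes A :: "complex mat"
  assumes "i < dim_col A" "j < dim_row A" shows "mat_adjoint A $$ (i, j) = cnj (A $$ (j, i))"
  using assms by (simp add: mat_adjoint_def mat_of_rows_index)

lemma index_mult_mat_sum: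
  assumes "A \<in> carrier_mat n m" "B \<in> carrier_mat m k" "i < n" "j < k"
  shows "(A * B) $$ (i, j) = (\<Sum>r<m. A $$ (i, r) * B $$ (r, j))"
  using assms by (auto simp: scalar_prod_def atLeast0LessThan intro!: sum.cong)

lemma mat_adjoint_mult:
  fixes A B :: "complex mat"
  assumes A: "A \<in> carrier_mat n m" and B: "B \<in> carrier_mat m k"
  shows "mat_adjoint (A * B) = mat_adjoint B * mat_adjoint A"
proof (rule eq_matI)
  fix i j assume ij: "i < dim_row (mat_adjoint B * mat_adjoint A)" "j < dim_col (mat_adjoint B * mat_adjoint A)"
  then have i: "i < k" and j: "j < n" using A B by auto
  have "mat_adjoint (A * B) $$ (i, j) = cnj ((A * B) $$ (j, i))"
    using A B i j by (intro index_mat_adjoint) auto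
  also have "\<dots> = (\<Sum>r<m. cnj (A $$ (j, r)) * cnj (B $$ (r, i)))"
    unfolding index_mult_mat_sum[OF A B j i] by simp
  also have "\<dots> = (mat_adjoint B * mat_adjoint A) $$ (i, j)"
    unfolding index_mult_mat_sum[OF mat_adjoint_carrier[OF B] mat_adjoint_carrier[OF A] i j]
    using A B i j by (intro sum.cong) auto
  finally show "mat_adjoint (A * B) $$ (i, j) = (mat_adjoint B * mat_adjoint A) $$ (i, j)" .
qed (use A B in auto)

lemma mat_adjoint_adjoint [simp]: "mat_adjoint (mat_adjoint (A :: complex mat)) = A"
  by (rule eq_matI) auto

text \<open>Gram-Schmidt applied to a basis that starts with \<open>v\<close> keeps \<open>v\<close>
  in first place; normalizing the columns yields the unitary matrix for the deflation step of the
  spectral theorem.\<close>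

lemma exists_unitary_first_col:
  fixes v :: "complex vec"
  assumes v: "v \<in> carrier_vec n" and v0: "v \<noteq> 0\<^sub>v n"
  shows "\<exists>W k. W \<in> carrier_mat n n \<and> mat_adjoint W * W = 1\<^sub>m n \<and> col W 0 = k \<cdot>\<^sub>v v"
proof -
  interpret cof_vec_space n "TYPE(complex)" .
  have n: "n > 0"
  proof (rule Nat.gr0I)
    assume "n = 0"
    then have "v = 0\<^sub>v n" using v by (intro eq_vecI) auto
    then show False using v0 by simp
  qed
  define b where "b = basis_completion v"
  from basis_completion[OF v v0, folded b_def]
  have dist_b: "distinct b" and indep: "\<not> lin_dep (set b)" and b: "set b \<subseteq> carrier_vec n"
    and hdb: "hd b = v" and len_b: "length b = n" by auto
  from hdb len_b n obtain vs where bv: "b = v # vs" by (cases b) auto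
  define ws where "ws = gram_schmidt n b"
  from gram_schmidt_result[OF b dist_b indep refl, folded ws_def]
  have ws: "set ws \<subseteq> carrier_vec n" "corthogonal ws" "length ws = n"
    by (auto simp: len_b)
  have hdws: "ws ! 0 = v" using gram_schmidt_hd[OF v, of vs, folded bv] ws n
    unfolding ws_def by (subst hd_conv_nth[symmetric]) auto
  have wsc: "ws ! j \<in> carrier_vec n" if "j < n" for j using ws that by auto
  define s where "s j = (\<Sum>r<n. (cmod (ws ! j $ r))\<^sup>2)" for j
  define W where "W = mat n n (\<lambda>(i, j). ws ! j $ i / sqrt (s j))"
  have orth: "(\<Sum>r<n. ws ! i $ r * cnj (ws ! j $ r)) = (if i = j then s i else 0)"
    and s0: "s i \<noteq> 0" if "i < n" "j < n" for i j
  proof -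
    have *: "ws ! i \<bullet>c ws ! j = (\<Sum>r<n. ws ! i $ r * cnj (ws ! j $ r))" if "i < n" "j < n" for i j
      using wsc[OF that(1)] wsc[OF that(2)] by (auto simp: scalar_prod_def atLeast0LessThan intro!: sum.cong)
    have sq: "ws ! i \<bullet>c ws ! i = s i" if "i < n" for i
      unfolding *[OF that that] s_def by (simp add: complex_norm_square del: of_real_power)
    show "(\<Sum>r<n. ws ! i $ r * cnj (ws ! j $ r)) = (if i = j then s i else 0)"
      using corthogonalD[OF ws(2), of i j] *[of i j] sq that ws(3) by auto
    show "s i \<noteq> 0"
      using corthogonalD[OF ws(2), of i i] sq[of i] that ws(3) by auto
  qed
  have W: "W \<in> carrier_mat n n" by (simp add: W_def)
  have spos: "s i \<ge> 0" for i unfolding s_def by (intro sum_nonneg) auto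
  have "mat_adjoint W * W = 1\<^sub>m n"
  proof (rule eq_matI)
    fix i j assume "i < dim_row (1\<^sub>m n :: complex mat)" "j < dim_col (1\<^sub>m n :: complex mat)"
    then have ij: "i < n" "j < n" by auto
    have "(mat_adjoint W * W) $$ (i, j) = (\<Sum>r<n. cnj (W $$ (r, i)) * W $$ (r, j))"
      unfolding index_mult_mat_sum[OF mat_adjoint_carrier[OF W] W ij]
      using W ij by (intro sum.cong) auto
    also have "\<dots> = (\<Sum>r<n. ws ! j $ r * cnj (ws ! i $ r)) / (sqrt (s i) * sqrt (s j))"
      unfolding sum_divide_distrib using ij by (intro sum.cong) (auto simp: W_def)
    also have "\<dots> = (1\<^sub>m n) $$ (i, j)"
      using ij orth[of j i] s0[of i i] spos[of i]
      by (auto simp: of_real_mult[symmetric] simp del: of_real_mult)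
    finally show "(mat_adjoint W * W) $$ (i, j) = (1\<^sub>m n) $$ (i, j)" .
  qed (use W in auto)
  moreover have "col W 0 = (1 / complex_of_real (sqrt (s 0))) \<cdot>\<^sub>v v"
    using v n by (intro eq_vecI) (auto simp: W_def hdws)
  ultimately show ?thesis using W by blast
qed

definition real_diag :: "real list \<Rightarrow> complex mat" where
  "real_diag ds = mat (length ds) (length ds) (\<lambda>(i, j). if i = j then complex_of_real (ds ! i) else 0)"

lemma real_diag_carrier [simp]: "real_diag ds \<in> carrier_mat (length ds) (length ds)"
  by (simp add: real_diag_def)

lemma real_diag_Cons:
  "real_diag (d # ds) = four_block_mat (mat 1 1 (\<lambda>_. complex_of_real d)) (0\<^sub>m 1 (length ds)) (0\<^sub>m (length ds) 1) (real_diag ds)"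
  by (rule eq_matI) (auto simp: real_diag_def nth_Cons' four_block_mat_def Let_def)

lemma complex_has_eigenvalue:
  fixes A :: "complex mat"
  assumes A: "A \<in> carrier_mat n n" and n: "n > 0"
  obtains v e where "v \<in> carrier_vec n" "v \<noteq> 0\<^sub>v n" "A *\<^sub>v v = e \<cdot>\<^sub>v v"
proof -
  obtain as where as: "char_poly A = (\<Prod>a\<leftarrow>as. [:- a, 1:])" "length as = n"
    using char_poly_factorized[OF A] by auto
  then have "poly (char_poly A) (as ! 0) = 0"
    using n by (cases as) auto
  then have "eigenvalue A (as ! 0)" using eigenvalue_root_char_poly[OF A] by simp
  then show ?thesis using that A unfolding eigenvalue_def eigenvector_def by auto
qed

text \<open>Induction by deflation. In a unitary basis starting with an eigenvector, the first
  column is \<open>e\<close> times a unit vector; Hermitian symmetry clears the first row as well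
  and makes \<open>e\<close> real, and the remaining block is Hermitian of size
  \<open>m\<close>.\<close>

theorem hermitian_diagonalization:
  fixes A :: "complex mat"
  assumes "A \<in> carrier_mat n n" "mat_adjoint A = A"
  shows "\<exists>U ds. U \<in> carrier_mat n n \<and> length ds = n \<and> mat_adjoint U * U = 1\<^sub>m n \<and>
           A = U * real_diag ds * mat_adjoint U"
  using assms
proof (induction n arbitrary: A)
  case 0
  then have "A = 1\<^sub>m 0" by (intro eq_matI) auto
  then show ?case using 0
    by (intro exI[of _ A] exI[of _ "[]"]) (auto simp: real_diag_def intro!: eq_matI)
next
  case (Suc m A)
  let ?n = "Suc m"
  note A = Suc.prems(1) and herm = Suc.prems(2)
  obtain v e where v: "v \<in> carrier_vec ?n" "v \<noteq> 0\<^sub>v ?n" "A *\<^sub>v v = e \<cdot>\<^sub>v v"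
    using complex_has_eigenvalue[OF A] by auto
  obtain W k where W: "W \<in> carrier_mat ?n ?n" "mat_adjoint W * W = 1\<^sub>m ?n" "col W 0 = k \<cdot>\<^sub>v v"
    using exists_unitary_first_col[OF v(1,2)] by auto
  have W': "mat_adjoint W \<in> carrier_mat ?n ?n" using mat_adjoint_carrier[OF W(1)] .
  have WW': "W * mat_adjoint W = 1\<^sub>m ?n" using mat_mult_left_right_inverse[OF W' W(1) W(2)] .
  define B where "B = mat_adjoint W * (A * W)"
  have AW: "A * W \<in> carrier_mat ?n ?n" using A W(1) by simp
  have B: "B \<in> carrier_mat ?n ?n" unfolding B_def using W' AW by simp
  have hermB: "mat_adjoint B = B"
    unfolding B_def using mat_adjoint_mult[OF W' AW] mat_adjoint_mult[OF A W(1)] herm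
      assoc_mult_mat[OF W' A W(1)] by simp
  have "col B 0 = mat_adjoint W *\<^sub>v (A *\<^sub>v col W 0)"
    unfolding B_def using col_mult2[OF W' AW, of 0] col_mult2[OF A W(1), of 0] by simp
  also have "A *\<^sub>v col W 0 = e \<cdot>\<^sub>v col W 0"
    unfolding W(3) using v A by (simp add: mult_mat_vec smult_smult_assoc mult.commute)
  also have "mat_adjoint W *\<^sub>v (e \<cdot>\<^sub>v col W 0) = e \<cdot>\<^sub>v (mat_adjoint W *\<^sub>v col W 0)"
    using mult_mat_vec[OF W'] W(1) col_dim[of W 0] by (metis carrier_matD(1))
  also have "mat_adjoint W *\<^sub>v col W 0 = col (mat_adjoint W * W) 0"
    using col_mult2[OF W' W(1)] by simp
  finally have col0: "col B 0 = e \<cdot>\<^sub>v unit_vec ?n 0" unfolding W(2) by simp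
  have B0: "B $$ (i, 0) = (if i = 0 then e else 0)" if "i < ?n" for i
    using arg_cong[OF col0, of "\<lambda>u. vec_index u i"] that B by simp
  have Bcnj: "B $$ (i, j) = cnj (B $$ (j, i))" if "i < ?n" "j < ?n" for i j
    using arg_cong[OF hermB, of "\<lambda>M. index_mat M (i, j)"] that B by simp
  have e_real: "e = complex_of_real (Re e)"
    using Bcnj[of 0 0] B0[of 0] by (simp add: complex_eq_iff)
  have B0': "B $$ (0, j) = (if j = 0 then e else 0)" if "j < ?n" for j
    using Bcnj[of 0 j] B0[of j] B0[of 0] that Bcnj[of 0 0] by (auto split: if_splits)
  define C where "C = mat m m (\<lambda>(i, j). B $$ (Suc i, Suc j))"
  have C: "C \<in> carrier_mat m m" by (simp add: C_def)
  have "mat_adjoint C = C"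
    by (rule eq_matI) (auto simp: C_def intro: Bcnj[symmetric])
  from Suc.IH[OF C this] obtain U ds where U: "U \<in> carrier_mat m m" "length ds = m"
      "mat_adjoint U * U = 1\<^sub>m m" "C = U * real_diag ds * mat_adjoint U" by auto
  have U': "mat_adjoint U \<in> carrier_mat m m" using mat_adjoint_carrier[OF U(1)] .
  have D: "real_diag ds \<in> carrier_mat m m" using U(2) real_diag_carrier by metis
  let ?E = "mat 1 1 (\<lambda>_. e)"
  let ?bl = "\<lambda>X Y. four_block_mat X (0\<^sub>m 1 m) (0\<^sub>m m 1) Y"
  have bl_mult: "?bl X Y * ?bl X' Y' = ?bl (X * X') (Y * Y')"
    if "X \<in> carrier_mat 1 1" "X' \<in> carrier_mat 1 1" "Y \<in> carrier_mat m m" "Y' \<in> carrier_mat m m"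
    for X X' Y Y' :: "complex mat"
    using that by (subst mult_four_block_mat[OF that(1) _ _ that(3) that(2) _ _ that(4)]) auto
  have BC: "B = ?bl ?E C"
    using B by (intro eq_matI) (auto simp: C_def B0 B0' four_block_mat_def Let_def)
  define V where "V = ?bl (1\<^sub>m 1) U"
  have V: "V \<in> carrier_mat ?n ?n" unfolding V_def using U(1) four_block_carrier_mat[OF one_carrier_mat[of 1] U(1)] by simp
  have V': "mat_adjoint V = ?bl (1\<^sub>m 1) (mat_adjoint U)"
    unfolding V_def using U(1) by (intro eq_matI) (auto simp: four_block_mat_def Let_def)
  have RD: "real_diag (Re e # ds) = ?bl ?E (real_diag ds)"
    unfolding real_diag_Cons U(2) using e_real by simp
  have BV: "B = V * real_diag (Re e # ds) * mat_adjoint V"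
    unfolding BC V' RD unfolding V_def U(4)
    using U(1) U' D by (simp add: bl_mult del: One_nat_def)
  have VV: "mat_adjoint V * V = 1\<^sub>m ?n"
    unfolding V' unfolding V_def using U(1,3) U' by (simp add: bl_mult del: One_nat_def)
      (rule eq_matI, auto simp: four_block_mat_def Let_def)
  have RDc: "real_diag (Re e # ds) \<in> carrier_mat ?n ?n" using U(2) real_diag_carrier by (metis length_Cons)
  have Vc': "mat_adjoint V \<in> carrier_mat ?n ?n" using mat_adjoint_carrier[OF V] .
  have adjWV: "mat_adjoint (W * V) = mat_adjoint V * mat_adjoint W"
    using mat_adjoint_mult[OF W(1) V] .
  have "A = (W * mat_adjoint W) * A * (W * mat_adjoint W)"
    using A WW' by simp
  also have "\<dots> = W * B * mat_adjoint W"
    unfolding B_def using A W W' AW by (simp add: assoc_mult_mat[of _ ?n ?n _ ?n _ ?n])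
  also have "\<dots> = (W * V) * real_diag (Re e # ds) * mat_adjoint (W * V)"
    unfolding BV adjWV using A W(1) W' V Vc' RDc by (simp add: assoc_mult_mat[of _ ?n ?n _ ?n _ ?n])
  finally have A_eq: "A = (W * V) * real_diag (Re e # ds) * mat_adjoint (W * V)" .
  have "mat_adjoint (W * V) * (W * V) = mat_adjoint V * (mat_adjoint W * W) * V"
    unfolding adjWV using W(1) W' V Vc' by (simp add: assoc_mult_mat[of _ ?n ?n _ ?n _ ?n])
  also have "\<dots> = 1\<^sub>m ?n" unfolding W(2) using Vc' V VV by simp
  finally show ?case
    using A_eq W(1) V U(2) by (intro exI[of _ "W * V"] exI[of _ "Re e # ds"]) auto
qed

lemma char_poly_diagonalized:
  assumes U: "U \<in> carrier_mat n n" and ds: "length ds = n" and UU: "mat_adjoint U * U = 1\<^sub>m n"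
    and A: "A = U * real_diag ds * mat_adjoint U"
  shows "char_poly A = (\<Prod>x\<leftarrow>ds. [:- complex_of_real x, 1:])"
proof -
  have U': "mat_adjoint U \<in> carrier_mat n n" using mat_adjoint_carrier[OF U] .
  have D: "real_diag ds \<in> carrier_mat n n" using ds real_diag_carrier by metis
  have "similar_mat_wit A (real_diag ds) U (mat_adjoint U)"
    using U U' D UU mat_mult_left_right_inverse[OF U' U UU] A by (intro similar_mat_witI[of _ _ n]) auto
  then have "char_poly A = char_poly (real_diag ds)"
    by (intro char_poly_similar) (auto simp: similar_mat_def)
  also have "\<dots> = (\<Prod>a\<leftarrow>diag_mat (real_diag ds). [:- a, 1:])"
    by (rule char_poly_upper_triangular[OF D]) (auto simp: real_diag_def)
  also have "diag_mat (real_diag ds) = map complex_of_real ds"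
    by (auto simp: diag_mat_def real_diag_def intro!: nth_equalityI)
  finally show ?thesis by (simp add: o_def)
qed

lemma ordered_eigenvalues_eq_sort:
  assumes "char_poly A = (\<Prod>x\<leftarrow>ds. [:- complex_of_real x, 1:])"
  shows "ordered_eigenvalues A = sort ds"
proof (rule ordered_eigenvalues_eqI)
  show "char_poly A = (\<Prod>x\<leftarrow>sort ds. [:- complex_of_real x, 1:])"
    unfolding assms prod_mset_prod_list[symmetric] mset_map by simp
qed simp

section \<open>Quadratic forms and bounds for ordered eigenvalues\<close>

definition quad_form :: "complex mat \<Rightarrow> (nat \<Rightarrow> complex) \<Rightarrow> complex" where
  "quad_form A w = (\<Sum>i<dim_row A. \<Sum>j<dim_col A. cnj (w i) * A $$ (i, j) * w j)"

lemma quad_form_diagonalized: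
  fixes U :: "complex mat"
  assumes U: "U \<in> carrier_mat n n" and ds: "length ds = n" and A: "A = U * real_diag ds * mat_adjoint U"
  shows "quad_form A w = complex_of_real (\<Sum>k<n. ds ! k * (cmod (\<Sum>j<n. cnj (U $$ (j, k)) * w j))\<^sup>2)"
proof -
  have U': "mat_adjoint U \<in> carrier_mat n n" using mat_adjoint_carrier[OF U] .
  have D: "real_diag ds \<in> carrier_mat n n" using ds real_diag_carrier by metis
  have UD: "U * real_diag ds \<in> carrier_mat n n" using U D by simp
  have UDi: "(U * real_diag ds) $$ (i, k) = U $$ (i, k) * ds ! k" if "i < n" "k < n" for i k
  proof -
    have "(U * real_diag ds) $$ (i, k) = (\<Sum>r<n. if r = k then U $$ (i, k) * ds ! k else 0)"
      unfolding index_mult_mat_sum[OF U D that] using that ds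
      by (intro sum.cong) (auto simp: real_diag_def)
    then show ?thesis using that by simp
  qed
  have Aij: "A $$ (i, j) = (\<Sum>k<n. ds ! k * U $$ (i, k) * cnj (U $$ (j, k)))" if "i < n" "j < n" for i j
    unfolding A index_mult_mat_sum[OF UD U' that] using that U
    by (intro sum.cong) (auto simp: UDi)
  have Ad: "dim_row A = n" "dim_col A = n" using A UD U' by auto
  have "quad_form A w = (\<Sum>i<n. \<Sum>j<n. \<Sum>k<n. ds ! k * (cnj (cnj (U $$ (i, k)) * w i) * (cnj (U $$ (j, k)) * w j)))"
    unfolding quad_form_def Ad
    by (intro sum.cong refl) (simp add: Aij sum_distrib_left sum_distrib_right algebra_simps)
  also have "\<dots> = (\<Sum>i<n. \<Sum>k<n. \<Sum>j<n. ds ! k * (cnj (cnj (U $$ (i, k)) * w i) * (cnj (U $$ (j, k)) * w j)))"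
    by (rule sum.cong[OF refl], rule sum.swap)
  also have "\<dots> = (\<Sum>k<n. \<Sum>i<n. \<Sum>j<n. ds ! k * (cnj (cnj (U $$ (i, k)) * w i) * (cnj (U $$ (j, k)) * w j)))"
    by (rule sum.swap)
  also have "\<dots> = (\<Sum>k<n. ds ! k * (cnj (\<Sum>j<n. cnj (U $$ (j, k)) * w j) * (\<Sum>j<n. cnj (U $$ (j, k)) * w j)))"
    by (simp only: cnj_sum sum_product) (simp only: sum_distrib_left)
  also have "\<dots> = complex_of_real (\<Sum>k<n. ds ! k * (cmod (\<Sum>j<n. cnj (U $$ (j, k)) * w j))\<^sup>2)"
    by (simp add: complex_norm_square mult.commute del: of_real_power)
  finally show ?thesis .
qed

text \<open>This is the diagonalized quadratic form of the identity matrix, all of whose eigenvalues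
  are 1.\<close>

lemma unitary_norm:
  fixes U :: "complex mat"
  assumes U: "U \<in> carrier_mat n n" and UU: "mat_adjoint U * U = 1\<^sub>m n"
  shows "(\<Sum>k<n. (cmod (\<Sum>j<n. cnj (U $$ (j, k)) * w j))\<^sup>2) = (\<Sum>j<n. (cmod (w j))\<^sup>2)"
proof -
  have U': "mat_adjoint U \<in> carrier_mat n n" using mat_adjoint_carrier[OF U] .
  define ds where "ds = replicate n (1::real)"
  have ds: "length ds = n" by (simp add: ds_def)
  have D: "real_diag ds = 1\<^sub>m n" by (rule eq_matI) (auto simp: real_diag_def ds_def)
  have "1\<^sub>m n = U * real_diag ds * mat_adjoint U"
    unfolding D using U U' mat_mult_left_right_inverse[OF U' U UU] by simp
  from quad_form_diagonalized[OF U ds this, of w]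
  have "complex_of_real (\<Sum>k<n. (cmod (\<Sum>j<n. cnj (U $$ (j, k)) * w j))\<^sup>2) = quad_form (1\<^sub>m n) w"
    by (simp add: ds_def)
  also have "\<dots> = (\<Sum>i<n. \<Sum>j<n. if j = i then cnj (w i) * w i else 0)"
    unfolding quad_form_def by (intro sum.cong) auto
  also have "\<dots> = complex_of_real (\<Sum>j<n. (cmod (w j))\<^sup>2)"
    by (simp add: complex_norm_square mult.commute del: of_real_power)
  finally show ?thesis by (simp only: of_real_eq_iff)
qed

lemma sort_nth_le:
  fixes ds :: "real list"
  assumes "card {k. k < length ds \<and> ds ! k \<le> \<epsilon>} \<ge> q" "q \<ge> 1"
  shows "sort ds ! (q - 1) \<le> \<epsilon>"
proof (rule ccontr)
  assume neg: "\<not> ?thesis"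
  have "q \<le> length (filter (\<lambda>x. x \<le> \<epsilon>) ds)"
    using assms(1) by (simp add: length_filter_conv_card)
  also have "\<dots> = length (filter (\<lambda>x. x \<le> \<epsilon>) (sort ds))"
    by (simp add: filter_sort)
  also have "\<dots> = card {k. k < length (sort ds) \<and> sort ds ! k \<le> \<epsilon>}"
    by (rule length_filter_conv_card)
  also have "\<dots> \<le> card {..<q - 1}"
  proof (rule card_mono)
    show "{k. k < length (sort ds) \<and> sort ds ! k \<le> \<epsilon>} \<subseteq> {..<q - 1}"
    proof clarify
      fix k assume k: "k < length (sort ds)" "sort ds ! k \<le> \<epsilon>"
      show "k < q - 1"
      proof (rule ccontr)
        assume "\<not> k < q - 1"
        then have "sort ds ! (q - 1) \<le> sort ds ! k"
          using k(1) by (intro sorted_nth_mono) auto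
        then show False using neg k(2) by simp
      qed
    qed
  qed simp
  finally show False using assms(2) by simp
qed

text \<open>Padding the \<open>m\<close> equations with zero rows gives a square matrix whose last
  row is zero, hence a singular one.\<close>

lemma homogeneous_system_nontrivial:
  fixes M :: "nat \<Rightarrow> nat \<Rightarrow> complex"
  assumes "m < q"
  shows "\<exists>c. (\<exists>r<q. c r \<noteq> 0) \<and> (\<forall>a<m. (\<Sum>r<q. M a r * c r) = 0)"
proof -
  define N where "N = mat q q (\<lambda>(a, r). if a < m then M a r else 0)"
  have N: "N \<in> carrier_mat q q" by (simp add: N_def)
  have "N = mat\<^sub>r q q (\<lambda>i. if i = q - 1 then 0\<^sub>v q else row N i)"
    using assms by (intro eq_matI) (auto simp: N_def)
  then have "det N = 0"
    using det_row_0[of "q - 1" q "\<lambda>i. row N i"] assms N by fastforce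
  then obtain v where v: "v \<in> carrier_vec q" "v \<noteq> 0\<^sub>v q" "N *\<^sub>v v = 0\<^sub>v q"
    using det_0_iff_vec_prod_zero[OF N] by auto
  have "\<exists>r<q. vec_index v r \<noteq> 0"
    using v(1,2) by (metis eq_vecI carrier_vecD index_zero_vec)
  moreover have "(\<Sum>r<q. M a r * vec_index v r) = 0" if "a < m" for a
  proof -
    have "(\<Sum>r<q. M a r * vec_index v r) = vec_index (N *\<^sub>v v) a"
      using that assms v(1) by (auto simp: N_def scalar_prod_def atLeast0LessThan intro!: sum.cong)
    then show ?thesis using v(3) that assms by simp
  qed
  ultimately show ?thesis by blast
qed

text \<open>The easy half of the Courant--Fischer min-max principle.\<close>

theorem ordered_eigenvalues_le:
  fixes A :: "complex mat" and V :: "nat \<Rightarrow> nat \<Rightarrow> complex"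
  assumes A: "A \<in> carrier_mat n n" "mat_adjoint A = A" and q: "q \<ge> 1"
    and V: "\<And>c. \<exists>r<q. c r \<noteq> 0 \<Longrightarrow> (\<exists>i<n. (\<Sum>r<q. V i r * c r) \<noteq> 0) \<and>
      Re (quad_form A (\<lambda>i. \<Sum>r<q. V i r * c r)) \<le> \<epsilon> * (\<Sum>i<n. (cmod (\<Sum>r<q. V i r * c r))\<^sup>2)"
  shows "ordered_eigenvalues A ! (q - 1) \<le> \<epsilon>"
proof -
  obtain U ds where U: "U \<in> carrier_mat n n" "length ds = n" "mat_adjoint U * U = 1\<^sub>m n"
    "A = U * real_diag ds * mat_adjoint U"
    using hermitian_diagonalization[OF A] by blast
  define I where "I = {k. k < length ds \<and> ds ! k \<le> \<epsilon>}"
  have finI: "finite I" by (simp add: I_def)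
  have "q \<le> card I"
  proof (rule ccontr)
    assume "\<not> q \<le> card I"
    then have lt: "card I < q" by simp
    obtain ks where ks: "set ks = I" "length ks = card I"
      using finite_distinct_list[OF finI] distinct_card by metis
    define y where "y w k = (\<Sum>j<n. cnj (U $$ (j, k)) * w j)" for w k
    \<comment> \<open>Fewer than \<open>q\<close> eigenvectors belong to eigenvalues at most
      \<open>\<epsilon>\<close>, so some nonzero combination of the \<open>q\<close> test vectors is
      orthogonal to all of them. On it the form exceeds \<open>\<epsilon>\<close> times the squared
      norm unless the vector is zero.\<close>
    from homogeneous_system_nontrivial[OF lt, of "\<lambda>a r. \<Sum>j<n. cnj (U $$ (j, ks ! a)) * V j r"]
    obtain c where c: "\<exists>r<q. c r \<noteq> 0"
      "\<forall>a<card I. (\<Sum>r<q. (\<Sum>j<n. cnj (U $$ (j, ks ! a)) * V j r) * c r) = 0"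
      by (elim exE conjE) (rule that, rule exI, rule conjI, assumption+)
    define w where "w i = (\<Sum>r<q. V i r * c r)" for i
    have y0: "y w k = 0" if "k \<in> I" for k
    proof -
      have "k \<in> set ks" using that ks(1) by simp
      then obtain a where "a < length ks" "ks ! a = k" by (auto simp: in_set_conv_nth)
      then have a: "a < card I" "k = ks ! a" using ks(2) by auto
      have "y w k = (\<Sum>j<n. \<Sum>r<q. cnj (U $$ (j, k)) * V j r * c r)"
        unfolding y_def w_def by (simp add: sum_distrib_left mult.assoc)
      also have "\<dots> = (\<Sum>r<q. (\<Sum>j<n. cnj (U $$ (j, k)) * V j r) * c r)"
        by (subst sum.swap) (simp add: sum_distrib_right)
      finally show ?thesis using c(2)[rule_format, OF a(1)] a(2) by simp
    qed
    have norm: "(\<Sum>k<n. (cmod (y w k))\<^sup>2) = (\<Sum>j<n. (cmod (w j))\<^sup>2)"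
      unfolding y_def by (rule unitary_norm[OF U(1,3)])
    have "Re (quad_form A w) \<le> \<epsilon> * (\<Sum>k<n. (cmod (y w k))\<^sup>2)"
      using V[OF c(1)] unfolding norm w_def by simp
    moreover have "Re (quad_form A w) = (\<Sum>k<n. ds ! k * (cmod (y w k))\<^sup>2)"
      unfolding quad_form_diagonalized[OF U(1,2,4)] y_def by (rule Re_complex_of_real)
    ultimately have le: "(\<Sum>k<n. (ds ! k - \<epsilon>) * (cmod (y w k))\<^sup>2) \<le> 0"
      by (simp add: sum_subtractf left_diff_distrib sum_distrib_left)
    have nonneg: "(ds ! k - \<epsilon>) * (cmod (y w k))\<^sup>2 \<ge> 0" if "k \<in> {..<n}" for k
      using y0[of k] that U(2) unfolding I_def by (cases "ds ! k \<le> \<epsilon>") auto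
    have "(\<Sum>k<n. (ds ! k - \<epsilon>) * (cmod (y w k))\<^sup>2) = 0"
      using le sum_nonneg[OF nonneg] by (rule antisym)
    then have z: "(ds ! k - \<epsilon>) * (cmod (y w k))\<^sup>2 = 0" if "k < n" for k
      using sum_nonneg_eq_0_iff[of "{..<n}" "\<lambda>k. (ds ! k - \<epsilon>) * (cmod (y w k))\<^sup>2"] nonneg that by auto
    have "y w k = 0" if "k < n" for k
      using z[OF that] y0[of k] that U(2) unfolding I_def by (cases "ds ! k \<le> \<epsilon>") auto
    then have "(\<Sum>j<n. (cmod (w j))\<^sup>2) = 0" using norm by simp
    then have "\<forall>j<n. w j = 0" by (subst (asm) sum_nonneg_eq_0_iff) auto
    then show False using V[OF c(1)] unfolding w_def by auto
  qed
  then have "sort ds ! (q - 1) \<le> \<epsilon>"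
    unfolding I_def by (rule sort_nth_le) (fact q)
  then show ?thesis
    using ordered_eigenvalues_eq_sort[OF char_poly_diagonalized[OF U]] by simp
qed

text \<open>Evaluating the form at the \<open>k\<close>-th column of \<open>U\<close> returns the
  \<open>k\<close>-th eigenvalue.\<close>

theorem ordered_eigenvalues_nonneg:
  fixes A :: "complex mat"
  assumes A: "A \<in> carrier_mat n n" "mat_adjoint A = A" and q: "q < n"
    and psd: "\<And>w. Re (quad_form A w) \<ge> 0"
  shows "ordered_eigenvalues A ! q \<ge> 0"
proof -
  obtain U ds where U: "U \<in> carrier_mat n n" "length ds = n" "mat_adjoint U * U = 1\<^sub>m n"
    "A = U * real_diag ds * mat_adjoint U"
    using hermitian_diagonalization[OF A] by blast
  have "ds ! k \<ge> 0" if k: "k < n" for k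
  proof -
    have orth: "(\<Sum>j<n. cnj (U $$ (j, k')) * U $$ (j, k)) = (if k' = k then 1 else 0)" if "k' < n" for k'
    proof -
      have "(\<Sum>j<n. cnj (U $$ (j, k')) * U $$ (j, k)) = (mat_adjoint U * U) $$ (k', k)"
        unfolding index_mult_mat_sum[OF mat_adjoint_carrier[OF U(1)] U(1) that k]
        using that k U(1) by (intro sum.cong) auto
      then show ?thesis using U(3) that k by simp
    qed
    have "(\<Sum>k'<n. ds ! k' * (cmod (\<Sum>j<n. cnj (U $$ (j, k')) * U $$ (j, k)))\<^sup>2) =
        (\<Sum>k'<n. if k' = k then ds ! k else 0)"
      by (intro sum.cong) (auto simp: orth)
    also have "\<dots> = ds ! k" using k by simp
    finally show ?thesis
      using psd[of "\<lambda>j. U $$ (j, k)"] unfolding quad_form_diagonalized[OF U(1,2,4)] Re_complex_of_real by simp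
  qed
  then have "\<forall>x\<in>set (sort ds). x \<ge> 0" using U(2) by (auto simp: in_set_conv_nth)
  then show ?thesis
    using ordered_eigenvalues_eq_sort[OF char_poly_diagonalized[OF U]] U(2) q
    by (metis length_sort nth_mem)
qed

section \<open>Dirichlet characters\<close>

definition dirichlet_characters :: "nat \<Rightarrow> (nat \<Rightarrow> complex) set" where
  "dirichlet_characters b = {\<chi>. \<chi> 1 = 1 \<and> (\<forall>m n. \<chi> (m * n) = \<chi> m * \<chi> n) \<and>
     (\<forall>m n. [m = n] (mod b) \<longrightarrow> \<chi> m = \<chi> n) \<and> (\<forall>n. \<not> coprime n b \<longrightarrow> \<chi> n = 0)}"

lemma dirichlet_characterI:
  assumes "\<chi> 1 = 1" "\<And>m n. \<chi> (m * n) = \<chi> m * \<chi> n"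
    and "\<And>m n. [m = n] (mod b) \<Longrightarrow> \<chi> m = \<chi> n" "\<And>n. \<not> coprime n b \<Longrightarrow> \<chi> n = 0"
  shows "\<chi> \<in> dirichlet_characters b"
  unfolding dirichlet_characters_def mem_Collect_eq by (intro conjI allI impI; (rule assms; assumption?))

lemma dirichlet_characterD:
  assumes "\<chi> \<in> dirichlet_characters b"
  shows "\<chi> 1 = 1" "\<chi> (Suc 0) = 1" "\<chi> (m * n) = \<chi> m * \<chi> n" "\<not> coprime n b \<Longrightarrow> \<chi> n = 0"
    and "[m = n] (mod b) \<Longrightarrow> \<chi> m = \<chi> n" "\<chi> (n mod b) = \<chi> n" "\<chi> (n + b) = \<chi> n"
proof -
  note D = assms[unfolded dirichlet_characters_def mem_Collect_eq]
  show "\<chi> 1 = 1" "\<chi> (Suc 0) = 1" using D[THEN conjunct1] by simp_all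
  show "\<chi> (m * n) = \<chi> m * \<chi> n" using D[THEN conjunct2, THEN conjunct1] by simp
  show "\<not> coprime n b \<Longrightarrow> \<chi> n = 0"
    using D[THEN conjunct2, THEN conjunct2, THEN conjunct2] by simp
  have cong: "[m = n] (mod b) \<Longrightarrow> \<chi> m = \<chi> n" for m n
    by (rule D[THEN conjunct2, THEN conjunct2, THEN conjunct1, rule_format])
  show "[m = n] (mod b) \<Longrightarrow> \<chi> m = \<chi> n" by (rule cong)
  show "\<chi> (n mod b) = \<chi> n" by (rule cong) (simp add: cong_def)
  show "\<chi> (n + b) = \<chi> n" by (rule cong) (simp add: cong_def)
qed

lemma dirichlet_character_power:
  assumes "\<chi> \<in> dirichlet_characters b" shows "\<chi> (n ^ k) = \<chi> n ^ k"
  by (induction k) (simp_all add: dirichlet_characterD[OF assms])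

definition principal_character :: "nat \<Rightarrow> nat \<Rightarrow> complex" where
  "principal_character b n = (if coprime n b then 1 else 0)"

text \<open>A character of a subgroup of the units modulo \<open>b\<close>, encoded without residue
  classes as a set of naturals closed under congruence. Closure under inverses is automatic, since
  by Euler's theorem inverses are powers.\<close>

definition partial_character :: "nat \<Rightarrow> nat set \<Rightarrow> (nat \<Rightarrow> complex) \<Rightarrow> bool" where
  "partial_character b H \<psi> \<longleftrightarrow> H \<subseteq> {n. coprime n b} \<and> 1 \<in> H \<and> \<psi> 1 = 1 \<and>
     (\<forall>m\<in>H. \<forall>n\<in>H. m * n \<in> H \<and> \<psi> (m * n) = \<psi> m * \<psi> n) \<and>
     (\<forall>m\<in>H. \<forall>n. [n = m] (mod b) \<longrightarrow> n \<in> H \<and> \<psi> n = \<psi> m)"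

lemma partial_characterD:
  assumes "partial_character b H \<psi>"
  shows "1 \<in> H" "\<psi> 1 = 1" "m \<in> H \<Longrightarrow> coprime m b"
    and "m \<in> H \<Longrightarrow> n \<in> H \<Longrightarrow> m * n \<in> H" "m \<in> H \<Longrightarrow> n \<in> H \<Longrightarrow> \<psi> (m * n) = \<psi> m * \<psi> n"
    and "m \<in> H \<Longrightarrow> [n = m] (mod b) \<Longrightarrow> n \<in> H" "m \<in> H \<Longrightarrow> [n = m] (mod b) \<Longrightarrow> \<psi> n = \<psi> m"
proof -
  note D = assms[unfolded partial_character_def]
  note * = D[THEN conjunct1] D[THEN conjunct2, THEN conjunct1]
    D[THEN conjunct2, THEN conjunct2, THEN conjunct1]
    D[THEN conjunct2, THEN conjunct2, THEN conjunct2, THEN conjunct1]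
    D[THEN conjunct2, THEN conjunct2, THEN conjunct2, THEN conjunct2]
  show "1 \<in> H" "\<psi> 1 = 1" by (fact *)+
  show "m \<in> H \<Longrightarrow> coprime m b" using *(1) by blast
  show "m \<in> H \<Longrightarrow> n \<in> H \<Longrightarrow> m * n \<in> H" "m \<in> H \<Longrightarrow> n \<in> H \<Longrightarrow> \<psi> (m * n) = \<psi> m * \<psi> n"
    using *(4)[rule_format, of m n] by simp_all
  show "m \<in> H \<Longrightarrow> [n = m] (mod b) \<Longrightarrow> n \<in> H" "m \<in> H \<Longrightarrow> [n = m] (mod b) \<Longrightarrow> \<psi> n = \<psi> m"
    using *(5)[rule_format, of m n] by simp_all
qed

lemma partial_character_power:
  assumes "partial_character b H \<psi>" "m \<in> H"
  shows "m ^ k \<in> H" "\<psi> (m ^ k) = \<psi> m ^ k"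
proof -
  have "m ^ k \<in> H \<and> \<psi> (m ^ k) = \<psi> m ^ k"
  proof (induction k)
    case 0
    show ?case using partial_characterD(1,2)[OF assms(1)] by simp
  next
    case (Suc k)
    then show ?case by (simp add: partial_characterD(4,5)[OF assms])
  qed
  then show "m ^ k \<in> H" "\<psi> (m ^ k) = \<psi> m ^ k" by auto
qed

lemma partial_character_inverse:
  assumes H: "partial_character b H \<psi>" and m: "m \<in> H" and b: "b > 0"
  shows "m ^ (totient b - 1) \<in> H" "[m ^ (totient b - 1) * m = 1] (mod b)"
proof -
  show "m ^ (totient b - 1) \<in> H" by (rule partial_character_power[OF H m])
  have "coprime m b" using partial_characterD(3)[OF H m] .
  moreover have "m ^ (totient b - 1) * m = m ^ totient b"
    using b by (cases "totient b") auto
  ultimately show "[m ^ (totient b - 1) * m = 1] (mod b)"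
    using euler_theorem by auto
qed

lemma partial_character_cancel:
  assumes H: "partial_character b H \<psi>" and m: "m \<in> H" and mn: "m * n \<in> H" and b: "b > 0"
  shows "n \<in> H"
proof -
  let ?i = "m ^ (totient b - 1)"
  note inv = partial_character_inverse[OF H m b]
  have "?i * (m * n) \<in> H" using partial_characterD(4)[OF H inv(1) mn] .
  moreover have "[n = ?i * (m * n)] (mod b)"
    using cong_scalar_right[OF inv(2), of n] by (simp add: mult.assoc cong_sym_eq)
  ultimately show ?thesis by (rule partial_characterD(6)[OF H])
qed

lemma partial_character_nonzero:
  assumes H: "partial_character b H \<psi>" and m: "m \<in> H" and b: "b > 0"
  shows "\<psi> m \<noteq> 0"
proof
  assume "\<psi> m = 0"
  note inv = partial_character_inverse[OF H m b]
  have "\<psi> (m ^ (totient b - 1) * m) = 0"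
    using partial_characterD(5)[OF H inv(1) m] \<open>\<psi> m = 0\<close> by simp
  moreover have "\<psi> (m ^ (totient b - 1) * m) = \<psi> 1"
    by (rule partial_characterD(7)[OF H partial_characterD(1)[OF H] inv(2)])
  ultimately show False using partial_characterD(2)[OF H] by simp
qed

text \<open>The extension sends \<open>m * g ^ i\<close> to \<open>\<psi> m * z ^ i\<close>. It is
  well defined because the exponents \<open>t\<close> with \<open>g ^ t \<in> H\<close> are
  multiples of the least positive one \<open>k\<close>, and \<open>z\<close> is a
  \<open>k\<close>-th root of \<open>\<psi> (g ^ k)\<close>.\<close>

lemma extend_partial_character:
  assumes H: "partial_character b H \<psi>" and b: "b > 0" and g: "coprime g b"
    and k: "k > 0" "g ^ k \<in> H" "\<And>j. 0 < j \<Longrightarrow> j < k \<Longrightarrow> g ^ j \<notin> H"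
    and z: "z ^ k = \<psi> (g ^ k)"
  shows "\<exists>H' \<psi>'. partial_character b H' \<psi>' \<and> H \<subseteq> H' \<and> g \<in> H' \<and> (\<forall>n\<in>H. \<psi>' n = \<psi> n) \<and> \<psi>' g = z"
proof -
  note H1 = partial_characterD(1,2)[OF H] and Hco = partial_characterD(3)[OF H]
    and Hmult = partial_characterD(4,5)[OF H] and Hcong = partial_characterD(6,7)[OF H]
  have pw: "\<psi> (g ^ t) = z ^ t" if t: "g ^ t \<in> H" for t
  proof -
    have eq: "g ^ t = (g ^ k) ^ (t div k) * g ^ (t mod k)"
      by (simp flip: power_mult power_add)
    have "g ^ (t mod k) \<in> H"
      by (rule partial_character_cancel[OF H partial_character_power(1)[OF H k(2), of "t div k"] _ b])
         (use t eq in simp)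
    then have "t mod k = 0" using k(3)[of "t mod k"] k(1) by auto
    then have "g ^ t = (g ^ k) ^ (t div k)" using eq by simp
    then have "\<psi> (g ^ t) = (z ^ k) ^ (t div k)"
      using partial_character_power(2)[OF H k(2)] z by simp
    also have "\<dots> = z ^ (k * (t div k))" by (simp add: power_mult)
    also have "k * (t div k) = t" using \<open>t mod k = 0\<close> by auto
    finally show ?thesis .
  qed
  have wd1: "\<psi> m * z ^ i = \<psi> n * z ^ j"
    if mn: "m \<in> H" "n \<in> H" and c: "[m * g ^ i = n * g ^ j] (mod b)" and ij: "i \<le> j" for m n i j
  proof -
    have "n * g ^ j = n * g ^ (j - i) * g ^ i" using ij by (simp add: mult.assoc flip: power_add)
    then have "[m * g ^ i = n * g ^ (j - i) * g ^ i] (mod b)" using c by (simp only:)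
    then have "[m = n * g ^ (j - i)] (mod b)"
      using g cong_mult_rcancel_nat[of "g ^ i" b m "n * g ^ (j - i)"] by simp
    then have *: "n * g ^ (j - i) \<in> H" "\<psi> (n * g ^ (j - i)) = \<psi> m"
      by - (rule Hcong[OF mn(1) cong_sym], assumption)+
    then have gH: "g ^ (j - i) \<in> H" using partial_character_cancel[OF H mn(2) _ b] by blast
    have "\<psi> m = \<psi> n * z ^ (j - i)" using *(2) Hmult(2)[OF mn(2) gH] pw[OF gH] by simp
    then show ?thesis using ij by (simp add: mult.assoc flip: power_add)
  qed
  have wd: "\<psi> m * z ^ i = \<psi> n * z ^ j"
    if "m \<in> H" "n \<in> H" "[m * g ^ i = n * g ^ j] (mod b)" for m n i j
    using wd1[OF that] wd1[OF that(2,1) cong_sym[OF that(3)]] by (cases "i \<le> j") auto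
  define H' where "H' = {n. \<exists>m\<in>H. \<exists>i. [n = m * g ^ i] (mod b)}"
  \<comment> \<open>By \<open>wd\<close> the value does not depend on the representation that is
    chosen.\<close>
  define \<psi>' where "\<psi>' n = (SOME w. \<exists>m\<in>H. \<exists>i. [n = m * g ^ i] (mod b) \<and> w = \<psi> m * z ^ i)" for n
  have \<psi>': "\<psi>' n = \<psi> m * z ^ i" if m: "m \<in> H" and c: "[n = m * g ^ i] (mod b)" for n m i
  proof -
    have "\<exists>w. \<exists>m\<in>H. \<exists>i. [n = m * g ^ i] (mod b) \<and> w = \<psi> m * z ^ i" using m c by blast
    from someI_ex[OF this] obtain m' i' where "m' \<in> H" "[n = m' * g ^ i'] (mod b)" "\<psi>' n = \<psi> m' * z ^ i'"
      unfolding \<psi>'_def by blast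
    moreover have "\<psi> m' * z ^ i' = \<psi> m * z ^ i"
      using calculation m c by (intro wd) (simp_all add: cong_def)
    ultimately show ?thesis by simp
  qed
  have sub: "H \<subseteq> H'" unfolding H'_def by (auto intro!: bexI exI[of _ 0])
  have \<psi>H: "\<psi>' n = \<psi> n" if "n \<in> H" for n using \<psi>'[OF that, of n 0] by simp
  have gH': "g \<in> H'" unfolding H'_def using H1 by (auto intro!: bexI[of _ 1] exI[of _ 1])
  have \<psi>g: "\<psi>' g = z" using \<psi>'[OF H1(1), of g 1] H1 by simp
  have "partial_character b H' \<psi>'"
    unfolding partial_character_def
  proof (intro conjI ballI allI impI subsetI)
    fix n assume "n \<in> H'"
    then obtain m i where mi: "m \<in> H" "[n = m * g ^ i] (mod b)" by (auto simp: H'_def)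
    have "coprime (m * g ^ i) b" using Hco[OF mi(1)] g by simp
    then show "n \<in> {n. coprime n b}" using mi(2) by (auto intro: cong_imp_coprime cong_sym)
  next
    show "1 \<in> H'" "\<psi>' 1 = 1" using sub H1 \<psi>H by auto
  next
    fix m n assume "m \<in> H'" "n \<in> H'"
    then obtain m1 i n1 j where *: "m1 \<in> H" "[m = m1 * g ^ i] (mod b)" "n1 \<in> H" "[n = n1 * g ^ j] (mod b)"
      by (auto simp: H'_def)
    have c: "[m * n = (m1 * n1) * g ^ (i + j)] (mod b)"
      using cong_mult[OF *(2,4)] by (simp add: power_add mult_ac)
    then show "m * n \<in> H'" unfolding H'_def using Hmult(1)[OF *(1,3)] by blast
    show "\<psi>' (m * n) = \<psi>' m * \<psi>' n"
      using \<psi>'[OF Hmult(1)[OF *(1,3)] c] \<psi>'[OF *(1,2)] \<psi>'[OF *(3,4)] Hmult(2)[OF *(1,3)]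
      by (simp add: power_add)
  next
    fix m n assume "m \<in> H'" and c: "[n = m] (mod b)"
    then obtain m1 i where *: "m1 \<in> H" "[m = m1 * g ^ i] (mod b)" by (auto simp: H'_def)
    have **: "[n = m1 * g ^ i] (mod b)" using c *(2) by (rule cong_trans)
    then show "n \<in> H'" unfolding H'_def using *(1) by blast
    show "\<psi>' n = \<psi>' m" using \<psi>'[OF *(1) **] \<psi>'[OF *] by simp
  qed
  then show ?thesis using sub gH' \<psi>H \<psi>g by blast
qed

lemma least_power_in_partial_character:
  assumes H: "partial_character b H \<psi>" and b: "b > 0" and g: "coprime g b"
  obtains k where "k > 0" "g ^ k \<in> H" "\<And>j. 0 < j \<Longrightarrow> j < k \<Longrightarrow> g ^ j \<notin> H"
proof -
  have "g ^ totient b \<in> H"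
    by (rule partial_characterD(6)[OF H partial_characterD(1)[OF H] euler_theorem[OF g]])
  then have "\<exists>k>0. g ^ k \<in> H" using b by (intro exI[of _ "totient b"]) auto
  then show ?thesis
    using that[of "LEAST k. 0 < k \<and> g ^ k \<in> H"] LeastI_ex[of "\<lambda>k. 0 < k \<and> g ^ k \<in> H"]
      not_less_Least[of _ "\<lambda>k. 0 < k \<and> g ^ k \<in> H"] by auto
qed

text \<open>Missing units are adjoined one at a time; the induction is on the number of unit
  residues outside \<open>H\<close>.\<close>

lemma partial_character_extends:
  assumes "partial_character b H \<psi>" and b: "b > 0"
  shows "\<exists>\<chi>\<in>dirichlet_characters b. \<forall>n\<in>H. \<chi> n = \<psi> n"
  using assms(1)
proof (induction "card ({n\<in>{..<b}. coprime n b} - H)" arbitrary: H \<psi> rule: less_induct)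
  case less
  note H = less.prems
  show ?case
  proof (cases "{n. coprime n b} \<subseteq> H")
    case True
    then have HU: "n \<in> H \<longleftrightarrow> coprime n b" for n using partial_characterD(3)[OF H] by auto
    define \<chi> where "\<chi> n = (if coprime n b then \<psi> n else 0)" for n
    have "\<chi> \<in> dirichlet_characters b"
    proof (rule dirichlet_characterI)
      fix m n assume "[m = n] (mod b)"
      moreover from this have "coprime m b \<longleftrightarrow> coprime n b"
        using cong_imp_coprime cong_sym by blast
      ultimately show "\<chi> m = \<chi> n"
        using partial_characterD(7)[OF H, of n m] HU by (simp add: \<chi>_def)
    next
      fix m n show "\<chi> (m * n) = \<chi> m * \<chi> n"
        using partial_characterD(5)[OF H, of m n] HU by (simp add: \<chi>_def)
    qed (use partial_characterD(2)[OF H] in \<open>auto simp: \<chi>_def\<close>)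
    then show ?thesis by (intro bexI[of _ \<chi>]) (auto simp: \<chi>_def HU)
  next
    case False
    then obtain g where g: "coprime g b" "g \<notin> H" by auto
    obtain k where k: "k > 0" "g ^ k \<in> H" "\<And>j. 0 < j \<Longrightarrow> j < k \<Longrightarrow> g ^ j \<notin> H"
      using least_power_in_partial_character[OF H b g(1)] by blast
    \<comment> \<open>A \<open>k\<close>-th root, available because \<open>\<psi>\<close> does not
      vanish on \<open>H\<close>.\<close>
    define z where "z = exp (Ln (\<psi> (g ^ k)) / of_nat k)"
    have "z ^ k = \<psi> (g ^ k)"
      using partial_character_nonzero[OF H k(2) b] k(1) unfolding z_def
      by (simp flip: exp_of_nat_mult)
    from extend_partial_character[OF H b g(1) k this] obtain H' \<psi>'
      where H': "partial_character b H' \<psi>'" "H \<subseteq> H'" "g \<in> H'" "\<forall>n\<in>H. \<psi>' n = \<psi> n" by blast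
    have gm: "g mod b \<in> {n \<in> {..<b}. coprime n b}" using b g by simp
    have "g mod b \<notin> H"
    proof
      assume "g mod b \<in> H"
      then have "g \<in> H" by (rule partial_characterD(6)[OF H]) (simp add: cong_def)
      then show False using g by simp
    qed
    moreover have "g mod b \<in> H'" 
      by (rule partial_characterD(6)[OF H'(1,3)]) (simp add: cong_def)
    ultimately have "{n\<in>{..<b}. coprime n b} - H' \<subset> {n\<in>{..<b}. coprime n b} - H"
      using H'(2) gm by blast
    then have "card ({n\<in>{..<b}. coprime n b} - H') < card ({n\<in>{..<b}. coprime n b} - H)"
      by (intro psubset_card_mono) auto
    from less.hyps[OF this H'(1)] obtain \<chi> where "\<chi> \<in> dirichlet_characters b" "\<forall>n\<in>H'. \<chi> n = \<psi>' n" ..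
    then show ?thesis using H'(2,4) by (intro bexI[of _ \<chi>]) auto
  qed
qed

text \<open>The trivial character on the class of 1 is extended to \<open>g\<close> with a primitive
  \<open>k\<close>-th root of unity as value, where \<open>k\<close> is the order of
  \<open>g\<close> modulo \<open>b\<close> and at least 2.\<close>

lemma exists_character_neq_1:
  assumes b: "b > 0" and g: "coprime g b" and g1: "\<not> [g = 1] (mod b)"
  shows "\<exists>\<chi>\<in>dirichlet_characters b. \<chi> g \<noteq> 1"
proof -
  define H where "H = {n. [n = 1] (mod b)}"
  have H: "partial_character b H (\<lambda>_. 1)"
    unfolding partial_character_def H_def
    using cong_mult[of _ 1 b _ 1] by (auto intro: cong_trans cong_imp_coprime[OF cong_sym])
  obtain k where k: "k > 0" "g ^ k \<in> H" "\<And>j. 0 < j \<Longrightarrow> j < k \<Longrightarrow> g ^ j \<notin> H"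
    using least_power_in_partial_character[OF H b g] by blast
  have "k \<noteq> 1" using k(2) g1 by (auto simp: H_def)
  then have k2: "k \<ge> 2" using k(1) by simp
  define z where "z = exp (2 * of_real pi * \<i> / of_nat k)"
  have zk: "z ^ k = 1" using k(1) unfolding z_def by (simp flip: exp_of_nat_mult)
  have z1: "z \<noteq> 1"
  proof
    assume "z = 1"
    then have "\<exists>n::int. 2 * pi / real k = 2 * n * pi" unfolding z_def exp_eq_1 by simp
    then obtain n :: int where "2 * pi * (1 / real k) = 2 * pi * n" by (auto simp: mult_ac)
    then have "1 / real k = n" by (subst (asm) mult_cancel_left) simp
    moreover have "0 < 1 / real k" "1 / real k < 1" using k2 by auto
    ultimately have "0 < real_of_int n" "real_of_int n < 1" by simp_all
    then show False by simp
  qed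
  from extend_partial_character[OF H b g k, of z] zk obtain H' \<psi>'
    where H': "partial_character b H' \<psi>'" "g \<in> H'" "\<psi>' g = z" by auto
  from partial_character_extends[OF H'(1) b] show ?thesis using H'(2,3) z1 by metis
qed

lemma character_norm:
  assumes "\<chi> \<in> dirichlet_characters b" "b > 0"
  shows "norm (\<chi> n) = (if coprime n b then 1 else 0)"
proof (cases "coprime n b")
  case True
  have "\<chi> n ^ totient b = 1"
    using dirichlet_characterD(5)[OF assms(1) euler_theorem[OF True]]
    by (simp add: dirichlet_character_power[OF assms(1)] dirichlet_characterD[OF assms(1)])
  then have "norm (\<chi> n) ^ totient b = 1" by (metis norm_one norm_power)
  then have "norm (\<chi> n) = 1"
    using assms(2) power_eq_iff_eq_base[of "totient b" "norm (\<chi> n)" 1] by simp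
  then show ?thesis using True by simp
qed (simp add: dirichlet_characterD(4)[OF assms(1)])

lemma character_norm_le: "\<chi> \<in> dirichlet_characters b \<Longrightarrow> b > 0 \<Longrightarrow> norm (\<chi> n) \<le> 1"
  by (simp add: character_norm)

lemma principal_character_in: "b > 0 \<Longrightarrow> principal_character b \<in> dirichlet_characters b"
  by (rule dirichlet_characterI)
     (auto simp: principal_character_def dest: cong_imp_coprime cong_imp_coprime[OF cong_sym])

text \<open>Periodicity embeds the characters into the functions from \<open>{..<b}\<close> to the
  finite set of 0 and the \<open>totient b\<close>-th roots of unity.\<close>

lemma finite_dirichlet_characters:
  assumes b: "b > 0"
  shows "finite (dirichlet_characters b)"
proof -
  let ?V = "insert 0 {z::complex. z ^ totient b = 1}"
  have finV: "finite ?V" using b by (intro finite.insertI finite_roots_unity) (simp add: Suc_le_eq)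
  have "inj_on (\<lambda>\<chi>. restrict \<chi> {..<b}) (dirichlet_characters b)"
  proof (rule inj_onI, rule ext)
    fix \<chi> \<chi>' n assume *: "\<chi> \<in> dirichlet_characters b" "\<chi>' \<in> dirichlet_characters b"
      "restrict \<chi> {..<b} = restrict \<chi>' {..<b}"
    have "\<chi> n = \<chi> (n mod b)" "\<chi>' n = \<chi>' (n mod b)"
      using *(1,2) by (simp_all add: dirichlet_characterD(6))
    moreover have "\<chi> (n mod b) = \<chi>' (n mod b)"
      using fun_cong[OF *(3), of "n mod b"] b by simp
    ultimately show "\<chi> n = \<chi>' n" by simp
  qed
  moreover have "(\<lambda>\<chi>. restrict \<chi> {..<b}) ` dirichlet_characters b \<subseteq> PiE {..<b} (\<lambda>_. ?V)"
  proof clarify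
    fix \<chi> assume \<chi>: "\<chi> \<in> dirichlet_characters b"
    have "\<chi> n \<in> ?V" for n
    proof (cases "coprime n b")
      case True
      have "\<chi> n ^ totient b = 1"
        using dirichlet_characterD(5)[OF \<chi> euler_theorem[OF True]]
        by (simp add: dirichlet_character_power[OF \<chi>] dirichlet_characterD[OF \<chi>])
      then show ?thesis by simp
    qed (simp add: dirichlet_characterD(4)[OF \<chi>])
    then show "restrict \<chi> {..<b} \<in> PiE {..<b} (\<lambda>_. ?V)" by auto
  qed
  ultimately show ?thesis
    using finV by (meson finite_PiE finite_lessThan finite_subset inj_on_finite)
qed

lemma character_mult_in:
  "\<chi> \<in> dirichlet_characters b \<Longrightarrow> \<psi> \<in> dirichlet_characters b \<Longrightarrow>
   (\<lambda>n. \<chi> n * \<psi> n) \<in> dirichlet_characters b"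
  by (rule dirichlet_characterI) (simp_all add: dirichlet_characterD dirichlet_characterD(5)[of _ b])

lemma character_cnj_in:
  "\<chi> \<in> dirichlet_characters b \<Longrightarrow> (\<lambda>n. cnj (\<chi> n)) \<in> dirichlet_characters b"
  by (rule dirichlet_characterI) (simp_all add: dirichlet_characterD dirichlet_characterD(5)[of _ b])

text \<open>Orthogonality: multiplication by a character \<open>\<psi>\<close> with
  \<open>\<psi> n \<noteq> 1\<close> permutes the characters, so the sum equals
  \<open>\<psi> n\<close> times itself.\<close>

lemma sum_characters:
  assumes b: "b > 0"
  shows "(\<Sum>\<chi>\<in>dirichlet_characters b. \<chi> n) =
    (if [n = 1] (mod b) then of_nat (card (dirichlet_characters b)) else 0)"
proof -
  let ?X = "dirichlet_characters b"
  consider "[n = 1] (mod b)" | "\<not> [n = 1] (mod b)" "coprime n b" | "\<not> [n = 1] (mod b)" "\<not> coprime n b" by blast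
  then show ?thesis
  proof cases
    case 1
    then have "\<chi> n = 1" if "\<chi> \<in> ?X" for \<chi>
      using dirichlet_characterD(5)[OF that 1] dirichlet_characterD(1)[OF that] by simp
    then have "(\<Sum>\<chi>\<in>?X. \<chi> n) = (\<Sum>\<chi>\<in>?X. 1)" by (rule sum.cong[OF refl])
    then show ?thesis using 1 by simp
  next
    case 3
    then have "\<chi> n = 0" if "\<chi> \<in> ?X" for \<chi>
      using dirichlet_characterD(4)[OF that] by simp
    then have "(\<Sum>\<chi>\<in>?X. \<chi> n) = 0" by (rule sum.neutral[OF ballI])
    then show ?thesis using 3 by simp
  next
    case 2
    obtain \<psi> where \<psi>: "\<psi> \<in> ?X" "\<psi> n \<noteq> 1" using exists_character_neq_1[OF b 2(2,1)] by auto
    have inv: "cnj (\<psi> m) * (\<psi> m * \<chi> m) = \<chi> m" "\<psi> m * (cnj (\<psi> m) * \<chi> m) = \<chi> m" if "\<chi> \<in> ?X" for \<chi> m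
    proof -
      have "\<psi> m * cnj (\<psi> m) * \<chi> m = \<chi> m"
        unfolding complex_norm_square[symmetric] character_norm[OF \<psi>(1) b]
        using dirichlet_characterD(4)[OF that] by simp
      then show "cnj (\<psi> m) * (\<psi> m * \<chi> m) = \<chi> m" "\<psi> m * (cnj (\<psi> m) * \<chi> m) = \<chi> m"
        by (simp_all add: mult_ac)
    qed
    have "(\<Sum>\<chi>\<in>?X. \<chi> n) = (\<Sum>\<chi>\<in>?X. \<psi> n * \<chi> n)"
      by (rule sum.reindex_bij_witness[of _ "\<lambda>\<chi> m. \<psi> m * \<chi> m" "\<lambda>\<chi> m. cnj (\<psi> m) * \<chi> m"])
         (use \<psi>(1) inv in \<open>auto intro: character_mult_in character_cnj_in\<close>)
    then have "(\<Sum>\<chi>\<in>?X. \<chi> n) = \<psi> n * (\<Sum>\<chi>\<in>?X. \<chi> n)" unfolding sum_distrib_left .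
    then show ?thesis using \<psi>(2) 2 by simp
  qed
qed

text \<open>Multiplication by a unit \<open>a\<close> with \<open>\<chi> a \<noteq> 1\<close>
  permutes the residues, so the sum equals \<open>\<chi> a\<close> times itself.\<close>

lemma sum_nonprincipal_character:
  assumes b: "b > 0" and \<chi>: "\<chi> \<in> dirichlet_characters b" "\<chi> \<noteq> principal_character b"
  shows "(\<Sum>n<b. \<chi> n) = 0"
proof -
  obtain a where a: "coprime a b" "\<chi> a \<noteq> 1"
  proof -
    obtain a where "\<chi> a \<noteq> principal_character b a" using \<chi>(2) by auto
    then show ?thesis using dirichlet_characterD(4)[OF \<chi>(1), of a] that[of a]
      by (auto simp: principal_character_def split: if_splits)
  qed
  have inj: "inj_on (\<lambda>n. a * n mod b) {..<b}"
  proof (rule inj_onI)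
    fix m n assume *: "m \<in> {..<b}" "n \<in> {..<b}" "a * m mod b = a * n mod b"
    then have "[a * m = a * n] (mod b)" by (simp add: cong_def)
    then have "[m = n] (mod b)" using a(1) by (simp add: cong_mult_lcancel_nat)
    then show "m = n" using * by (simp add: cong_def)
  qed
  then have "(\<lambda>n. a * n mod b) ` {..<b} = {..<b}"
    using b by (intro endo_inj_surj) auto
  then have "(\<Sum>n<b. \<chi> n) = (\<Sum>n<b. \<chi> (a * n mod b))"
    using sum.reindex[OF inj, of \<chi>] by simp
  also have "\<dots> = (\<Sum>n<b. \<chi> a * \<chi> n)"
  proof (rule sum.cong[OF refl])
    fix n
    show "\<chi> (a * n mod b) = \<chi> a * \<chi> n"
      by (simp add: dirichlet_characterD[OF \<chi>(1)])
  qed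
  finally have "(\<Sum>n<b. \<chi> n) = \<chi> a * (\<Sum>n<b. \<chi> n)" unfolding sum_distrib_left .
  then show ?thesis using a(2) by simp
qed

lemma sum_add_split:
  fixes f :: "nat \<Rightarrow> 'a :: comm_monoid_add"
  shows "(\<Sum>n<m + k. f n) = (\<Sum>n<m. f n) + (\<Sum>n<k. f (m + n))"
  by (induction k) (simp_all add: add_ac)

text \<open>Any \<open>b\<close> consecutive values sum to 0, so only an incomplete block of fewer
  than \<open>b\<close> values remains. The shift \<open>k\<close> serves series that start at
  1.\<close>

lemma norm_sum_nonprincipal_character:
  assumes b: "b > 0" and \<chi>: "\<chi> \<in> dirichlet_characters b" "\<chi> \<noteq> principal_character b"
  shows "norm (\<Sum>n<N. \<chi> (n + k)) \<le> b"
proof (induction N rule: less_induct)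
  case (less N)
  note per = dirichlet_characterD(7)[OF \<chi>(1)]
  have z: "(\<Sum>n<b. \<chi> (n + k)) = 0" for k
  proof (induction k)
    case 0
    then show ?case using sum_nonprincipal_character[OF assms] by simp
  next
    case (Suc k)
    have "(\<Sum>n<b. \<chi> (n + k)) + \<chi> (b + k) = \<chi> k + (\<Sum>n<b. \<chi> (n + Suc k))"
      using sum.lessThan_Suc_shift[of "\<lambda>n. \<chi> (n + k)" b] by simp
    then show ?case using Suc per[of k] by (simp add: add.commute)
  qed
  show ?case
  proof (cases "N < b")
    case True
    have "norm (\<Sum>n<N. \<chi> (n + k)) \<le> (\<Sum>n<N. 1)"
      using character_norm_le[OF \<chi>(1) b] by (intro order_trans[OF norm_sum] sum_mono) auto
    then show ?thesis using True by simp
  next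
    case False
    then have "(\<Sum>n<N. \<chi> (n + k)) = (\<Sum>n<N - b. \<chi> (n + k)) + (\<Sum>n<b. \<chi> (N - b + n + k))"
      using sum_add_split[of "\<lambda>n. \<chi> (n + k)" "N - b" b] by simp
    also have "(\<Sum>n<b. \<chi> (N - b + n + k)) = 0"
      using z[of "N - b + k"] by (simp only: add_ac)
    finally show ?thesis using less.IH[of "N - b"] False b by simp
  qed
qed

section \<open>L-functions at real arguments\<close>

text \<open>Abel summation. Bounded variation replaces monotonicity because the test is to be
  applied to \<open>n powr - s - n powr - 1\<close>, which is not monotone in
  \<open>n\<close>.\<close>

lemma dirichlet_test_bounded_variation:
  fixes f :: "nat \<Rightarrow> complex" and a :: "nat \<Rightarrow> real"
  assumes B: "\<And>N. norm (\<Sum>n<N. f n) \<le> B" and a: "a \<longlonglongrightarrow> 0"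
    and V: "summable (\<lambda>n. \<bar>a n - a (Suc n)\<bar>)"
  shows "summable (\<lambda>n. f n * of_real (a n))"
    and "norm (\<Sum>n. f n * of_real (a n)) \<le> B * (\<Sum>n. \<bar>a n - a (Suc n)\<bar>)"
proof -
  define S where "S N = (\<Sum>n<N. f n)" for N
  define h where "h n = S (Suc n) * of_real (a n - a (Suc n))" for n
  have part: "(\<Sum>n<N. f n * of_real (a n)) = S N * of_real (a N) + (\<Sum>n<N. h n)" for N
    by (induction N) (simp_all add: S_def h_def algebra_simps)
  have hn: "norm (h n) \<le> B * \<bar>a n - a (Suc n)\<bar>" for n
    unfolding h_def norm_mult norm_of_real S_def by (intro mult_right_mono B) auto
  have sV: "summable (\<lambda>n. B * \<bar>a n - a (Suc n)\<bar>)" using V by (rule summable_mult)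
  have hs: "summable (\<lambda>n. norm (h n))"
    using sV hn by (intro summable_comparison_test'[OF sV, of 0]) auto
  have "(\<lambda>N. S N * of_real (a N)) \<longlonglongrightarrow> 0"
  proof (rule Lim_null_comparison)
    show "\<forall>\<^sub>F N in sequentially. norm (S N * of_real (a N)) \<le> B * \<bar>a N\<bar>"
      unfolding norm_mult norm_of_real S_def by (intro always_eventually allI mult_right_mono B) auto
    have "(\<lambda>N. B * \<bar>a N\<bar>) \<longlonglongrightarrow> B * \<bar>0\<bar>" by (intro tendsto_intros a)
    then show "(\<lambda>N. B * \<bar>a N\<bar>) \<longlonglongrightarrow> 0" by simp
  qed
  moreover have "(\<lambda>N. \<Sum>n<N. h n) \<longlonglongrightarrow> suminf h"
    using summable_norm_cancel[OF hs] by (rule summable_LIMSEQ)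
  ultimately have "(\<lambda>N. S N * of_real (a N) + (\<Sum>n<N. h n)) \<longlonglongrightarrow> 0 + suminf h"
    by (rule tendsto_add)
  then have sums: "(\<lambda>n. f n * of_real (a n)) sums suminf h"
    unfolding sums_def part by simp
  then show "summable (\<lambda>n. f n * of_real (a n))" by (rule sums_summable)
  have "norm (\<Sum>n. f n * of_real (a n)) = norm (suminf h)"
    using sums_unique[OF sums] by simp
  also have "\<dots> \<le> (\<Sum>n. norm (h n))" using hs by (rule summable_norm)
  also have "\<dots> \<le> (\<Sum>n. B * \<bar>a n - a (Suc n)\<bar>)" using hn hs sV by (rule suminf_le)
  also have "\<dots> = B * (\<Sum>n. \<bar>a n - a (Suc n)\<bar>)" using V by (rule suminf_mult)
  finally show "norm (\<Sum>n. f n * of_real (a n)) \<le> B * (\<Sum>n. \<bar>a n - a (Suc n)\<bar>)" .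
qed

lemma dirichlet_test_decreasing:
  fixes f :: "nat \<Rightarrow> complex" and a :: "nat \<Rightarrow> real"
  assumes B: "\<And>N. norm (\<Sum>n<N. f n) \<le> B" and a: "a \<longlonglongrightarrow> 0" and dec: "\<And>n. a (Suc n) \<le> a n"
  shows "summable (\<lambda>n. f n * of_real (a n))" "norm (\<Sum>n. f n * of_real (a n)) \<le> B * a 0"
proof -
  have "(\<lambda>n. a n - a (Suc n)) sums (a 0 - 0)" by (rule telescope_sums'[OF a])
  then have "(\<lambda>n. \<bar>a n - a (Suc n)\<bar>) sums a 0" using dec by simp
  then have V: "summable (\<lambda>n. \<bar>a n - a (Suc n)\<bar>)" "(\<Sum>n. \<bar>a n - a (Suc n)\<bar>) = a 0"
    by (simp_all add: sums_iff)
  show "summable (\<lambda>n. f n * of_real (a n))" "norm (\<Sum>n. f n * of_real (a n)) \<le> B * a 0"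
    using dirichlet_test_bounded_variation[OF B a V(1)] unfolding V(2) by auto
qed

definition dirichlet_L :: "(nat \<Rightarrow> complex) \<Rightarrow> real \<Rightarrow> complex" where
  "dirichlet_L \<chi> s = (\<Sum>n. \<chi> (Suc n) * of_real (real (Suc n) powr - s))"

lemma powr_Suc_null:
  assumes "s > 0" shows "(\<lambda>n. real (Suc n) powr - s) \<longlonglongrightarrow> 0"
  by (intro tendsto_neg_powr filterlim_compose[OF filterlim_real_sequentially] filterlim_Suc) (use assms in simp)

lemma summable_powr_Suc:
  assumes "s > 1" shows "summable (\<lambda>n. real (Suc n) powr - s)"
  using assms summable_real_powr_iff[of "- s"] summable_Suc_iff[of "\<lambda>n. real n powr - s"] by simp

lemma summable_dirichlet_L:
  assumes b: "b > 0" and \<chi>: "\<chi> \<in> dirichlet_characters b" and s: "s > 1"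
  shows "summable (\<lambda>n. norm (\<chi> (Suc n) * of_real (real (Suc n) powr - s)))"
proof (rule summable_comparison_test'[OF summable_powr_Suc[OF s], of 0])
  show "norm (norm (\<chi> (Suc n) * of_real (real (Suc n) powr - s))) \<le> real (Suc n) powr - s" for n
    using mult_right_mono[OF character_norm_le[OF \<chi> b, of "Suc n"], of "real (Suc n) powr - s"]
    by (simp add: norm_mult)
qed

lemma norm_sum_character_Suc:
  assumes "b > 0" "\<chi> \<in> dirichlet_characters b" "\<chi> \<noteq> principal_character b"
  shows "norm (\<Sum>n<N. \<chi> (Suc n)) \<le> b"
  using norm_sum_nonprincipal_character[OF assms, where N = N and k = 1] by simp

lemma summable_dirichlet_L_nonprincipal:
  assumes "b > 0" "\<chi> \<in> dirichlet_characters b" "\<chi> \<noteq> principal_character b" and s: "s > 0"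
  shows "summable (\<lambda>n. \<chi> (Suc n) * of_real (real (Suc n) powr - s))"
  by (rule dirichlet_test_decreasing(1)[OF norm_sum_character_Suc[OF assms(1-3)] powr_Suc_null[OF s]])
     (use s in \<open>auto intro!: powr_mono2'\<close>)

text \<open>By the mean value theorem the difference is, up to sign, a value of the derivative
  \<open>- (z powr - 2 * (s * z powr (1 - s) - 1))\<close>. The inner bracket is at most
  \<open>2 * (s - 1) * sqrt z\<close> in absolute value because
  \<open>ln z \<le> 2 * sqrt z\<close>. The square root costs half a power, and the exponent -3/2 is
  still summable.\<close>

lemma powr_minus_variation:
  fixes s x :: real
  assumes s: "1 \<le> s" and x: "x \<ge> 1"
  shows "\<bar>(x powr - s - x powr - 1) - ((x + 1) powr - s - (x + 1) powr - 1)\<bar> \<le> 2 * (s - 1) * x powr (- 3 / 2)"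
proof -
  let ?f = "\<lambda>y::real. y powr - s - y powr - 1"
  let ?f' = "\<lambda>y::real. - s * y powr (- s - 1) + y powr - 2"
  have "DERIV ?f y :> ?f' y" if "x \<le> y" "y \<le> x + 1" for y
    by (rule DERIV_cong[OF DERIV_diff[OF has_real_derivative_powr has_real_derivative_powr]])
       (use that x in simp_all)
  from MVT2[of x "x + 1" ?f ?f', OF _ this] obtain z where z: "x < z" "z < x + 1"
    "?f (x + 1) - ?f x = (x + 1 - x) * ?f' z" by auto
  have z1: "z \<ge> 1" using z x by simp
  define E where "E = z powr (1 - s)"
  have E: "E = exp ((1 - s) * ln z)" using z1 by (simp add: E_def powr_def)
  have "E \<le> 1" unfolding E using z1 s by (simp add: mult_nonpos_nonneg)
  have "1 + (1 - s) * ln z \<le> E" unfolding E by (rule exp_ge_add_one_self)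
  have sq: "sqrt z \<ge> 1" using z1 by simp
  have "ln z = 2 * ln (sqrt z)" using z1 by (simp add: ln_sqrt)
  also have "\<dots> \<le> 2 * sqrt z" using ln_le_minus_one[of "sqrt z"] sq by simp
  finally have ln: "ln z \<le> 2 * sqrt z" .
  have "s * E - 1 \<le> (s - 1) * 1" using mult_left_mono[OF \<open>E \<le> 1\<close>, of s] s by simp
  also have "\<dots> \<le> (s - 1) * (2 * sqrt z)" using s sq by (intro mult_left_mono) linarith+
  finally have up: "s * E - 1 \<le> (s - 1) * (2 * sqrt z)" .
  have "(s - 1) * ln z \<le> (s - 1) * (2 * sqrt z)" using s ln by (intro mult_left_mono) auto
  moreover have "E \<le> s * E" using s mult_right_mono[of 1 s E] by (simp add: E_def)
  ultimately have "- ((s - 1) * (2 * sqrt z)) \<le> s * E - 1"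
    using \<open>1 + (1 - s) * ln z \<le> E\<close> by (simp add: algebra_simps)
  with up have abs: "\<bar>s * E - 1\<bar> \<le> (s - 1) * (2 * sqrt z)" by linarith
  have "z powr (- s - 1) = z powr - 2 * E"
    unfolding E_def by (subst powr_add[symmetric]) (rule arg_cong[where f = "(powr) z"], simp)
  moreover have "- s * (w * E) + w = - (w * (s * E - 1))" for w by (simp add: algebra_simps)
  ultimately have "?f' z = - (z powr - 2 * (s * E - 1))" by (simp only:)
  then have "\<bar>?f' z\<bar> = z powr - 2 * \<bar>s * E - 1\<bar>" by (simp add: abs_mult)
  also have "\<dots> \<le> z powr - 2 * ((s - 1) * (2 * sqrt z))" by (intro mult_left_mono abs) auto
  also have "sqrt z = z powr (1 / 2)" using z1 by (simp add: powr_half_sqrt)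
  also have "z powr - 2 * ((s - 1) * (2 * z powr (1 / 2))) = 2 * (s - 1) * (z powr - 2 * z powr (1 / 2))"
    by (simp only: mult_ac)
  also have "z powr - 2 * z powr (1 / 2) = z powr (- 3 / 2)"
    by (subst powr_add[symmetric]) simp
  also have "2 * (s - 1) * z powr (- 3 / 2) \<le> 2 * (s - 1) * x powr (- 3 / 2)"
    using s x z by (intro mult_left_mono powr_mono2') auto
  finally have "\<bar>?f (x + 1) - ?f x\<bar> \<le> 2 * (s - 1) * x powr (- 3 / 2)" using z(3) by simp
  then show ?thesis by (simp only: abs_minus_commute)
qed

text \<open>A linear rate is proved, not just continuity: a zero at 1 then cancels the growth
  \<open>2 / (s - 1)\<close> of the principal L-function.\<close>

lemma dirichlet_L_lipschitz:
  assumes "b > 0" "\<chi> \<in> dirichlet_characters b" "\<chi> \<noteq> principal_character b"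
  shows "\<exists>C. \<forall>s\<ge>1. norm (dirichlet_L \<chi> s - dirichlet_L \<chi> 1) \<le> C * (s - 1)"
proof (intro exI allI impI)
  let ?V = "\<Sum>n. real (Suc n) powr - (3 / 2)"
  fix s :: real assume s: "s \<ge> 1"
  define a where "a n = real (Suc n) powr - s - real (Suc n) powr - 1" for n
  have sum3: "summable (\<lambda>n. 2 * (s - 1) * real (Suc n) powr - (3 / 2))"
    by (intro summable_mult summable_powr_Suc) simp
  have var: "\<bar>a n - a (Suc n)\<bar> \<le> 2 * (s - 1) * real (Suc n) powr - (3 / 2)" for n
    using powr_minus_variation[OF s, of "real (Suc n)"] by (simp add: a_def add_ac)
  have V: "summable (\<lambda>n. \<bar>a n - a (Suc n)\<bar>)"
    by (rule summable_comparison_test'[OF sum3, of 0]) (use var in simp)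
  have a0: "a \<longlonglongrightarrow> 0"
    using tendsto_diff[OF powr_Suc_null[of s] powr_Suc_null[of 1]] s by (simp add: a_def[abs_def])
  have "summable (\<lambda>n. \<chi> (Suc n) * of_real (real (Suc n) powr - s))"
    by (rule summable_dirichlet_L_nonprincipal[OF assms]) (use s in simp)
  moreover have "summable (\<lambda>n. \<chi> (Suc n) * of_real (real (Suc n) powr - 1))"
    by (rule summable_dirichlet_L_nonprincipal[OF assms]) simp
  ultimately have "dirichlet_L \<chi> s - dirichlet_L \<chi> 1 = (\<Sum>n. \<chi> (Suc n) * of_real (a n))"
    unfolding dirichlet_L_def a_def of_real_diff right_diff_distrib by (rule suminf_diff)
  also have "norm \<dots> \<le> b * (\<Sum>n. \<bar>a n - a (Suc n)\<bar>)"
    by (rule dirichlet_test_bounded_variation(2)[OF norm_sum_character_Suc[OF assms] a0 V])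
  also have "\<dots> \<le> b * (\<Sum>n. 2 * (s - 1) * real (Suc n) powr - (3 / 2))"
    by (intro mult_left_mono suminf_le var V sum3) auto
  also have "\<dots> = b * (2 * (s - 1) * ?V)"
    by (subst suminf_mult[OF summable_powr_Suc]) simp_all
  finally show "norm (dirichlet_L \<chi> s - dirichlet_L \<chi> 1) \<le> (b * (2 * ?V)) * (s - 1)"
    by (simp only: mult_ac)
qed

lemma dirichlet_L_tendsto_1:
  assumes "b > 0" "\<chi> \<in> dirichlet_characters b" "\<chi> \<noteq> principal_character b"
  shows "(dirichlet_L \<chi> \<longlongrightarrow> dirichlet_L \<chi> 1) (at_right 1)"
proof -
  obtain C where C: "\<forall>s\<ge>1. norm (dirichlet_L \<chi> s - dirichlet_L \<chi> 1) \<le> C * (s - 1)"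
    using dirichlet_L_lipschitz[OF assms] by blast
  have "((\<lambda>s. dirichlet_L \<chi> s - dirichlet_L \<chi> 1) \<longlongrightarrow> 0) (at_right 1)"
  proof (rule Lim_null_comparison)
    show "\<forall>\<^sub>F s in at_right 1. norm (dirichlet_L \<chi> s - dirichlet_L \<chi> 1) \<le> C * (s - 1)"
      using C by (auto simp: eventually_at_filter)
    have "((\<lambda>s::real. C * (s - 1)) \<longlongrightarrow> C * (1 - 1)) (at_right 1)" by (intro tendsto_intros)
    then show "((\<lambda>s. C * (s - 1)) \<longlongrightarrow> 0) (at_right 1)" by simp
  qed
  then show ?thesis by (simp only: Lim_null[symmetric])
qed

text \<open>Each term after the first is compared with the integral of \<open>y powr - s\<close>
  over a unit interval, in the form of a telescoping sum. The constant 2 is the bound for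
  \<open>s\<close>.\<close>

lemma suminf_powr_le:
  assumes s: "1 < s" "s \<le> 2"
  shows "(\<Sum>n. real (Suc n) powr - s) \<le> 2 / (s - 1)"
proof -
  have step: "real (Suc (Suc n)) powr - s \<le>
      (real (Suc n) powr (1 - s) - real (Suc (Suc n)) powr (1 - s)) / (s - 1)" for n
  proof -
    let ?x = "real (Suc n)"
    have "DERIV (\<lambda>y. y powr (1 - s)) y :> (1 - s) * y powr (- s)" if "?x \<le> y" "y \<le> ?x + 1" for y
      using that by (auto intro!: derivative_eq_intros)
    from MVT2[of ?x "?x + 1" "\<lambda>y. y powr (1 - s)", OF _ this] obtain z where z: "?x < z" "z < ?x + 1"
      "(?x + 1) powr (1 - s) - ?x powr (1 - s) = (?x + 1 - ?x) * ((1 - s) * z powr (- s))" by auto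
    have "(?x + 1) powr - s \<le> z powr - s" using z s by (intro powr_mono2') auto
    also have "z powr - s = (?x powr (1 - s) - (?x + 1) powr (1 - s)) / (s - 1)"
      using z(3) s by (simp add: field_simps)
    finally show ?thesis by (simp add: add_ac)
  qed
  have part: "(\<Sum>n<N. real (Suc (Suc n)) powr - s) \<le> 1 / (s - 1)" for N
  proof -
    have "(\<Sum>n<N. real (Suc (Suc n)) powr - s) \<le>
        (\<Sum>n<N. (real (Suc n) powr (1 - s) - real (Suc (Suc n)) powr (1 - s)) / (s - 1))"
      by (intro sum_mono step)
    also have "\<dots> = (1 - real (Suc N) powr (1 - s)) / (s - 1)"
      unfolding sum_divide_distrib[symmetric]
      by (subst sum_lessThan_telescope'[of "\<lambda>n. real (Suc n) powr (1 - s)"]) simp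
    also have "\<dots> \<le> 1 / (s - 1)" using s by (intro divide_right_mono) auto
    finally show ?thesis .
  qed
  have sm: "summable (\<lambda>n. real (Suc n) powr - s)" using summable_powr_Suc s by simp
  have "(\<Sum>n. real (Suc n) powr - s) = 1 + (\<Sum>n. real (Suc (Suc n)) powr - s)"
    using suminf_split_head[OF sm] by simp
  also have "(\<Sum>n. real (Suc (Suc n)) powr - s) \<le> 1 / (s - 1)"
    by (intro suminf_le_const part) (use sm in \<open>simp only: summable_Suc_iff[of "\<lambda>n. real (Suc n) powr - s"]\<close>)
  also have "1 + 1 / (s - 1) = s / (s - 1)" using s by (simp add: field_simps)
  also have "\<dots> \<le> 2 / (s - 1)" using s by (intro divide_right_mono) auto
  finally show ?thesis by simp
qed

lemma norm_dirichlet_L_le: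
  assumes "b > 0" "\<chi> \<in> dirichlet_characters b" and s: "1 < s" "s \<le> 2"
  shows "norm (dirichlet_L \<chi> s) \<le> 2 / (s - 1)"
proof -
  have "norm (dirichlet_L \<chi> s) \<le> (\<Sum>n. norm (\<chi> (Suc n) * of_real (real (Suc n) powr - s)))"
    unfolding dirichlet_L_def by (rule summable_norm[OF summable_dirichlet_L[OF assms(1,2) s(1)]])
  also have "\<dots> \<le> (\<Sum>n. real (Suc n) powr - s)"
  proof (rule suminf_le[OF _ summable_dirichlet_L[OF assms(1,2) s(1)] summable_powr_Suc[OF s(1)]])
    show "norm (\<chi> (Suc n) * of_real (real (Suc n) powr - s)) \<le> real (Suc n) powr - s" for n
      using mult_right_mono[OF character_norm_le[OF assms(2,1), of "Suc n"], of "real (Suc n) powr - s"]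
      by (simp add: norm_mult)
  qed
  also have "\<dots> \<le> 2 / (s - 1)" by (rule suminf_powr_le[OF s])
  finally show ?thesis .
qed

text \<open>The numbers \<open>1 + b * j\<close> are coprime to \<open>b\<close>, so at
  \<open>s = 1\<close> the series dominates a multiple of the harmonic series. A finite partial sum
  that is large at 1 stays large for \<open>s\<close> near 1.\<close>

lemma dirichlet_L_principal_at_top:
  assumes b: "b > 0"
  shows "filterlim (\<lambda>s. norm (dirichlet_L (principal_character b) s)) at_top (at_right 1)"
  unfolding filterlim_at_top
proof
  fix Z :: real
  define r where "r n = Re (principal_character b (Suc n))" for n
  have r: "principal_character b (Suc n) = of_real (r n)" "r n \<ge> 0" for n
    by (simp_all add: r_def principal_character_def)
  have "\<exists>N. (\<Sum>n<N. r n * real (Suc n) powr - 1) > Z"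
  proof (rule ccontr)
    assume "\<not> ?thesis"
    then have le: "(\<Sum>n<N. r n * real (Suc n) powr - 1) \<le> Z" for N by (auto simp: not_less)
    have "(\<Sum>j<M. inverse (real (Suc j))) \<le> b * Z" for M
    proof -
      have "(\<Sum>j<M. inverse (real b * real (Suc j))) = inverse (real b) * (\<Sum>j<M. inverse (real (Suc j)))"
        unfolding sum_distrib_left inverse_mult_distrib ..
      then have "(\<Sum>j<M. inverse (real (Suc j))) = b * (\<Sum>j<M. inverse (real b * real (Suc j)))"
        using b by simp
      also have "(\<Sum>j<M. inverse (real b * real (Suc j))) \<le> (\<Sum>j<M. r (b * j) * real (Suc (b * j)) powr - 1)"
      proof (rule sum_mono)
        fix j
        have "coprime (Suc (b * j)) b"
          by (metis coprime_Suc_left_nat coprime_commute coprime_mult_right_iff)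
        then have "r (b * j) = 1" by (simp add: r_def principal_character_def)
        moreover have "real (Suc (b * j)) \<le> real b * real (Suc j)"
          using b by (simp add: algebra_simps)
        then have "inverse (real b * real (Suc j)) \<le> inverse (real (Suc (b * j)))"
          by (intro le_imp_inverse_le) (simp_all add: add_pos_nonneg)
        moreover have "real (Suc (b * j)) powr - 1 = inverse (real (Suc (b * j)))"
          by (simp add: powr_minus)
        ultimately show "inverse (real b * real (Suc j)) \<le> r (b * j) * real (Suc (b * j)) powr - 1"
          by (simp only: mult_1_left)
      qed
      also have "\<dots> = (\<Sum>n\<in>(\<lambda>j. b * j) ` {..<M}. r n * real (Suc n) powr - 1)"
        using b by (subst sum.reindex) (auto simp: inj_on_def)
      also have "\<dots> \<le> (\<Sum>n<b * M. r n * real (Suc n) powr - 1)"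
        using r b by (intro sum_mono2) auto
      also have "\<dots> \<le> Z" by (rule le)
      finally show ?thesis by (simp add: mult_left_mono)
    qed
    then have "summable (\<lambda>j. inverse (real (Suc j)))"
      by (intro summableI_nonneg_bounded) auto
    then show False using not_summable_harmonic[where 'a = real] summable_Suc_iff[of "\<lambda>n. inverse (real n)"] by simp
  qed
  then obtain N where N: "(\<Sum>n<N. r n * real (Suc n) powr - 1) > Z" by blast
  have "((\<lambda>s. \<Sum>n<N. r n * real (Suc n) powr - s) \<longlongrightarrow> (\<Sum>n<N. r n * real (Suc n) powr - 1)) (at_right 1)"
    by (intro tendsto_intros) auto
  then have "\<forall>\<^sub>F s in at_right 1. (\<Sum>n<N. r n * real (Suc n) powr - s) > Z"
    using N by (rule order_tendstoD)
  moreover have "\<forall>\<^sub>F s::real in at_right 1. s > 1" by (simp add: eventually_at_filter)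
  ultimately show "\<forall>\<^sub>F s in at_right 1. Z \<le> norm (dirichlet_L (principal_character b) s)"
  proof eventually_elim
    case (elim s)
    have sm: "summable (\<lambda>n. r n * real (Suc n) powr - s)"
      using summable_dirichlet_L[OF b principal_character_in[OF b] elim(2)] r by (simp add: norm_mult)
    have "dirichlet_L (principal_character b) s = of_real (\<Sum>n. r n * real (Suc n) powr - s)"
      unfolding dirichlet_L_def using suminf_of_real[OF sm, where 'a = complex] by (simp add: r(1))
    moreover have "(\<Sum>n<N. r n * real (Suc n) powr - s) \<le> (\<Sum>n. r n * real (Suc n) powr - s)"
      using sm r by (intro sum_le_suminf) auto
    ultimately show ?case using elim(1) by simp
  qed
qed

section \<open>Euler products\<close>

lemma euler_product_sieve:
  fixes g :: "nat \<Rightarrow> complex"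
  assumes mult: "\<And>m n. g (m * n) = g m * g n" and sm: "summable (\<lambda>n. norm (g n))"
    and P: "finite P" "\<And>p. p \<in> P \<Longrightarrow> prime p"
  shows "(\<Prod>p\<in>P. 1 - g p) * suminf g = (\<Sum>n. if \<forall>p\<in>P. \<not> p dvd n then g n else 0)"
  using P
proof (induction P)
  case empty
  then show ?case by simp
next
  case (insert p P)
  define A where "A n = (if \<forall>q\<in>P. \<not> q dvd n then g n else 0)" for n
  define D where "D n = (if p dvd n \<and> (\<forall>q\<in>P. \<not> q dvd n) then g n else 0)" for n
  have p: "prime p" using insert.prems by simp
  have sA: "summable A" by (rule summable_comparison_test'[OF sm, of 0]) (simp add: A_def)
  have sD: "summable D" by (rule summable_comparison_test'[OF sm, of 0]) (simp add: D_def)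
  \<comment> \<open>By complete multiplicativity, the multiples of \<open>p\<close> that survive the
    sieve by \<open>P\<close> contribute \<open>g p\<close> times the whole sifted sum; the new
    factor \<open>1 - g p\<close> removes exactly them.\<close>
  have Dp: "D (p * m) = g p * A m" for m
  proof -
    have "q dvd p * m \<longleftrightarrow> q dvd m" if "q \<in> P" for q
    proof -
      have q: "prime q" "q \<noteq> p" using that insert by auto
      then have "\<not> q dvd p" using p primes_dvd_imp_eq by blast
      then show ?thesis using prime_dvd_mult_iff[OF q(1)] by simp
    qed
    then show ?thesis by (simp add: D_def A_def mult)
  qed
  have "suminf D = (\<Sum>m. D (p * m))"
  proof (rule suminf_mono_reindex[symmetric])
    show "strict_mono ((*) p)" using prime_gt_0_nat[OF p] by (simp add: strict_mono_def)
    show "D n = 0" if "n \<notin> range ((*) p)" for n using that by (auto simp: D_def elim!: dvdE)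
  qed
  also have "\<dots> = g p * suminf A" unfolding Dp using sA by (rule suminf_mult)
  finally have SD: "suminf D = g p * suminf A" .
  have "(\<Sum>n. if \<forall>q\<in>insert p P. \<not> q dvd n then g n else 0) = (\<Sum>n. A n - D n)"
    by (intro suminf_cong) (auto simp: A_def D_def)
  also have "\<dots> = (1 - g p) * suminf A"
    using suminf_diff[OF sA sD] SD by (simp add: left_diff_distrib)
  also have "suminf A = (\<Prod>q\<in>P. 1 - g q) * suminf g"
    using insert by (simp add: A_def[abs_def])
  finally show ?case using insert by (simp add: mult.assoc)
qed

text \<open>Sifting by all primes up to \<open>N\<close> leaves the term at 1 and terms beyond
  \<open>N\<close>, whose sum tends to 0. With the factors \<open>1 - g p\<close> multiplied onto
  the series, no infinite product and no division enter.\<close>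

lemma euler_product:
  fixes g :: "nat \<Rightarrow> complex"
  assumes mult: "\<And>m n. g (m * n) = g m * g n" and g: "g 0 = 0" "g 1 = 1"
    and sm: "summable (\<lambda>n. norm (g n))"
  shows "(\<lambda>N. (\<Prod>p | prime p \<and> p \<le> N. 1 - g p) * suminf g) \<longlonglongrightarrow> 1"
proof (rule LIMSEQ_I)
  fix r :: real assume "r > 0"
  from suminf_exist_split[OF this sm] obtain N0 where
    N0: "\<And>n. n \<ge> N0 \<Longrightarrow> norm (\<Sum>i. norm (g (i + n))) < r" by blast
  show "\<exists>no. \<forall>N\<ge>no. norm ((\<Prod>p | prime p \<and> p \<le> N. 1 - g p) * suminf g - 1) < r"
  proof (intro exI allI impI)
    fix N assume N: "N \<ge> Suc N0"
    let ?P = "{p. prime p \<and> p \<le> N}"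
    define A where "A n = (if \<forall>p\<in>?P. \<not> p dvd n then g n else 0)" for n
    have sA: "summable A" by (rule summable_comparison_test'[OF sm, of 0]) (simp add: A_def)
    have Asmall: "A n = (if n = 1 then 1 else 0)" if "n < Suc N" for n
    proof (cases "n \<le> 1")
      case True
      then show ?thesis using g by (cases n) (auto simp: A_def)
    next
      case False
      then obtain p where p: "prime p" "p dvd n" using prime_factor_nat by (metis le_refl)
      then have "p \<le> N" using False that dvd_imp_le[of p n] by auto
      then show ?thesis using p False by (auto simp: A_def)
    qed
    have "(\<Prod>p\<in>?P. 1 - g p) * suminf g = suminf A"
      unfolding A_def[abs_def] by (rule euler_product_sieve[OF mult sm]) auto
    also have "suminf A = (\<Sum>n. A (n + Suc N)) + (\<Sum>n<Suc N. A n)"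
      by (rule suminf_split_initial_segment[OF sA])
    also have "(\<Sum>n<Suc N. A n) = (\<Sum>n<Suc N. if n = 1 then 1 else 0)"
      by (intro sum.cong) (auto simp: Asmall)
    also have "\<dots> = 1" using N by simp
    finally have "norm ((\<Prod>p\<in>?P. 1 - g p) * suminf g - 1) = norm (\<Sum>n. A (n + Suc N))" by simp
    also have "\<dots> \<le> (\<Sum>n. norm (A (n + Suc N)))"
      by (intro summable_norm summable_ignore_initial_segment)
         (rule summable_comparison_test'[OF sm, of 0], simp add: A_def)
    also have "\<dots> \<le> (\<Sum>n. norm (g (n + Suc N)))"
    proof (rule suminf_le)
      show "summable (\<lambda>n. norm (A (n + Suc N)))"
        by (intro summable_ignore_initial_segment)
           (rule summable_comparison_test'[OF sm, of 0], simp add: A_def)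
      show "summable (\<lambda>n. norm (g (n + Suc N)))"
        by (intro summable_ignore_initial_segment sm)
    qed (simp add: A_def)
    also have "\<dots> < r" using N0[of "Suc N"] N by simp
    finally show "norm ((\<Prod>p\<in>?P. 1 - g p) * suminf g - 1) < r" .
  qed
qed

text \<open>First-order expansion of the logarithm of \<open>norm (1 - z)\<close>, which is the real
  part of \<open>Ln (1 - z)\<close>. The quadratic error is summable over the primes.\<close>

lemma norm_one_minus_bounds:
  fixes z :: complex
  assumes "norm z \<le> 1 / 2"
  shows "exp (- Re z - 2 * (norm z)\<^sup>2) \<le> norm (1 - z)" "norm (1 - z) \<le> exp (- Re z + 2 * (norm z)\<^sup>2)"
proof -
  have nz: "1 - z \<noteq> 0" using assms by auto
  have "norm (Ln (1 + (- z)) - (- z)) \<le> (norm (- z))\<^sup>2 / (1 - norm (- z))"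
    by (rule Ln_approx_linear) (use assms in simp)
  also have "\<dots> \<le> (norm z)\<^sup>2 / (1 / 2)"
    using assms by (simp only: norm_minus_cancel) (intro divide_left_mono, auto)
  finally have "norm (Ln (1 - z) + z) \<le> 2 * (norm z)\<^sup>2" by simp
  then have "\<bar>Re (Ln (1 - z) + z)\<bar> \<le> 2 * (norm z)\<^sup>2"
    using abs_Re_le_cmod order_trans by blast
  moreover have "Re (Ln (1 - z)) = ln (norm (1 - z))" using nz by (rule Re_Ln)
  ultimately have *: "- Re z - 2 * (norm z)\<^sup>2 \<le> ln (norm (1 - z))" "ln (norm (1 - z)) \<le> - Re z + 2 * (norm z)\<^sup>2"
    by auto
  have "exp (ln (norm (1 - z))) = norm (1 - z)" using nz by simp
  then show "exp (- Re z - 2 * (norm z)\<^sup>2) \<le> norm (1 - z)" "norm (1 - z) \<le> exp (- Re z + 2 * (norm z)\<^sup>2)"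
    using * by (metis exp_le_cancel_iff)+
qed

section \<open>The product of all L-functions modulo \<open>b\<close>\<close>

definition L_term :: "real \<Rightarrow> (nat \<Rightarrow> complex) \<Rightarrow> nat \<Rightarrow> complex" where
  "L_term s \<chi> n = \<chi> n * of_real (real n powr - s)"

context
  fixes b :: nat and s :: real
  assumes b: "b > 0" and s: "s > 1"
begin

lemma norm_L_term:
  assumes "\<chi> \<in> dirichlet_characters b" "prime p"
  shows "norm (L_term s \<chi> p) \<le> 1 / 2" "(norm (L_term s \<chi> p))\<^sup>2 \<le> real p powr - 2"
proof -
  have p2: "real p \<ge> 2" using prime_ge_2_nat[OF assms(2)] by simp
  have "norm (L_term s \<chi> p) \<le> 1 * real p powr - s"
    unfolding L_term_def norm_mult using character_norm_le[OF assms(1) b, of p] by (intro mult_mono) auto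
  also have "1 * real p powr - s \<le> real p powr - 1" using p2 s by (simp only: mult_1_left) (intro powr_mono, auto)
  finally have le: "norm (L_term s \<chi> p) \<le> real p powr - 1" .
  also have "\<dots> \<le> 1 / 2" using p2 by (simp add: powr_minus field_simps)
  finally show "norm (L_term s \<chi> p) \<le> 1 / 2" .
  have "(norm (L_term s \<chi> p))\<^sup>2 \<le> (real p powr - 1)\<^sup>2" using le by (intro power_mono) auto
  also have "\<dots> = real p powr - 2"
    unfolding power2_eq_square by (subst powr_add[symmetric]) simp
  finally show "(norm (L_term s \<chi> p))\<^sup>2 \<le> real p powr - 2" .
qed

lemma sum_Re_L_term:
  "(\<Sum>\<chi>\<in>dirichlet_characters b. Re (L_term s \<chi> p)) =
    (if [p = 1] (mod b) then card (dirichlet_characters b) * real p powr - s else 0)"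
proof -
  have "(\<Sum>\<chi>\<in>dirichlet_characters b. Re (L_term s \<chi> p)) =
      Re ((\<Sum>\<chi>\<in>dirichlet_characters b. \<chi> p) * complex_of_real (real p powr - s))"
    unfolding L_term_def sum_distrib_right Re_sum ..
  then show ?thesis unfolding sum_characters[OF b] by simp
qed

text \<open>When the bounds for single factors are multiplied over all characters, orthogonality
  removes the first-order terms unless \<open>p\<close> is congruent to 1, where they add up to
  \<open>K * p powr - s\<close>. This nonnegative quantity is dropped in the upper bound and
  replaced by \<open>K / p\<close> in the lower one, which makes both bounds independent of
  \<open>s\<close>.\<close>

lemma local_factor_bounds:
  assumes p: "prime p"
  defines "K \<equiv> real (card (dirichlet_characters b))"
  shows "(\<Prod>\<chi>\<in>dirichlet_characters b. norm (1 - L_term s \<chi> p)) \<le> exp (2 * K * real p powr - 2)"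
    and "exp (- K * (if [p = 1] (mod b) then 1 / real p else 0) - 2 * K * real p powr - 2)
      \<le> (\<Prod>\<chi>\<in>dirichlet_characters b. norm (1 - L_term s \<chi> p))"
proof -
  let ?X = "dirichlet_characters b"
  note fin = finite_dirichlet_characters[OF b]
  have "(\<Prod>\<chi>\<in>?X. norm (1 - L_term s \<chi> p)) \<le> (\<Prod>\<chi>\<in>?X. exp (- Re (L_term s \<chi> p) + 2 * real p powr - 2))"
  proof (intro prod_mono conjI)
    fix \<chi> assume \<chi>: "\<chi> \<in> ?X"
    show "norm (1 - L_term s \<chi> p) \<le> exp (- Re (L_term s \<chi> p) + 2 * real p powr - 2)"
      by (rule order_trans[OF norm_one_minus_bounds(2)[OF norm_L_term(1)[OF \<chi> p]]])
         (use norm_L_term(2)[OF \<chi> p] in simp)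
  qed simp
  also have "\<dots> = exp (- (\<Sum>\<chi>\<in>?X. Re (L_term s \<chi> p)) + 2 * K * real p powr - 2)"
    unfolding exp_sum[OF fin, symmetric] K_def by (simp add: sum.distrib sum_subtractf sum_negf)
  also have "\<dots> \<le> exp (2 * K * real p powr - 2)"
    unfolding sum_Re_L_term by simp
  finally show "(\<Prod>\<chi>\<in>?X. norm (1 - L_term s \<chi> p)) \<le> exp (2 * K * real p powr - 2)" .
  have p2: "real p \<ge> 2" using prime_ge_2_nat[OF p] by simp
  have "real p powr - s \<le> real p powr - 1" using p2 s by (intro powr_mono) auto
  also have "\<dots> = 1 / real p" using p2 by (simp add: powr_minus_divide)
  finally have "(\<Sum>\<chi>\<in>?X. Re (L_term s \<chi> p)) \<le> K * (if [p = 1] (mod b) then 1 / real p else 0)"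
    unfolding sum_Re_L_term using mult_left_mono[of "real p powr - s" "1 / real p" K] by (auto simp: K_def)
  then have "exp (- K * (if [p = 1] (mod b) then 1 / real p else 0) - 2 * K * real p powr - 2)
      \<le> exp (- (\<Sum>\<chi>\<in>?X. Re (L_term s \<chi> p)) - 2 * K * real p powr - 2)"
    by simp
  also have "\<dots> = (\<Prod>\<chi>\<in>?X. exp (- Re (L_term s \<chi> p) - 2 * real p powr - 2))"
    unfolding exp_sum[OF fin, symmetric] K_def by (simp add: sum_subtractf sum_negf)
  also have "\<dots> \<le> (\<Prod>\<chi>\<in>?X. norm (1 - L_term s \<chi> p))"
  proof (intro prod_mono conjI)
    fix \<chi> assume \<chi>: "\<chi> \<in> ?X"
    show "exp (- Re (L_term s \<chi> p) - 2 * real p powr - 2) \<le> norm (1 - L_term s \<chi> p)"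
      by (rule order_trans[OF _ norm_one_minus_bounds(1)[OF norm_L_term(1)[OF \<chi> p]]])
         (use norm_L_term(2)[OF \<chi> p] in simp)
  qed simp
  finally show "exp (- K * (if [p = 1] (mod b) then 1 / real p else 0) - 2 * K * real p powr - 2)
      \<le> (\<Prod>\<chi>\<in>?X. norm (1 - L_term s \<chi> p))" .
qed

lemma prod_L_tendsto:
  "(\<lambda>N. (\<Prod>p | prime p \<and> p \<le> N. \<Prod>\<chi>\<in>dirichlet_characters b. norm (1 - L_term s \<chi> p)) *
      (\<Prod>\<chi>\<in>dirichlet_characters b. norm (dirichlet_L \<chi> s))) \<longlonglongrightarrow> 1"
proof -
  have "(\<lambda>N. \<Prod>\<chi>\<in>dirichlet_characters b.
      norm ((\<Prod>p | prime p \<and> p \<le> N. 1 - L_term s \<chi> p) * dirichlet_L \<chi> s)) \<longlonglongrightarrow> (\<Prod>\<chi>\<in>dirichlet_characters b. norm (1 :: complex))"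
  proof (intro tendsto_prod tendsto_norm)
    fix \<chi> assume \<chi>: "\<chi> \<in> dirichlet_characters b"
    have sm: "summable (\<lambda>n. norm (L_term s \<chi> n))"
      using summable_dirichlet_L[OF b \<chi> s] unfolding L_term_def
      by (subst summable_Suc_iff[symmetric])
    have "dirichlet_L \<chi> s = suminf (L_term s \<chi>)"
      using suminf_split_head[OF summable_norm_cancel[OF sm]] by (simp add: dirichlet_L_def L_term_def[abs_def])
    moreover have "(\<lambda>N. (\<Prod>p | prime p \<and> p \<le> N. 1 - L_term s \<chi> p) * suminf (L_term s \<chi>)) \<longlonglongrightarrow> 1"
      by (rule euler_product[OF _ _ _ sm])
         (simp_all add: L_term_def dirichlet_characterD[OF \<chi>] powr_mult mult_ac)
    ultimately show "(\<lambda>N. (\<Prod>p | prime p \<and> p \<le> N. 1 - L_term s \<chi> p) * dirichlet_L \<chi> s) \<longlonglongrightarrow> 1" by simp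
  qed
  also have "(\<lambda>N. \<Prod>\<chi>\<in>dirichlet_characters b.
      norm ((\<Prod>p | prime p \<and> p \<le> N. 1 - L_term s \<chi> p) * dirichlet_L \<chi> s)) =
    (\<lambda>N. (\<Prod>p | prime p \<and> p \<le> N. \<Prod>\<chi>\<in>dirichlet_characters b. norm (1 - L_term s \<chi> p)) *
      (\<Prod>\<chi>\<in>dirichlet_characters b. norm (dirichlet_L \<chi> s)))"
    unfolding norm_mult prod.distrib prod_norm[symmetric] by (subst prod.swap) (rule refl)
  finally show ?thesis by simp
qed

lemma sum_prime_powr_le:
  "(\<Sum>p | prime p \<and> p \<le> N. real p powr - 2) \<le> (\<Sum>n. real n powr - 2)"
  by (rule sum_le_suminf) (auto simp: summable_real_powr_iff)

text \<open>The bound does not depend on \<open>s\<close>; this is what excludes two zeros at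
  1.\<close>

lemma prod_dirichlet_L_ge:
  "exp (- 2 * card (dirichlet_characters b) * (\<Sum>n. real n powr - 2))
     \<le> (\<Prod>\<chi>\<in>dirichlet_characters b. norm (dirichlet_L \<chi> s))"
proof -
  let ?K = "real (card (dirichlet_characters b))" and ?Z = "\<Sum>n. real n powr - 2"
  let ?F = "\<Prod>\<chi>\<in>dirichlet_characters b. norm (dirichlet_L \<chi> s)"
  have F0: "?F \<ge> 0" by (intro prod_nonneg) auto
  have "(\<Prod>p | prime p \<and> p \<le> N. \<Prod>\<chi>\<in>dirichlet_characters b. norm (1 - L_term s \<chi> p)) * ?F \<le> exp (2 * ?K * ?Z) * ?F" for N
  proof (rule mult_right_mono[OF _ F0])
    have "(\<Prod>p | prime p \<and> p \<le> N. \<Prod>\<chi>\<in>dirichlet_characters b. norm (1 - L_term s \<chi> p))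
        \<le> (\<Prod>p | prime p \<and> p \<le> N. exp (2 * ?K * real p powr - 2))"
      by (intro prod_mono conjI local_factor_bounds(1) prod_nonneg) auto
    also have "\<dots> = exp (2 * ?K * (\<Sum>p | prime p \<and> p \<le> N. real p powr - 2))"
      by (subst exp_sum[symmetric]) (simp_all add: sum_distrib_left)
    also have "\<dots> \<le> exp (2 * ?K * ?Z)"
      unfolding exp_le_cancel_iff by (intro mult_left_mono sum_prime_powr_le) simp
    finally show "(\<Prod>p | prime p \<and> p \<le> N. \<Prod>\<chi>\<in>dirichlet_characters b. norm (1 - L_term s \<chi> p)) \<le> exp (2 * ?K * ?Z)" .
  qed
  then have "1 \<le> exp (2 * ?K * ?Z) * ?F"
    by (intro LIMSEQ_le_const2[OF prod_L_tendsto]) blast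
  then have "exp (- (2 * ?K * ?Z)) * 1 \<le> exp (- (2 * ?K * ?Z)) * (exp (2 * ?K * ?Z) * ?F)"
    by (intro mult_left_mono) auto
  also have "\<dots> = ?F" by (simp flip: mult.assoc exp_add)
  finally show ?thesis by simp
qed

text \<open>Again uniform in \<open>s\<close>: under the bound \<open>T\<close> the product cannot
  tend to infinity as \<open>s\<close> decreases to 1.\<close>

lemma prod_dirichlet_L_le:
  fixes T :: real
  assumes T: "\<And>N. (\<Sum>p | prime p \<and> p \<le> N \<and> [p = 1] (mod b). 1 / real p) \<le> T"
  shows "(\<Prod>\<chi>\<in>dirichlet_characters b. norm (dirichlet_L \<chi> s))
    \<le> exp (card (dirichlet_characters b) * T + 2 * card (dirichlet_characters b) * (\<Sum>n. real n powr - 2))"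
proof -
  let ?K = "real (card (dirichlet_characters b))" and ?Z = "\<Sum>n. real n powr - 2"
  let ?F = "\<Prod>\<chi>\<in>dirichlet_characters b. norm (dirichlet_L \<chi> s)"
  have F0: "?F \<ge> 0" by (intro prod_nonneg) auto
  have "exp (- (?K * T + 2 * ?K * ?Z)) * ?F
      \<le> (\<Prod>p | prime p \<and> p \<le> N. \<Prod>\<chi>\<in>dirichlet_characters b. norm (1 - L_term s \<chi> p)) * ?F" for N
  proof (rule mult_right_mono[OF _ F0])
    let ?P = "{p. prime p \<and> p \<le> N}"
    let ?u = "\<lambda>p. if [p = 1] (mod b) then 1 / real p else 0"
    have "(\<Sum>p\<in>?P. ?u p) = (\<Sum>p | prime p \<and> p \<le> N \<and> [p = 1] (mod b). 1 / real p)"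
      by (subst sum.inter_filter[symmetric]) (auto intro!: sum.cong)
    then have "(\<Sum>p\<in>?P. ?u p) \<le> T" using T by simp
    then have "?K * (\<Sum>p\<in>?P. ?u p) + 2 * ?K * (\<Sum>p\<in>?P. real p powr - 2) \<le> ?K * T + 2 * ?K * ?Z"
      by (intro add_mono mult_left_mono sum_prime_powr_le) simp_all
    then have "exp (- (?K * T + 2 * ?K * ?Z)) \<le> exp (- (?K * (\<Sum>p\<in>?P. ?u p) + 2 * ?K * (\<Sum>p\<in>?P. real p powr - 2)))"
      by simp
    also have "\<dots> = exp (\<Sum>p\<in>?P. - ?K * ?u p - 2 * ?K * real p powr - 2)"
      unfolding sum_subtractf sum_distrib_left[symmetric] by simp
    also have "\<dots> = (\<Prod>p\<in>?P. exp (- ?K * ?u p - 2 * ?K * real p powr - 2))"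
      by (rule exp_sum) simp
    also have "\<dots> \<le> (\<Prod>p\<in>?P. \<Prod>\<chi>\<in>dirichlet_characters b. norm (1 - L_term s \<chi> p))"
      by (intro prod_mono conjI local_factor_bounds(2)) auto
    finally show "exp (- (?K * T + 2 * ?K * ?Z)) \<le> (\<Prod>p\<in>?P. \<Prod>\<chi>\<in>dirichlet_characters b. norm (1 - L_term s \<chi> p))" .
  qed
  then have *: "exp (- (?K * T + 2 * ?K * ?Z)) * ?F \<le> 1"
    by (intro LIMSEQ_le_const[OF prod_L_tendsto]) blast
  have "?F = exp (?K * T + 2 * ?K * ?Z) * (exp (- (?K * T + 2 * ?K * ?Z)) * ?F)"
    by (simp flip: mult.assoc exp_add)
  also have "\<dots> \<le> exp (?K * T + 2 * ?K * ?Z) * 1"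
    by (intro mult_left_mono *) simp
  finally show ?thesis by simp
qed

end

section \<open>Nonvanishing at 1 and primes congruent to 1\<close>

text \<open>With \<open>S n = 1 + t + ... + t ^ (n - 1)\<close> the claim reduces to
  \<open>n * (n + 1) * t ^ n \<le> S n * S (n + 1)\<close>. The inequality of arithmetic and
  geometric means for the pairs \<open>t ^ i\<close>, \<open>t ^ (n - 1 - i)\<close> gives
  \<open>S n \<ge> n * r ^ (n - 1)\<close> with \<open>r = sqrt t\<close>, which is enough as
  \<open>r < 1\<close>.\<close>

lemma lambert_decreasing:
  fixes t :: real
  assumes n: "n \<ge> 1" and t: "0 < t" "t < 1"
  shows "1 / (real (Suc n) * (1 - t)) - t ^ Suc n / (1 - t ^ Suc n) \<le> 1 / (real n * (1 - t)) - t ^ n / (1 - t ^ n)"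
proof -
  define r where "r = sqrt t"
  have r: "0 < r" "r < 1" "t = r\<^sup>2" using t by (simp_all add: r_def)
  define S where "S n = (\<Sum>i<n. t ^ i)" for n
  have SS: "1 - t ^ n = (1 - t) * S n" for n by (simp add: S_def one_diff_power_eq)
  have Sge: "real n * r ^ (n - 1) \<le> S n" if "n \<ge> 1" for n
  proof -
    have "2 * (real n * r ^ (n - 1)) = (\<Sum>i<n. 2 * (r ^ i * r ^ (n - 1 - i)))"
      by (simp add: sum_distrib_left flip: power_add)
    also have "\<dots> \<le> (\<Sum>i<n. (r ^ i)\<^sup>2 + (r ^ (n - 1 - i))\<^sup>2)"
      by (intro sum_mono) (use sum_squares_bound in \<open>simp add: mult.assoc\<close>)
    also have "\<dots> = (\<Sum>i<n. t ^ i) + (\<Sum>i<n. t ^ (n - Suc i))"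
      by (simp add: r(3) sum.distrib power_mult[symmetric] mult.commute)
    also have "(\<Sum>i<n. t ^ (n - Suc i)) = (\<Sum>i<n. t ^ i)" by (rule sum.nat_diff_reindex)
    finally show ?thesis by (simp add: S_def)
  qed
  have Spos: "S n > 0" if "n \<ge> 1" for n
    using Sge[OF that] r that by (intro less_le_trans[OF _ Sge[OF that]]) simp
  have "real n * real (Suc n) * t ^ n \<le> (real n * r ^ (n - 1)) * (real (Suc n) * r ^ n)"
  proof -
    have "t ^ n = r ^ (n + n)" by (simp add: r(3) flip: power_mult power_add mult_2)
    also have "\<dots> \<le> r ^ ((n - 1) + n)" using r by (intro power_decreasing) auto
    finally have "real n * real (Suc n) * t ^ n \<le> real n * real (Suc n) * r ^ ((n - 1) + n)"
      by (intro mult_left_mono) auto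
    then show ?thesis by (simp only: power_add mult_ac)
  qed
  also have "\<dots> \<le> S n * S (Suc n)"
    using Sge[of n] Sge[of "Suc n"] n r Spos[of n] by (intro mult_mono) auto
  finally have key: "real n * real (Suc n) * t ^ n \<le> S n * S (Suc n)" .
  have pos: "1 - t > 0" "S n > 0" "S (Suc n) > 0" "real n > 0" using t n Spos by auto
  have S2: "S (Suc n) = 1 + t * S n"
    unfolding S_def by (subst sum.lessThan_Suc_shift) (simp add: sum_distrib_left)
  have "t ^ n / (1 - t ^ n) - t ^ Suc n / (1 - t ^ Suc n) = t ^ n / ((1 - t) * (S n * S (Suc n)))"
  proof -
    have "t ^ n / (1 - t ^ n) - t ^ Suc n / (1 - t ^ Suc n) =
        (t ^ n * S (Suc n) - t * t ^ n * S n) / ((1 - t) * (S n * S (Suc n)))"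
      unfolding SS using pos by (simp add: divide_simps)
    also have "t ^ n * S (Suc n) - t * t ^ n * S n = t ^ n" unfolding S2 by (simp add: algebra_simps)
    finally show ?thesis .
  qed
  also have "\<dots> \<le> 1 / ((1 - t) * (real n * real (Suc n)))"
    using key pos by (simp add: divide_simps mult_ac)
  also have "\<dots> = 1 / (real n * (1 - t)) - 1 / (real (Suc n) * (1 - t))"
    using pos by (simp add: divide_simps)
  finally show ?thesis by linarith
qed

text \<open>Expanding \<open>t ^ n / (1 - t ^ n)\<close> geometrically up to exponent
  \<open>M\<close> and collecting equal exponents produces the divisor sums. Each of the
  \<open>M\<close> remainders is at most \<open>t ^ M / (1 - t)\<close> in absolute value. In this
  finite form no double series has to be rearranged.\<close>

lemma lambert_divisor_sum:
  fixes r :: "nat \<Rightarrow> real" and t :: real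
  assumes t: "0 < t" "t < 1" and r: "\<And>n. \<bar>r n\<bar> \<le> 1"
  shows "(\<Sum>m=1..M. (\<Sum>n | n dvd m. r n) * t ^ m) - M * t ^ M / (1 - t) \<le> (\<Sum>n=1..M. r n * (t ^ n / (1 - t ^ n)))"
proof -
  let ?err = "\<lambda>n. t ^ (n * (M div n + 1)) / (1 - t ^ n)"
  have split: "t ^ n / (1 - t ^ n) = (\<Sum>k=1..M div n. t ^ (n * k)) + ?err n" if "n \<ge> 1" for n
  proof -
    have tn: "t ^ n < 1" using t that by (simp add: power_less_one_iff)
    have geo: "(\<Sum>k=1..K. u ^ k) * (1 - u) = u - u ^ (K + 1)" for u :: real and K
    proof (induction K)
      case (Suc K)
      have "(\<Sum>k=1..Suc K. u ^ k) * (1 - u) = (\<Sum>k=1..K. u ^ k) * (1 - u) + u ^ Suc K * (1 - u)"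
        by (simp add: distrib_right)
      also have "\<dots> = u - u ^ (Suc K + 1)" unfolding Suc by (simp add: algebra_simps)
      finally show ?case .
    qed simp
    have "(\<Sum>k=1..K. t ^ (n * k)) * (1 - t ^ n) = t ^ n - t ^ (n * (K + 1))" for K
      unfolding power_mult by (rule geo)
    then have "(\<Sum>k=1..K. t ^ (n * k)) = (t ^ n - t ^ (n * (K + 1))) / (1 - t ^ n)" for K
      using tn by (simp only: eq_divide_eq) simp
    then show ?thesis by (simp only: diff_divide_distrib)
  qed
  have err: "\<bar>r n * ?err n\<bar> \<le> t ^ M / (1 - t)" if "n \<in> {1..M}" for n
  proof -
    have n: "n \<ge> 1" using that by simp
    have "M < n * (M div n + 1)" using n dividend_less_times_div[of n M] by simp
    then have 1: "t ^ (n * (M div n + 1)) \<le> t ^ M" using t by (intro power_decreasing) auto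
    have 2: "t ^ n \<le> t" using power_decreasing[of 1 n t] t n by simp
    have "?err n \<le> t ^ M / (1 - t)" using 1 2 t by (intro frac_le) auto
    moreover have "?err n \<ge> 0" using 2 t by (intro divide_nonneg_nonneg) auto
    ultimately have "\<bar>r n\<bar> * ?err n \<le> 1 * (t ^ M / (1 - t))" using r[of n] by (intro mult_mono) auto
    then show ?thesis unfolding abs_mult abs_of_nonneg[OF \<open>?err n \<ge> 0\<close>] mult_1_left .
  qed
  have "(\<Sum>n=1..M. r n * (t ^ n / (1 - t ^ n))) =
      (\<Sum>n=1..M. \<Sum>k=1..M div n. r n * t ^ (n * k)) + (\<Sum>n=1..M. r n * ?err n)"
    unfolding sum.distrib[symmetric]
    by (intro sum.cong refl) (simp add: split ring_distribs sum_distrib_left del: mult_Suc_right)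
  moreover have "(\<Sum>n=1..M. \<Sum>k=1..M div n. r n * t ^ (n * k)) = (\<Sum>m=1..M. (\<Sum>n | n dvd m. r n) * t ^ m)"
  proof -
    have fin: "finite {n. n dvd m}" if "m \<in> {1..M}" for m using that by simp
    have "(\<Sum>n=1..M. \<Sum>k=1..M div n. r n * t ^ (n * k)) =
        (\<Sum>(n, k)\<in>Sigma {1..M} (\<lambda>n. {1..M div n}). r n * t ^ (n * k))"
      by (rule sum.Sigma) auto
    also have "\<dots> = (\<Sum>(m, n)\<in>Sigma {1..M} (\<lambda>m. {n. n dvd m}). r n * t ^ m)"
    proof (rule sum.reindex_bij_witness[of _ "\<lambda>(m, n). (n, m div n)" "\<lambda>(n, k). (n * k, n)"], goal_cases)
      case (2 x)
      obtain n k where x: "x = (n, k)" by force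
      have "n * k \<le> n * (M div n)" using 2 x by simp
      also have "\<dots> \<le> M" by simp
      finally show ?case using 2 x by auto
    next
      case (4 y)
      obtain m n where y: "y = (m, n)" by force
      then have "n > 0" "n dvd m" "1 \<le> m" "m \<le> M" using 4 by (auto intro: Nat.gr0I)
      moreover from this have "m div n \<ge> 1" "m div n \<le> M div n" "n \<le> m"
        by (auto simp: div_le_mono dvd_imp_le div_greater_zero_iff Suc_le_eq)
      ultimately show ?case using y by auto
    qed auto
    also have "\<dots> = (\<Sum>m=1..M. \<Sum>n | n dvd m. r n * t ^ m)"
      using fin by (intro sum.Sigma[symmetric]) auto
    finally show ?thesis by (simp add: sum_distrib_right)
  qed
  moreover have "- (\<Sum>n=1..M. r n * ?err n) \<le> M * t ^ M / (1 - t)"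
  proof -
    have "- (\<Sum>n=1..M. r n * ?err n) \<le> (\<Sum>n=1..M. \<bar>r n * ?err n\<bar>)"
      unfolding sum_negf[symmetric] by (intro sum_mono) linarith
    also have "\<dots> \<le> (\<Sum>n=1..M. t ^ M / (1 - t))" by (intro sum_mono err)
    finally show ?thesis by simp
  qed
  ultimately show ?thesis by linarith
qed

lemma real_character_values:
  assumes "b > 0" "\<chi> \<in> dirichlet_characters b" "\<And>n. cnj (\<chi> n) = \<chi> n"
  shows "\<chi> n \<in> {0, 1, -1}"
proof -
  have re: "\<chi> n = of_real (Re (\<chi> n))" using assms(3)[of n] by (simp add: complex_eq_iff)
  have "norm (\<chi> n) = 0 \<or> norm (\<chi> n) = 1" using character_norm[OF assms(2,1)] by simp
  then have "\<bar>Re (\<chi> n)\<bar> = 0 \<or> \<bar>Re (\<chi> n)\<bar> = 1" by (subst (asm) (1 2) re) simp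
  then have "Re (\<chi> n) \<in> {0, 1, -1}" by auto
  then show ?thesis using re by auto
qed

text \<open>For \<open>x = \<chi> p\<close> with a real character \<open>\<chi>\<close> this is the
  divisor sum of \<open>\<chi>\<close> at \<open>p ^ k\<close>.\<close>

lemma geometric_sum_sign:
  fixes x :: complex
  assumes "x \<in> {0, 1, -1}"
  shows "(\<Sum>i\<le>k. x ^ i) \<ge> 0" "even k \<Longrightarrow> (\<Sum>i\<le>k. x ^ i) \<ge> 1"
proof -
  have m1: "(\<Sum>i\<le>k. (- 1) ^ i) = (if even k then 1 else (0 :: complex))"
    by (induction k) auto
  have z: "(\<Sum>i\<le>k. 0 ^ i) = (1 :: complex)"
    by (induction k) auto
  consider "x = 0" | "x = 1" | "x = -1" using assms by auto
  then have v: "(\<Sum>i\<le>k. x ^ i) =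
      (if x = 0 then 1 else if x = 1 then of_nat (Suc k) else if even k then 1 else 0)"
  proof cases
    case 1
    show ?thesis unfolding 1 z by simp
  next
    case 2
    show ?thesis unfolding 2 by simp
  next
    case 3
    show ?thesis unfolding 3 m1 by simp
  qed
  show "(\<Sum>i\<le>k. x ^ i) \<ge> 0" "even k \<Longrightarrow> (\<Sum>i\<le>k. x ^ i) \<ge> 1"
    unfolding v by (simp_all add: less_eq_complex_def)
qed

text \<open>The divisor sum is multiplicative and becomes a geometric sum at prime powers. In a
  square all exponents are even, whence the bound 1.\<close>

lemma character_divisor_sum_sign:
  assumes b: "b > 0" and \<chi>: "\<chi> \<in> dirichlet_characters b" and re: "\<And>n. cnj (\<chi> n) = \<chi> n" and m: "m > 0"
  shows "dirichlet_conv \<chi> (\<lambda>_. 1) m \<ge> 0" "dirichlet_conv \<chi> (\<lambda>_. 1) (m\<^sup>2) \<ge> 1"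
proof -
  let ?c = "dirichlet_conv \<chi> (\<lambda>_. 1)"
  have mult: "?c (m * n) = ?c m * ?c n" if "m > 0" "n > 0" "coprime m n" for m n
  proof -
    have "multiplicative ?c"
      by (intro multiplicative_dirichlet_conv) (simp_all add: multiplicative_def dirichlet_characterD[OF \<chi>])
    then show ?thesis using that unfolding multiplicative_def by blast
  qed
  have pp: "?c (p ^ k) = (\<Sum>i\<le>k. \<chi> p ^ i)" if "prime p" for p k
    using dirichlet_conv_prime_power[OF that] by (simp add: dirichlet_character_power[OF \<chi>])
  note sign = geometric_sum_sign[OF real_character_values[OF b \<chi> re]]
  show "?c m \<ge> 0" using m
  proof (induction m rule: coprime_prime_power_induct)
    case one
    show ?case by (simp add: dirichlet_characterD[OF \<chi>] less_eq_complex_def)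
  next
    case (prime_power p k)
    then show ?case unfolding pp[OF prime_power(1)] by (intro sign)
  next
    case (coprime m n)
    then show ?case unfolding mult[OF coprime(1-3)] by (intro mult_nonneg_nonneg)
  qed
  show "?c (m\<^sup>2) \<ge> 1" using m
  proof (induction m rule: coprime_prime_power_induct)
    case one
    show ?case by (simp add: dirichlet_characterD[OF \<chi>] less_eq_complex_def)
  next
    case (prime_power p k)
    have "?c ((p ^ k)\<^sup>2) = (\<Sum>i\<le>k * 2. \<chi> p ^ i)"
      unfolding power_mult[symmetric] by (rule pp[OF prime_power(1)])
    then show ?case using sign(2)[of "k * 2" p] by simp
  next
    case (coprime m n)
    have zo: "0 \<le> (1 :: complex)" by (simp add: less_eq_complex_def)
    have "?c ((m * n)\<^sup>2) = ?c (m\<^sup>2) * ?c (n\<^sup>2)"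
      unfolding power_mult_distrib using coprime(1-3) by (intro mult) auto
    also have "\<dots> \<ge> 1 * 1"
      by (intro mult_mono coprime(4,5) order_trans[OF zo coprime(4)] zo)
    finally show ?case by simp
  qed
qed

text \<open>Monsky's argument: if \<open>L(\<chi>, 1)\<close> vanished, then the Lambert series of \<open>\<chi>\<close> would stay bounded
  as \<open>t \<rightarrow> 1\<close>, because \<open>1 / (n (1 - t)) - t\<^sup>n / (1 - t\<^sup>n)\<close> decreases in \<open>n\<close>; but it dominates
  \<open>\<Sum>j. t\<^bsup>j\<^sup>2\<^esup>\<close>.\<close>

lemma dirichlet_L_real_nonzero:
  assumes b: "b > 0" and \<chi>: "\<chi> \<in> dirichlet_characters b" "\<chi> \<noteq> principal_character b"
    and re: "\<And>n. cnj (\<chi> n) = \<chi> n"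
  shows "dirichlet_L \<chi> 1 \<noteq> 0"
proof
  assume L0: "dirichlet_L \<chi> 1 = 0"
  define r where "r n = Re (\<chi> n)" for n
  have r: "\<chi> n = of_real (r n)" for n using re[of n] by (simp add: r_def complex_eq_iff)
  have r1: "\<bar>r n\<bar> \<le> 1" for n using character_norm_le[OF \<chi>(1) b, of n] by (simp add: r)
  \<comment> \<open>\<open>b + 1\<close> squares suffice: their sum tends to \<open>b + 1\<close> as
    \<open>t\<close> tends to 1, beyond the bound \<open>b\<close>.\<close>
  let ?J = "Suc b"
  have bound: "(\<Sum>j=1..?J. t ^ (j\<^sup>2)) \<le> b" if t: "0 < t" "t < 1" for t :: real
  proof -
    let ?g = "\<lambda>n. t ^ n / (1 - t ^ n)"
    define \<beta> where "\<beta> n = 1 / (real (Suc n) * (1 - t)) - ?g (Suc n)" for n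
    have \<beta>0: "\<beta> \<longlonglongrightarrow> 0"
    proof -
      have "(\<lambda>n. 1 / real (Suc n) * (1 / (1 - t)) - ?g (Suc n)) \<longlonglongrightarrow> 0 * (1 / (1 - t)) - 0 / (1 - 0)"
        using t by (intro tendsto_intros LIMSEQ_Suc[OF LIMSEQ_power_zero] LIMSEQ_Suc[OF lim_1_over_n]) auto
      then show ?thesis by (simp add: \<beta>_def[abs_def])
    qed
    have dec: "\<beta> (Suc n) \<le> \<beta> n" for n unfolding \<beta>_def by (rule lambert_decreasing) (use t in auto)
    \<comment> \<open>The index is shifted, so \<open>\<beta> 0\<close> is the term at
      \<open>n = 1\<close>. Its value 1 is the factor that the Dirichlet test puts next to the bound
      \<open>b\<close> of the character sums.\<close>
    have "\<beta> 0 = 1" using t by (simp add: \<beta>_def divide_simps)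
    then have \<beta>: "summable (\<lambda>n. \<chi> (Suc n) * of_real (\<beta> n))"
      "norm (\<Sum>n. \<chi> (Suc n) * of_real (\<beta> n)) \<le> b"
      using dirichlet_test_decreasing[OF norm_sum_character_Suc[OF b \<chi>] \<beta>0 dec] by auto
    have "(\<lambda>n. \<chi> (Suc n) * of_real (real (Suc n) powr - 1)) sums 0"
      using summable_sums[OF summable_dirichlet_L_nonprincipal[OF b \<chi>, of 1]] L0 by (simp add: dirichlet_L_def)
    \<comment> \<open>Subtracting the series with \<open>\<beta>\<close> from
      \<open>1 / (1 - t)\<close> times the series of value 0 leaves the Lambert series.\<close>
    then have "(\<lambda>n. \<chi> (Suc n) * of_real (real (Suc n) powr - 1) * of_real (1 / (1 - t)) - \<chi> (Suc n) * of_real (\<beta> n))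
        sums (0 * of_real (1 / (1 - t)) - (\<Sum>n. \<chi> (Suc n) * of_real (\<beta> n)))"
      by (intro sums_diff sums_mult2 summable_sums \<beta>(1))
    also have "(\<lambda>n. \<chi> (Suc n) * of_real (real (Suc n) powr - 1) * of_real (1 / (1 - t)) - \<chi> (Suc n) * of_real (\<beta> n)) =
        (\<lambda>n. \<chi> (Suc n) * of_real (?g (Suc n)))"
    proof
      fix n
      have "real (Suc n) powr - 1 * (1 / (1 - t)) - \<beta> n = ?g (Suc n)"
        by (simp add: \<beta>_def powr_minus divide_inverse)
      then show "\<chi> (Suc n) * of_real (real (Suc n) powr - 1) * of_real (1 / (1 - t)) - \<chi> (Suc n) * of_real (\<beta> n) =
          \<chi> (Suc n) * of_real (?g (Suc n))"
        by (simp only: mult.assoc of_real_mult[symmetric] right_diff_distrib[symmetric] of_real_diff[symmetric])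
    qed
    finally have sums: "(\<lambda>n. Re (\<chi> (Suc n) * of_real (?g (Suc n)))) sums Re (- (\<Sum>n. \<chi> (Suc n) * of_real (\<beta> n)))"
      by (intro sums_Re) simp
    define G where "G = Re (- (\<Sum>n. \<chi> (Suc n) * of_real (\<beta> n)))"
    have "G \<le> norm (\<Sum>n. \<chi> (Suc n) * of_real (\<beta> n))"
      unfolding G_def by (metis complex_Re_le_cmod norm_minus_cancel)
    then have G: "G \<le> b" using \<beta>(2) by simp
    have "(\<lambda>M. \<Sum>n<M. r (Suc n) * ?g (Suc n)) \<longlonglongrightarrow> G"
      using sums unfolding sums_def G_def r by simp
    then have "(\<lambda>M. \<Sum>n=1..M. r n * ?g n) \<longlonglongrightarrow> G"
      by (simp add: sum.atLeast1_atMost_eq)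
    moreover have "(\<lambda>M. real M * t ^ M) \<longlonglongrightarrow> 0" using powser_times_n_limit_0[of t] t by simp
    then have "(\<lambda>M. (\<Sum>j=1..?J. t ^ (j\<^sup>2)) - real M * t ^ M / (1 - t)) \<longlonglongrightarrow> (\<Sum>j=1..?J. t ^ (j\<^sup>2)) - 0 / (1 - t)"
      using t by (intro tendsto_intros) auto
    moreover have "(\<Sum>j=1..?J. t ^ (j\<^sup>2)) - real M * t ^ M / (1 - t) \<le> (\<Sum>n=1..M. r n * ?g n)" if M: "M \<ge> ?J\<^sup>2" for M
    proof -
      have c: "dirichlet_conv \<chi> (\<lambda>_. 1) m = of_real (\<Sum>n | n dvd m. r n)" for m
        by (simp add: dirichlet_conv_def r)
      have c0: "(\<Sum>n | n dvd m. r n) \<ge> 0" and c1: "(\<Sum>n | n dvd m\<^sup>2. r n) \<ge> 1" if "m > 0" for m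
        using character_divisor_sum_sign[OF b \<chi>(1) re that] unfolding c by (simp_all add: less_eq_complex_def)
      have "(\<Sum>j=1..?J. t ^ (j\<^sup>2)) \<le> (\<Sum>j=1..?J. (\<Sum>n | n dvd j\<^sup>2. r n) * t ^ (j\<^sup>2))"
      proof (rule sum_mono)
        fix j assume "j \<in> {1..?J}"
        then show "t ^ (j\<^sup>2) \<le> (\<Sum>n | n dvd j\<^sup>2. r n) * t ^ (j\<^sup>2)"
          using mult_right_mono[OF c1[of j], of "t ^ (j\<^sup>2)"] t by simp
      qed
      also have "\<dots> = (\<Sum>m\<in>(\<lambda>j. j\<^sup>2) ` {1..?J}. (\<Sum>n | n dvd m. r n) * t ^ m)"
        by (subst sum.reindex) (auto simp: inj_on_def)
      also have "\<dots> \<le> (\<Sum>m=1..M. (\<Sum>n | n dvd m. r n) * t ^ m)"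
      proof (rule sum_mono2)
        show "(\<lambda>j. j\<^sup>2) ` {1..?J} \<subseteq> {1..M}"
          using M by (auto intro: order_trans[OF power_mono] simp: Suc_le_eq)
      qed (use t c0 in auto)
      finally show ?thesis using lambert_divisor_sum[where r = r and M = M, OF t r1] by linarith
    qed
    ultimately have "(\<Sum>j=1..?J. t ^ (j\<^sup>2)) - 0 / (1 - t) \<le> G"
      by (intro LIMSEQ_le) auto
    then show ?thesis using G by simp
  qed
  have "((\<lambda>t::real. \<Sum>j=1..?J. t ^ (j\<^sup>2)) \<longlongrightarrow> (\<Sum>j=1..?J. 1 ^ (j\<^sup>2))) (at_left 1)"
    by (intro tendsto_intros)
  moreover have "\<forall>\<^sub>F t::real in at_left 1. t \<in> {0<..<1}"
    by (rule eventually_at_left_real) simp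
  then have "\<forall>\<^sub>F t::real in at_left 1. (\<Sum>j=1..?J. t ^ (j\<^sup>2)) \<le> b"
    by (rule eventually_mono) (use bound in auto)
  ultimately have "(\<Sum>j=1..?J. 1 ^ (j\<^sup>2)) \<le> real b"
    by (rule tendsto_upperbound) (simp add: trivial_limit_at_left_real)
  then show False by simp
qed

text \<open>A zero of \<open>\<chi>\<close> at 1 is also one of its conjugate, a different character
  by the real case. The first zero turns the growth of the principal factor into the constant
  \<open>2 * C\<close>, and the second sends the whole product to 0, against its uniform lower
  bound.\<close>

lemma dirichlet_L_nonzero:
  assumes b: "b > 0" and \<chi>: "\<chi> \<in> dirichlet_characters b" "\<chi> \<noteq> principal_character b"
  shows "dirichlet_L \<chi> 1 \<noteq> 0"
proof
  assume zero: "dirichlet_L \<chi> 1 = 0"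
  let ?X = "dirichlet_characters b" and ?\<chi>0 = "principal_character b"
  note fin = finite_dirichlet_characters[OF b]
  define \<psi> where "\<psi> n = cnj (\<chi> n)" for n
  have \<psi>: "\<psi> \<in> ?X" unfolding \<psi>_def[abs_def] by (rule character_cnj_in[OF \<chi>(1)])
  have \<psi>0: "\<psi> \<noteq> ?\<chi>0"
  proof
    assume "\<psi> = ?\<chi>0"
    then have "cnj (\<psi> n) = cnj (?\<chi>0 n)" for n by simp
    then have "\<chi> = ?\<chi>0" by (auto simp: \<psi>_def principal_character_def fun_eq_iff)
    then show False using \<chi>(2) by simp
  qed
  have \<psi>\<chi>: "\<psi> \<noteq> \<chi>"
    using dirichlet_L_real_nonzero[OF b \<chi>] zero by (auto simp: \<psi>_def fun_eq_iff)
  have "(\<lambda>n. \<chi> (Suc n) * of_real (real (Suc n) powr - 1)) sums 0"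
    using summable_sums[OF summable_dirichlet_L_nonprincipal[OF b \<chi>, of 1]] zero by (simp add: dirichlet_L_def)
  then have "(\<lambda>n. cnj (\<chi> (Suc n) * of_real (real (Suc n) powr - 1))) sums cnj 0"
    by (simp only: sums_cnj)
  then have zero': "dirichlet_L \<psi> 1 = 0"
    unfolding dirichlet_L_def \<psi>_def by (simp add: sums_iff)
  define R where "R = ?X - {?\<chi>0, \<chi>, \<psi>}"
  have X: "?X = insert ?\<chi>0 (insert \<chi> (insert \<psi> R))"
    using principal_character_in[OF b] \<chi>(1) \<psi> by (auto simp: R_def)
  have prod: "(\<Prod>\<xi>\<in>?X. norm (dirichlet_L \<xi> s)) = norm (dirichlet_L ?\<chi>0 s) * (norm (dirichlet_L \<chi> s) *
      (norm (dirichlet_L \<psi> s) * (\<Prod>\<xi>\<in>R. norm (dirichlet_L \<xi> s))))" for s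
    unfolding X using fin \<chi>(2) \<psi>0 \<psi>\<chi> by (subst prod.insert; auto simp: R_def)+
  obtain C where C: "\<forall>s\<ge>1. norm (dirichlet_L \<chi> s - dirichlet_L \<chi> 1) \<le> C * (s - 1)"
    using dirichlet_L_lipschitz[OF b \<chi>] by blast
  have lim: "((\<lambda>s. 2 * C * (norm (dirichlet_L \<psi> s) * (\<Prod>\<xi>\<in>R. norm (dirichlet_L \<xi> s)))) \<longlongrightarrow>
      2 * C * (norm (dirichlet_L \<psi> 1) * (\<Prod>\<xi>\<in>R. norm (dirichlet_L \<xi> 1)))) (at_right 1)"
    by (intro tendsto_intros dirichlet_L_tendsto_1[OF b \<psi> \<psi>0] dirichlet_L_tendsto_1[OF b]) (auto simp: R_def)
  have "\<forall>\<^sub>F s::real in at_right 1. s \<in> {1<..<2}"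
    by (rule eventually_at_right_real) simp
  then have "\<forall>\<^sub>F s in at_right 1. exp (- 2 * card ?X * (\<Sum>n. real n powr - 2)) \<le>
      2 * C * (norm (dirichlet_L \<psi> s) * (\<Prod>\<xi>\<in>R. norm (dirichlet_L \<xi> s)))"
  proof (rule eventually_mono)
    fix s :: real assume s: "s \<in> {1<..<2}"
    have "norm (dirichlet_L ?\<chi>0 s) * norm (dirichlet_L \<chi> s) \<le> 2 / (s - 1) * (C * (s - 1))"
    proof (rule mult_mono)
      show "norm (dirichlet_L ?\<chi>0 s) \<le> 2 / (s - 1)"
        using s by (intro norm_dirichlet_L_le[OF b principal_character_in[OF b]]) auto
      show "norm (dirichlet_L \<chi> s) \<le> C * (s - 1)" using C[rule_format, of s] s zero by simp
    qed (use s in auto)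
    also have "\<dots> = 2 * C" using s by simp
    finally have le: "norm (dirichlet_L ?\<chi>0 s) * norm (dirichlet_L \<chi> s) \<le> 2 * C" .
    have "exp (- 2 * card ?X * (\<Sum>n. real n powr - 2)) \<le> (\<Prod>\<xi>\<in>?X. norm (dirichlet_L \<xi> s))"
      using s by (intro prod_dirichlet_L_ge[OF b]) auto
    also have "\<dots> \<le> 2 * C * (norm (dirichlet_L \<psi> s) * (\<Prod>\<xi>\<in>R. norm (dirichlet_L \<xi> s)))"
      unfolding prod mult.assoc[symmetric, of "norm (dirichlet_L ?\<chi>0 s)"]
      by (intro mult_right_mono le mult_nonneg_nonneg prod_nonneg) auto
    finally show "exp (- 2 * card ?X * (\<Sum>n. real n powr - 2)) \<le>
      2 * C * (norm (dirichlet_L \<psi> s) * (\<Prod>\<xi>\<in>R. norm (dirichlet_L \<xi> s)))" .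
  qed
  from tendsto_lowerbound[OF lim this]
  have "exp (- 2 * card ?X * (\<Sum>n. real n powr - 2)) \<le> 0"
    using zero' by simp
  then show False by (simp add: not_le[symmetric])
qed

theorem sum_inverse_primes_cong_1_unbounded:
  fixes b :: nat and T :: real
  assumes b: "b > 0"
  shows "\<exists>N. (\<Sum>p | prime p \<and> p \<le> N \<and> [p = 1] (mod b). 1 / real p) > T"
proof (rule ccontr)
  assume "\<not> ?thesis"
  then have T: "(\<Sum>p | prime p \<and> p \<le> N \<and> [p = 1] (mod b). 1 / real p) \<le> T" for N
    by (simp add: not_less)
  let ?X = "dirichlet_characters b" and ?\<chi>0 = "principal_character b"
  define M where "M = exp (card ?X * T + 2 * card ?X * (\<Sum>n. real n powr - 2))"
  note fin = finite_dirichlet_characters[OF b]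
  have prod: "(\<Prod>\<chi>\<in>?X. norm (dirichlet_L \<chi> s)) =
      (\<Prod>\<chi>\<in>?X - {?\<chi>0}. norm (dirichlet_L \<chi> s)) * norm (dirichlet_L ?\<chi>0 s)" for s
    by (subst prod.remove[OF fin principal_character_in[OF b]]) (rule mult.commute)
  have "((\<lambda>s. \<Prod>\<chi>\<in>?X - {?\<chi>0}. norm (dirichlet_L \<chi> s)) \<longlongrightarrow> (\<Prod>\<chi>\<in>?X - {?\<chi>0}. norm (dirichlet_L \<chi> 1))) (at_right 1)"
    by (intro tendsto_intros dirichlet_L_tendsto_1[OF b]) auto
  moreover have "(\<Prod>\<chi>\<in>?X - {?\<chi>0}. norm (dirichlet_L \<chi> 1)) > 0"
    using dirichlet_L_nonzero[OF b] by (intro prod_pos) auto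
  ultimately have "filterlim (\<lambda>s. \<Prod>\<chi>\<in>?X. norm (dirichlet_L \<chi> s)) at_top (at_right 1)"
    unfolding prod using dirichlet_L_principal_at_top[OF b]
    by (rule filterlim_tendsto_pos_mult_at_top)
  then have "\<forall>\<^sub>F s in at_right 1. M + 1 \<le> (\<Prod>\<chi>\<in>?X. norm (dirichlet_L \<chi> s))"
    unfolding filterlim_at_top by blast
  then have "\<forall>\<^sub>F s in at_right 1. M + 1 \<le> (\<Prod>\<chi>\<in>?X. norm (dirichlet_L \<chi> s)) \<and> s \<in> {1<..<2::real}"
    using eventually_at_right_real[of 1 "2::real"] by (simp add: eventually_conj_iff)
  then obtain s :: real where "M + 1 \<le> (\<Prod>\<chi>\<in>?X. norm (dirichlet_L \<chi> s))" "s \<in> {1<..<2}"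
    using eventually_happens[of _ "at_right (1::real)"] by (auto simp: trivial_limit_at_right_real)
  moreover from this have "(\<Prod>\<chi>\<in>?X. norm (dirichlet_L \<chi> s)) \<le> M"
    unfolding M_def by (intro prod_dirichlet_L_le[OF b _ T]) auto
  ultimately show False by simp
qed

section \<open>GCD matrices\<close>

lemma dirichlet_conv_zero:
  assumes "\<And>n. n > 0 \<Longrightarrow> g n = 0"
  shows "dirichlet_conv f g m = 0"
proof (cases "m = 0")
  case False
  then show ?thesis unfolding dirichlet_conv_def
    by (intro sum.neutral ballI) (auto simp: dvd_div_eq_0_iff intro!: assms Nat.gr0I)
qed simp

lemma foldr_dirichlet_conv_zero:
  assumes "f \<in> set fs" "\<And>n. n > 0 \<Longrightarrow> f n = 0"
  shows "foldr dirichlet_conv fs g m = 0"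
  using assms(1)
proof (induction fs arbitrary: m)
  case (Cons f' fs)
  show ?case
  proof (cases "f' = f")
    case True
    then show ?thesis using dirichlet_conv_zero[of f "foldr dirichlet_conv fs g" m] assms(2)
      by (simp add: dirichlet_conv_commute)
  next
    case False
    then have "\<And>m. foldr dirichlet_conv fs g m = 0" using Cons by auto
    then show ?thesis using dirichlet_conv_zero by simp
  qed
qed simp

definition divisors_of_seq :: "(nat \<Rightarrow> nat) \<Rightarrow> nat set" where
  "divisors_of_seq x = {k. \<exists>i\<ge>1. k dvd x i}"

lemma divisor_closed_divisors_of_seq:
  assumes "\<And>i. i \<ge> 1 \<Longrightarrow> x i > 0"
  shows "divisor_closed (divisors_of_seq x)"
  unfolding divisor_closed_def divisors_of_seq_def
  using assms by (auto intro: dvd_trans dvd_pos_nat)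

text \<open>Positive semidefiniteness depends on this nonnegativity alone; multiplicativity of
  \<open>h\<close> enters when the bound from the test vectors is estimated.\<close>

locale moebius_nonneg_seq =
  fixes h :: "nat \<Rightarrow> complex" and x :: "nat \<Rightarrow> nat"
  assumes pos: "i \<ge> 1 \<Longrightarrow> x i > 0"
    and nonneg: "nonneg_on (divisors_of_seq x) (dirichlet_conv h moebius_mu)"
begin

definition weight :: "nat \<Rightarrow> real" where
  "weight k = Re (dirichlet_conv h moebius_mu k)"

lemma weight:
  assumes "k dvd x (Suc i)"
  shows "weight k \<ge> 0" "dirichlet_conv h moebius_mu k = of_real (weight k)"
proof -
  have "k \<in> divisors_of_seq x" using assms unfolding divisors_of_seq_def by auto
  then have "dirichlet_conv h moebius_mu k \<ge> 0" using nonneg by (simp add: nonneg_on_def)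
  then show "weight k \<ge> 0" "dirichlet_conv h moebius_mu k = of_real (weight k)"
    by (auto simp: weight_def less_eq_complex_def complex_eq_iff)
qed

lemma h_eq_sum_weight:
  assumes "m dvd x (Suc i)"
  shows "h m = of_real (\<Sum>k | k dvd m. weight k)"
proof -
  have "m > 0" using dvd_pos_nat[OF pos[of "Suc i"] assms] by simp
  then have "h m = (\<Sum>k | k dvd m. dirichlet_conv h moebius_mu k)"
    by (rule dirichlet_conv_moebius_inversion)
  also have "\<dots> = (\<Sum>k | k dvd m. of_real (weight k))"
    using assms by (intro sum.cong refl) (auto intro: weight(2) dvd_trans)
  finally show ?thesis by simp
qed

lemma h_nonneg:
  assumes "m dvd x (Suc i)" shows "h m \<ge> 0"
proof -
  have "(\<Sum>k | k dvd m. weight k) \<ge> 0"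
    using assms by (intro sum_nonneg) (auto intro: weight(1) dvd_trans)
  then show ?thesis unfolding h_eq_sum_weight[OF assms] by (simp add: less_eq_complex_def)
qed

lemma gcd_matrix_carrier: "gcd_matrix h x n \<in> carrier_mat n n"
  by (simp add: gcd_matrix_def)

lemma gcd_matrix_hermitian: "mat_adjoint (gcd_matrix h x n) = gcd_matrix h x n"
proof (rule eq_matI)
  fix i j assume "i < dim_row (gcd_matrix h x n)" "j < dim_col (gcd_matrix h x n)"
  then have ij: "i < n" "j < n" by (auto simp: gcd_matrix_def)
  have "cnj (h (gcd (x (Suc j)) (x (Suc i)))) = h (gcd (x (Suc i)) (x (Suc j)))"
    using h_eq_sum_weight[of "gcd (x (Suc i)) (x (Suc j))" i] by (simp add: gcd.commute)
  then show "mat_adjoint (gcd_matrix h x n) $$ (i, j) = gcd_matrix h x n $$ (i, j)"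
    using ij by (simp add: gcd_matrix_def)
qed (simp_all add: gcd_matrix_def)

definition divisor_set :: "nat \<Rightarrow> nat set" where
  "divisor_set n = {k. \<exists>i<n. k dvd x (Suc i)}"

lemma finite_divisor_set: "finite (divisor_set n)"
proof -
  have "divisor_set n = (\<Union>i<n. {k. k dvd x (Suc i)})" by (auto simp: divisor_set_def)
  then show ?thesis using pos by simp
qed

text \<open>The gcd matrix factors through the incidence matrix of divisors \<open>k\<close> against
  terms of \<open>x\<close>, with the diagonal matrix of the weights in the middle. This is
  coordinate \<open>k\<close> of the transposed incidence matrix applied to
  \<open>w\<close>.\<close>

definition divisor_sum :: "nat \<Rightarrow> (nat \<Rightarrow> complex) \<Rightarrow> nat \<Rightarrow> complex" where
  "divisor_sum n w k = (\<Sum>i<n. if k dvd x (Suc i) then w i else 0)"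

lemma quad_form_gcd_matrix:
  "quad_form (gcd_matrix h x n) w =
    of_real (\<Sum>k\<in>divisor_set n. weight k * (cmod (divisor_sum n w k))\<^sup>2)"
proof -
  let ?e = "\<lambda>k i. if k dvd x (Suc i) then w i else 0"
  have entry: "cnj (w i) * gcd_matrix h x n $$ (i, j) * w j =
      (\<Sum>k\<in>divisor_set n. of_real (weight k) * (cnj (?e k i) * ?e k j))" if ij: "i < n" "j < n" for i j
  proof -
    let ?m = "gcd (x (Suc i)) (x (Suc j))"
    have "cnj (w i) * gcd_matrix h x n $$ (i, j) * w j = cnj (w i) * h ?m * w j"
      using ij by (simp add: gcd_matrix_def)
    also have "\<dots> = (\<Sum>k | k dvd ?m. of_real (weight k) * (cnj (w i) * w j))"
      using h_eq_sum_weight[of ?m i] by (simp add: sum_distrib_left sum_distrib_right mult_ac)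
    also have "\<dots> = (\<Sum>k\<in>divisor_set n. if k dvd ?m then of_real (weight k) * (cnj (w i) * w j) else 0)"
      using ij finite_divisor_set by (intro sum.mono_neutral_cong_left) (auto simp: divisor_set_def)
    also have "\<dots> = (\<Sum>k\<in>divisor_set n. of_real (weight k) * (cnj (?e k i) * ?e k j))"
      by (intro sum.cong) auto
    finally show ?thesis .
  qed
  have dims: "dim_row (gcd_matrix h x n) = n" "dim_col (gcd_matrix h x n) = n"
    by (simp_all add: gcd_matrix_def)
  have "quad_form (gcd_matrix h x n) w =
      (\<Sum>i<n. \<Sum>j<n. \<Sum>k\<in>divisor_set n. of_real (weight k) * (cnj (?e k i) * ?e k j))"
    unfolding quad_form_def dims by (intro sum.cong refl entry) auto
  also have "\<dots> = (\<Sum>i<n. \<Sum>k\<in>divisor_set n. \<Sum>j<n. of_real (weight k) * (cnj (?e k i) * ?e k j))"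
    by (rule sum.cong[OF refl], rule sum.swap)
  also have "\<dots> = (\<Sum>k\<in>divisor_set n. \<Sum>i<n. \<Sum>j<n. of_real (weight k) * (cnj (?e k i) * ?e k j))"
    by (rule sum.swap)
  also have "\<dots> = (\<Sum>k\<in>divisor_set n. of_real (weight k) * (cnj (divisor_sum n w k) * divisor_sum n w k))"
    unfolding divisor_sum_def by (simp only: cnj_sum sum_product) (simp only: sum_distrib_left)
  also have "\<dots> = of_real (\<Sum>k\<in>divisor_set n. weight k * (cmod (divisor_sum n w k))\<^sup>2)"
    by (simp add: complex_norm_square mult.commute del: of_real_power)
  finally show ?thesis .
qed

lemma ordered_eigenvalues_gcd_matrix_nonneg:
  assumes "r < n"
  shows "ordered_eigenvalues (gcd_matrix h x n) ! r \<ge> 0"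
proof (rule ordered_eigenvalues_nonneg[OF gcd_matrix_carrier gcd_matrix_hermitian assms])
  fix w
  have "(\<Sum>k\<in>divisor_set n. weight k * (cmod (divisor_sum n w k))\<^sup>2) \<ge> 0"
    by (intro sum_nonneg mult_nonneg_nonneg) (auto simp: divisor_set_def intro: weight(1))
  then show "Re (quad_form (gcd_matrix h x n) w) \<ge> 0"
    unfolding quad_form_gcd_matrix Re_complex_of_real .
qed

text \<open>At \<open>k\<close>, the divisor sum of the test vector \<open>\<Sum>p. w\<^sub>p e(x\<^sub>r p) - e(x\<^sub>r)\<close> vanishes if \<open>k\<close> divides
  \<open>x\<^sub>r\<close>, and otherwise involves at most one prime.\<close>

lemma ordered_eigenvalues_gcd_matrix_le:
  fixes w :: "nat \<Rightarrow> real" and \<sigma> :: "nat \<Rightarrow> nat \<Rightarrow> nat"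
  assumes q: "q \<ge> 1" "q \<le> n" and F: "finite F" "\<And>p. p \<in> F \<Longrightarrow> prime p"
    and w: "(\<Sum>p\<in>F. w p) = 1"
    and \<sigma>: "\<And>r p. r < q \<Longrightarrow> p \<in> F \<Longrightarrow> \<sigma> r p < n \<and> q \<le> \<sigma> r p \<and> x (Suc (\<sigma> r p)) = x (Suc r) * p"
  shows "ordered_eigenvalues (gcd_matrix h x n) ! (q - 1) \<le>
    (\<Sum>r<q. \<Sum>p\<in>F. (w p)\<^sup>2 * (Re (h (x (Suc r) * p)) - Re (h (x (Suc r)))))" (is "_ \<le> ?\<epsilon>")
proof -
  define V :: "nat \<Rightarrow> nat \<Rightarrow> complex" where
    "V i r = (\<Sum>p\<in>F. if i = \<sigma> r p then of_real (w p) else 0) - (if i = r then 1 else 0)" for i r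
  \<comment> \<open>An upper bound for the squared divisor sum of the \<open>r\<close>-th test
    vector; being a sum over primes, it can be summed against \<open>weight\<close> prime by
    prime.\<close>
  define B where "B r k = (\<Sum>p\<in>F. if k dvd x (Suc r) * p \<and> \<not> k dvd x (Suc r) then (w p)\<^sup>2 else 0)" for r k
  have DV: "divisor_sum n (\<lambda>i. V i r) k = (\<Sum>p\<in>F. if k dvd x (Suc r) * p then of_real (w p) else 0)
      - (if k dvd x (Suc r) then 1 else 0)" if r: "r < q" for r k
  proof -
    have "divisor_sum n (\<lambda>i. V i r) k =
        (\<Sum>i<n. \<Sum>p\<in>F. if i = \<sigma> r p then (if k dvd x (Suc i) then of_real (w p) else 0) else 0)
        - (\<Sum>i<n. if i = r then (if k dvd x (Suc i) then 1 else 0) else 0)"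
      unfolding divisor_sum_def V_def sum_subtractf[symmetric]
      by (intro sum.cong refl) (auto intro!: sum.cong sum.neutral)
    also have "(\<Sum>i<n. \<Sum>p\<in>F. if i = \<sigma> r p then (if k dvd x (Suc i) then of_real (w p) else 0) else (0 :: complex)) =
        (\<Sum>p\<in>F. \<Sum>i<n. if i = \<sigma> r p then (if k dvd x (Suc i) then of_real (w p) else 0) else 0)"
      by (rule sum.swap)
    also have "\<dots> = (\<Sum>p\<in>F. if k dvd x (Suc r) * p then of_real (w p) else 0)"
      using \<sigma>[OF r] by (intro sum.cong refl) (simp add: sum.delta)
    also have "(\<Sum>i<n. if i = r then (if k dvd x (Suc i) then 1 else 0) else (0 :: complex)) =
        (if k dvd x (Suc r) then 1 else 0)"
      using r q by (simp add: sum.delta)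
    finally show ?thesis .
  qed
  have DB: "(cmod (divisor_sum n (\<lambda>i. V i r) k))\<^sup>2 \<le> B r k" if r: "r < q" for r k
  proof (cases "k dvd x (Suc r)")
    case True
    then have "divisor_sum n (\<lambda>i. V i r) k = of_real (\<Sum>p\<in>F. w p) - 1"
      unfolding DV[OF r] by (simp add: dvd_mult2)
    then show ?thesis using w True by (simp add: B_def)
  next
    case False
    show ?thesis
    proof (cases "\<exists>p\<in>F. k dvd x (Suc r) * p")
      case True
      then obtain p where p: "p \<in> F" "k dvd x (Suc r) * p" by blast
      have uniq: "\<not> k dvd x (Suc r) * p'" if "p' \<in> F" "p' \<noteq> p" for p'
      proof
        assume "k dvd x (Suc r) * p'"
        then have "k dvd gcd (x (Suc r) * p) (x (Suc r) * p')" using p by simp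
        moreover have "gcd (x (Suc r) * p) (x (Suc r) * p') = x (Suc r)"
          using F(2) p(1) that by (simp add: gcd_mult_distrib_nat[symmetric] primes_coprime)
        ultimately show False using False by simp
      qed
      have "divisor_sum n (\<lambda>i. V i r) k = (\<Sum>p'\<in>F. if p' = p then of_real (w p) else 0)"
        unfolding DV[OF r] using False uniq p by (auto intro!: sum.cong)
      also have "\<dots> = of_real (w p)" using p F(1) by simp
      finally have "(cmod (divisor_sum n (\<lambda>i. V i r) k))\<^sup>2 = (w p)\<^sup>2" by simp
      also have "\<dots> \<le> B r k"
        unfolding B_def using member_le_sum[OF p(1), of "\<lambda>p. if k dvd x (Suc r) * p \<and> \<not> k dvd x (Suc r) then (w p)\<^sup>2 else 0"]
          p(2) False F(1) by simp
      finally show ?thesis .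
    next
      case no: False
      then have "divisor_sum n (\<lambda>i. V i r) k = 0"
        unfolding DV[OF r] using False by (auto intro!: sum.neutral)
      then show ?thesis by (auto simp: B_def intro!: sum_nonneg)
    qed
  qed
  \<comment> \<open>The weights of the divisors of \<open>x (Suc r) * p\<close> that do not divide
    \<open>x (Suc r)\<close> add up to the difference of the two values of \<open>h\<close>.\<close>
  have WB: "(\<Sum>k\<in>divisor_set n. weight k * B r k) = (\<Sum>p\<in>F. (w p)\<^sup>2 * (Re (h (x (Suc r) * p)) - Re (h (x (Suc r)))))"
    if r: "r < q" for r
  proof -
    have "(\<Sum>k\<in>divisor_set n. weight k * B r k) =
        (\<Sum>p\<in>F. (w p)\<^sup>2 * (\<Sum>k\<in>divisor_set n. if k dvd x (Suc r) * p \<and> \<not> k dvd x (Suc r) then weight k else 0))"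
      unfolding B_def sum_distrib_left by (subst sum.swap) (auto intro!: sum.cong)
    also have "\<dots> = (\<Sum>p\<in>F. (w p)\<^sup>2 * (Re (h (x (Suc r) * p)) - Re (h (x (Suc r)))))"
    proof (intro sum.cong refl arg_cong2[where f = "(*)"])
      fix p assume p: "p \<in> F"
      note s = \<sigma>[OF r p]
      have mp: "x (Suc r) * p dvd x (Suc (\<sigma> r p))" using s by simp
      have fin: "finite {k. k dvd x (Suc r) * p}" using pos[of "Suc (\<sigma> r p)"] s by simp
      have "{k. k dvd x (Suc r) * p \<and> \<not> k dvd x (Suc r)} \<subseteq> divisor_set n"
        unfolding divisor_set_def using s by (auto intro!: exI[of _ "\<sigma> r p"])
      then have "(\<Sum>k\<in>divisor_set n. if k dvd x (Suc r) * p \<and> \<not> k dvd x (Suc r) then weight k else 0) =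
          (\<Sum>k | k dvd x (Suc r) * p \<and> \<not> k dvd x (Suc r). weight k)"
        using finite_divisor_set by (intro sum.mono_neutral_cong_right) auto
      also have "{k. k dvd x (Suc r) * p \<and> \<not> k dvd x (Suc r)} = {k. k dvd x (Suc r) * p} - {k. k dvd x (Suc r)}"
        by auto
      also have "sum weight \<dots> = (\<Sum>k | k dvd x (Suc r) * p. weight k) - (\<Sum>k | k dvd x (Suc r). weight k)"
        using fin by (intro sum_diff) (auto intro: dvd_mult2)
      also have "\<dots> = Re (h (x (Suc r) * p)) - Re (h (x (Suc r)))"
        unfolding h_eq_sum_weight[OF mp] h_eq_sum_weight[of "x (Suc r)" r, OF dvd_refl] by simp
      finally show "(\<Sum>k\<in>divisor_set n. if k dvd x (Suc r) * p \<and> \<not> k dvd x (Suc r) then weight k else 0) =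
        Re (h (x (Suc r) * p)) - Re (h (x (Suc r)))" .
    qed
    finally show ?thesis .
  qed
  have wk: "weight k \<ge> 0" if "k \<in> divisor_set n" for k
    using that weight(1) by (auto simp: divisor_set_def)
  have B0: "B r k \<ge> 0" for r k unfolding B_def by (intro sum_nonneg) auto
  have \<epsilon>: "?\<epsilon> = (\<Sum>r<q. \<Sum>k\<in>divisor_set n. weight k * B r k)" using WB by simp
  have \<epsilon>0: "?\<epsilon> \<ge> 0" unfolding \<epsilon> by (intro sum_nonneg mult_nonneg_nonneg wk B0)
  show ?thesis
  proof (rule ordered_eigenvalues_le[where V = V, OF gcd_matrix_carrier gcd_matrix_hermitian q(1)])
    fix c :: "nat \<Rightarrow> complex" assume c: "\<exists>r<q. c r \<noteq> 0"
    let ?v = "\<lambda>i. \<Sum>r<q. V i r * c r"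
    let ?N = "\<Sum>r<q. (cmod (c r))\<^sup>2"
    \<comment> \<open>As \<open>q \<le> \<sigma> r p\<close>, the weighted parts lie outside the
      first \<open>q\<close> coordinates, where the combination is just \<open>- c\<close>. This
      gives both linear independence and the lower bound for the norm.\<close>
    have head: "?v i = - c i" if i: "i < q" for i
    proof -
      have "i \<noteq> \<sigma> r p" if "r < q" "p \<in> F" for r p using \<sigma>[OF that] i by linarith
      then have "V i r = - (if i = r then 1 else 0)" if "r < q" for r
        unfolding V_def using that by simp
      then have "?v i = (\<Sum>r<q. if r = i then - c i else 0)" by (intro sum.cong) auto
      then show ?thesis using i by simp
    qed
    have "?N = (\<Sum>i<q. (cmod (?v i))\<^sup>2)" by (intro sum.cong) (auto simp: head)
    also have "\<dots> \<le> (\<Sum>i<n. (cmod (?v i))\<^sup>2)" using q by (intro sum_mono2) auto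
    finally have N: "?N \<le> (\<Sum>i<n. (cmod (?v i))\<^sup>2)" .
    \<comment> \<open>Cauchy-Schwarz over \<open>r\<close> decouples the \<open>q\<close> test
      vectors; this is why the eigenvalue bound is a sum over \<open>r\<close>.\<close>
    have CS: "(cmod (divisor_sum n ?v k))\<^sup>2 \<le> ?N * (\<Sum>r<q. B r k)" for k
    proof -
      have "divisor_sum n ?v k = (\<Sum>i<n. \<Sum>r<q. c r * (if k dvd x (Suc i) then V i r else 0))"
        unfolding divisor_sum_def by (intro sum.cong) (auto simp: mult.commute)
      also have "\<dots> = (\<Sum>r<q. c r * divisor_sum n (\<lambda>i. V i r) k)"
        unfolding divisor_sum_def sum_distrib_left by (rule sum.swap)
      finally have "cmod (divisor_sum n ?v k) \<le> (\<Sum>r<q. cmod (c r) * cmod (divisor_sum n (\<lambda>i. V i r) k))"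
        using norm_sum[of "\<lambda>r. c r * divisor_sum n (\<lambda>i. V i r) k" "{..<q}"] by (simp add: norm_mult)
      then have "(cmod (divisor_sum n ?v k))\<^sup>2 \<le> (\<Sum>r<q. cmod (c r) * cmod (divisor_sum n (\<lambda>i. V i r) k))\<^sup>2"
        by (intro power_mono) auto
      also have "\<dots> \<le> ?N * (\<Sum>r<q. (cmod (divisor_sum n (\<lambda>i. V i r) k))\<^sup>2)"
        by (rule Cauchy_Schwarz_ineq_sum)
      also have "\<dots> \<le> ?N * (\<Sum>r<q. B r k)"
        by (intro mult_left_mono sum_mono DB sum_nonneg) auto
      finally show ?thesis .
    qed
    have "Re (quad_form (gcd_matrix h x n) ?v) = (\<Sum>k\<in>divisor_set n. weight k * (cmod (divisor_sum n ?v k))\<^sup>2)"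
      unfolding quad_form_gcd_matrix by (rule Re_complex_of_real)
    also have "\<dots> \<le> (\<Sum>k\<in>divisor_set n. weight k * (?N * (\<Sum>r<q. B r k)))"
      by (intro sum_mono mult_left_mono CS wk)
    also have "\<dots> = (\<Sum>k\<in>divisor_set n. \<Sum>r<q. ?N * (weight k * B r k))"
      by (intro sum.cong refl) (simp only: sum_distrib_left mult.left_commute)
    also have "\<dots> = (\<Sum>r<q. \<Sum>k\<in>divisor_set n. ?N * (weight k * B r k))" by (rule sum.swap)
    also have "\<dots> = ?N * ?\<epsilon>" unfolding \<epsilon> sum_distrib_left ..
    also have "\<dots> = ?\<epsilon> * ?N" by (rule mult.commute)
    also have "\<dots> \<le> ?\<epsilon> * (\<Sum>i<n. (cmod (?v i))\<^sup>2)" using \<epsilon>0 N by (rule mult_left_mono[rotated])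
    finally have "Re (quad_form (gcd_matrix h x n) ?v) \<le> ?\<epsilon> * (\<Sum>i<n. (cmod (?v i))\<^sup>2)" .
    moreover have "\<exists>i<n. ?v i \<noteq> 0"
    proof -
      obtain r where "r < q" "c r \<noteq> 0" using c by blast
      then show ?thesis using head[of r] q by (intro exI[of _ r]) auto
    qed
    ultimately show "(\<exists>i<n. ?v i \<noteq> 0) \<and>
      Re (quad_form (gcd_matrix h x n) ?v) \<le> ?\<epsilon> * (\<Sum>i<n. (cmod (?v i))\<^sup>2)" by blast
  qed
qed

end

lemma ordered_eigenvalues_zero_matrix:
  "ordered_eigenvalues (0\<^sub>m n n) = replicate n 0"
proof (rule ordered_eigenvalues_eqI)
  have "real_diag (replicate n 0) = 0\<^sub>m n n" by (rule eq_matI) (auto simp: real_diag_def)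
  moreover have adj: "mat_adjoint (1\<^sub>m n) = (1\<^sub>m n :: complex mat)" by (intro eq_matI) auto
  ultimately have "0\<^sub>m n n = 1\<^sub>m n * real_diag (replicate n 0) * mat_adjoint (1\<^sub>m n)"
    by simp
  from char_poly_diagonalized[OF one_carrier_mat length_replicate _ this]
  show "char_poly (0\<^sub>m n n) = (\<Prod>x\<leftarrow>replicate n 0. [:- complex_of_real x, 1:])"
    by (simp only: adj) simp
qed simp

section \<open>The increasing sequence of primes congruent to 1\<close>

lemma primes_1_mod_eq: "{p. prime p \<and> (\<exists>k. p = 1 + b * k)} = {p::nat. prime p \<and> [p = 1] (mod b)}"
proof -
  have "(\<exists>k. p = 1 + b * k) \<longleftrightarrow> [p = 1] (mod b)" if "prime p" for p
  proof
    assume "\<exists>k. p = 1 + b * k"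
    then obtain k where "p = 1 + b * k" ..
    then show "[p = 1] (mod b)" using cong_add_lcancel_0_nat[of 1 "b * k" b] by (simp add: cong_0_iff)
  next
    assume "[p = 1] (mod b)"
    then have "b dvd p - 1" using prime_ge_1_nat[OF that] by (simp add: cong_altdef_nat)
    then show "\<exists>k. p = 1 + b * k" using prime_ge_1_nat[OF that] by (metis dvd_def le_add_diff_inverse)
  qed
  then show ?thesis by blast
qed

text \<open>\<open>enumerate\<close> is an injective listing only for infinite sets, so the facts on
  \<open>ap_prime\<close> rest on this.\<close>

lemma infinite_primes_1_mod:
  fixes b :: nat
  assumes b: "b > 0"
  shows "infinite {p. prime p \<and> (\<exists>k. p = 1 + b * k)}"
proof
  let ?P = "{p. prime p \<and> (\<exists>k. p = 1 + b * k)}"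
  assume fin: "finite ?P"
  obtain N where "(\<Sum>p | prime p \<and> p \<le> N \<and> [p = 1] (mod b). 1 / real p) > (\<Sum>p\<in>?P. 1 / real p)"
    using sum_inverse_primes_cong_1_unbounded[OF b] by blast
  moreover have "(\<Sum>p | prime p \<and> p \<le> N \<and> [p = 1] (mod b). 1 / real p) \<le> (\<Sum>p\<in>?P. 1 / real p)"
    using fin unfolding primes_1_mod_eq by (intro sum_mono2) auto
  ultimately show False by simp
qed

lemma ap_prime_in:
  assumes "b > 0"
  shows "prime (ap_prime b i)" "\<exists>k. ap_prime b i = 1 + b * k"
  using enumerate_in_set[OF infinite_primes_1_mod[OF assms], of "i - 1"] by (auto simp: ap_prime_def)

lemma inj_on_ap_prime:
  assumes "b > 0" shows "inj_on (ap_prime b) {1..}"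
proof (rule inj_onI)
  fix i j assume ij: "i \<in> {1..}" "j \<in> {1..}" "ap_prime b i = ap_prime b j"
  have "inj (enumerate {p. prime p \<and> (\<exists>k. p = 1 + b * k)})"
    using infinite_primes_1_mod[OF assms] by (rule inj_enumerate)
  then have "i - 1 = j - 1" using ij(3) unfolding ap_prime_def by (rule injD)
  then show "i = j" using ij by auto
qed

lemma ap_prime_ge: "b > 0 \<Longrightarrow> i - 1 \<le> ap_prime b i"
  unfolding ap_prime_def by (rule le_enumerate) (rule infinite_primes_1_mod)

lemma sum_inverse_ap_primes_at_top:
  assumes b: "b > 0"
  shows "filterlim (\<lambda>N. \<Sum>i=1..N. 1 / real (ap_prime b i)) at_top sequentially"
  unfolding filterlim_at_top
proof
  fix T :: real
  let ?P = "{p. prime p \<and> (\<exists>k. p = 1 + b * k)}"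
  obtain N where N: "(\<Sum>p | prime p \<and> p \<le> N \<and> [p = 1] (mod b). 1 / real p) > T"
    using sum_inverse_primes_cong_1_unbounded[OF b] by blast
  \<comment> \<open>A prime \<open>p \<le> N\<close> has position at most \<open>p\<close> when
    counted from 0, hence index at most \<open>N + 1\<close> in \<open>ap_prime\<close>.\<close>
  have "T \<le> (\<Sum>i=1..M. 1 / real (ap_prime b i))" if M: "M \<ge> Suc (Suc N)" for M
  proof -
    have sub: "{p. prime p \<and> p \<le> N \<and> [p = 1] (mod b)} \<subseteq> ap_prime b ` {1..M}"
    proof
      fix p assume p: "p \<in> {p. prime p \<and> p \<le> N \<and> [p = 1] (mod b)}"
      then have "p \<in> ?P" unfolding primes_1_mod_eq by auto
      then obtain i where i: "enumerate ?P i = p"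
        using enumerate_Ex[of ?P p] infinite_primes_1_mod[OF b] by blast
      have "i \<le> enumerate ?P i" by (rule le_enumerate[OF infinite_primes_1_mod[OF b]])
      then have "i \<le> N" using i p by simp
      then show "p \<in> ap_prime b ` {1..M}"
        using i M by (intro image_eqI[of _ _ "Suc i"]) (auto simp: ap_prime_def)
    qed
    have "T \<le> (\<Sum>p | prime p \<and> p \<le> N \<and> [p = 1] (mod b). 1 / real p)" using N by simp
    also have "\<dots> \<le> (\<Sum>p\<in>ap_prime b ` {1..M}. 1 / real p)" using sub by (intro sum_mono2) auto
    also have "\<dots> = (\<Sum>i=1..M. 1 / real (ap_prime b i))"
      using inj_on_subset[OF inj_on_ap_prime[OF b], of "{1..M}"] by (subst sum.reindex) auto
    finally show ?thesis .
  qed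
  then show "\<forall>\<^sub>F M in sequentially. T \<le> (\<Sum>i=1..M. 1 / real (ap_prime b i))"
    by (rule eventually_sequentiallyI)
qed

lemma less_ap_prime: "b > 0 \<Longrightarrow> i > B + 1 \<Longrightarrow> B < ap_prime b i"
  using ap_prime_ge[of b i] by linarith

text \<open>Divergence survives the removal of the first \<open>i0\<close> terms; it is needed in
  this form because small primes have to be discarded.\<close>

lemma sum_tail_at_top:
  fixes u :: "nat \<Rightarrow> real"
  assumes "filterlim (\<lambda>N. \<Sum>i=1..N. u i) at_top sequentially"
  shows "\<exists>N. (\<Sum>i\<in>{i0<..N}. u i) \<ge> W"
proof -
  have "\<forall>\<^sub>F N in sequentially. W + (\<Sum>i=1..i0. u i) \<le> (\<Sum>i=1..N. u i)"
    using assms unfolding filterlim_at_top by blast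
  then have "\<forall>\<^sub>F N in sequentially. W + (\<Sum>i=1..i0. u i) \<le> (\<Sum>i=1..N. u i) \<and> N \<ge> i0"
    using eventually_ge_at_top[of i0] by (rule eventually_conj)
  then obtain N where N: "W + (\<Sum>i=1..i0. u i) \<le> (\<Sum>i=1..N. u i)" "N \<ge> i0"
    by (auto simp: eventually_sequentially)
  have "{1..N} = {1..i0} \<union> {i0<..N}" using N(2) by auto
  then have "(\<Sum>i=1..N. u i) = (\<Sum>i\<in>{1..i0} \<union> {i0<..N}. u i)" by (simp only:)
  also have "\<dots> = (\<Sum>i=1..i0. u i) + (\<Sum>i\<in>{i0<..N}. u i)"
    by (rule sum.union_disjoint) auto
  finally have "(\<Sum>i=1..N. u i) = (\<Sum>i=1..i0. u i) + (\<Sum>i\<in>{i0<..N}. u i)" .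
  then show ?thesis using N(1) by (intro exI[of _ N]) simp
qed

text \<open>Weights proportional to \<open>1 / \<Phi> p\<close> turn the sum of
  \<open>(w p)\<^sup>2 * \<Phi> p\<close> into \<open>1 / W\<close>, where \<open>W\<close> is the
  sum of the reciprocals over the chosen primes. With \<open>L\<close> and the values of
  \<open>h\<close> at the first \<open>q\<close> terms collected in \<open>K\<close>, the eigenvalue
  is at most \<open>K / W\<close>.\<close>

lemma (in moebius_nonneg_seq) ordered_eigenvalues_gcd_matrix_tendsto_0:
  fixes a b e q :: nat and L :: real and \<Phi> :: "nat \<Rightarrow> real"
  assumes a: "a \<ge> 1" and b: "b \<ge> 1" and q: "q \<ge> 1" and x_def: "x = (\<lambda>i. a + b * (e + i - 1))"
    and mult: "multiplicative h" and L: "L > 0"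
    and \<Phi>: "\<And>i. i \<ge> 1 \<Longrightarrow> \<Phi> (ap_prime b i) > 0"
      "\<And>i. i \<ge> 1 \<Longrightarrow> Re (h (ap_prime b i)) - 1 \<le> L * \<Phi> (ap_prime b i)"
    and div: "filterlim (\<lambda>N. \<Sum>i=1..N. 1 / \<Phi> (ap_prime b i)) at_top sequentially"
  shows "(\<lambda>n. ordered_eigenvalues (gcd_matrix h x n) ! (q - 1)) \<longlonglongrightarrow> 0"
proof (rule LIMSEQ_I)
  fix \<epsilon> :: real assume \<epsilon>: "\<epsilon> > 0"
  have b0: "b > 0" using b by simp
  have hr: "Re (h (x (Suc r))) \<ge> 0" for r
    using h_nonneg[of "x (Suc r)" r] by (simp add: less_eq_complex_def)
  define K where "K = L * (\<Sum>r<q. Re (h (x (Suc r))))"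
  have K0: "K \<ge> 0" unfolding K_def using L hr by (intro mult_nonneg_nonneg sum_nonneg) auto
  \<comment> \<open>A prime above \<open>B\<close> exceeds every \<open>x (Suc r)\<close> with
    \<open>r < q\<close>, hence is coprime to it, and the part \<open>b * q\<close> pushes the new
    indices up to at least \<open>q\<close>.\<close>
  define B where "B = b * q + (\<Sum>r<q. x (Suc r)) + 1"
  \<comment> \<open>The summand 1 makes \<open>W\<close> positive even for \<open>K = 0\<close> and
    the inequality \<open>K / W < \<epsilon>\<close> strict.\<close>
  obtain N where N: "(\<Sum>i\<in>{B + 1<..N}. 1 / \<Phi> (ap_prime b i)) \<ge> K / \<epsilon> + 1"
    using sum_tail_at_top[OF div] by blast
  define F where "F = ap_prime b ` {B + 1<..N}"
  define W where "W = (\<Sum>p\<in>F. 1 / \<Phi> p)"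
  have finF: "finite F" by (simp add: F_def)
  have W_eq: "W = (\<Sum>i\<in>{B + 1<..N}. 1 / \<Phi> (ap_prime b i))"
    unfolding W_def F_def
    by (subst sum.reindex) (auto intro: inj_on_subset[OF inj_on_ap_prime[OF b0]])
  have W: "W \<ge> K / \<epsilon> + 1" unfolding W_eq by (rule N)
  have W0: "W > 0" using W K0 \<epsilon> by (intro less_le_trans[OF _ W] add_nonneg_pos) auto
  have F: "prime p" "\<Phi> p > 0" "Re (h p) - 1 \<le> L * \<Phi> p" "p > B" "\<exists>k. p = 1 + b * k" if "p \<in> F" for p
  proof -
    from that obtain i where "i \<in> {B + 1<..N}" "p = ap_prime b i" unfolding F_def by blast
    then have i: "i > B + 1" "p = ap_prime b i" by auto
    then show "prime p" "\<Phi> p > 0" "Re (h p) - 1 \<le> L * \<Phi> p" "p > B" "\<exists>k. p = 1 + b * k"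
      using ap_prime_in[OF b0, of i] \<Phi>[of i] less_ap_prime[OF b0 i(1)] by auto
  qed
  define w where "w p = 1 / (\<Phi> p * W)" for p
  have w1: "(\<Sum>p\<in>F. w p) = 1"
  proof -
    have "(\<Sum>p\<in>F. w p) = (\<Sum>p\<in>F. 1 / \<Phi> p) / W" by (simp add: w_def sum_divide_distrib)
    then show ?thesis using W0 by (simp add: W_def)
  qed
  \<comment> \<open>With \<open>p = 1 + b * k\<close> one has
    \<open>x (Suc r) * p = x (Suc r) + b * (k * x (Suc r))\<close>, so the index moves by
    \<open>k * x (Suc r)\<close>.\<close>
  define \<sigma> where "\<sigma> r p = r + (p - 1) div b * x (Suc r)" for r p
  have \<sigma>x: "x (Suc (\<sigma> r p)) = x (Suc r) * p" and \<sigma>q: "q \<le> \<sigma> r p" if p: "p \<in> F" and r: "r < q" for r p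
  proof -
    obtain k where k: "p = 1 + b * k" using F(5)[OF p] by blast
    have \<sigma>: "\<sigma> r p = r + k * x (Suc r)" using k b by (simp add: \<sigma>_def)
    have "x (Suc (\<sigma> r p)) = (a + b * (e + r)) + b * k * x (Suc r)"
      unfolding \<sigma> by (simp add: x_def algebra_simps)
    also have "a + b * (e + r) = x (Suc r)" by (simp add: x_def)
    finally show "x (Suc (\<sigma> r p)) = x (Suc r) * p" unfolding k by (simp add: algebra_simps)
    have "b * q < b * k" using F(4)[OF p] unfolding k B_def by linarith
    then have "q \<le> k" by simp
    also have "k * 1 \<le> k * x (Suc r)" using pos[of "Suc r"] by (intro mult_le_mono2) simp
    finally show "q \<le> \<sigma> r p" unfolding \<sigma> by simp
  qed
  have hmp: "Re (h (x (Suc r) * p)) = Re (h (x (Suc r))) * Re (h p)" if p: "p \<in> F" and r: "r < q" for r p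
  proof -
    have "x (Suc r) \<le> (\<Sum>r<q. x (Suc r))" using r by (intro member_le_sum) auto
    then have "x (Suc r) < p" using F(4)[OF p] by (simp add: B_def)
    then have "\<not> p dvd x (Suc r)" using pos[of "Suc r"] by (auto dest: dvd_imp_le)
    then have "coprime (x (Suc r)) p" using F(1)[OF p] by (simp add: prime_imp_coprime coprime_commute)
    then have "h (x (Suc r) * p) = h (x (Suc r)) * h p"
      using mult pos[of "Suc r"] prime_gt_0_nat[OF F(1)[OF p]] unfolding multiplicative_def by simp
    then show ?thesis using h_nonneg[of "x (Suc r)" r] by (simp add: less_eq_complex_def)
  qed
  have sum_le: "(\<Sum>r<q. \<Sum>p\<in>F. (w p)\<^sup>2 * (Re (h (x (Suc r) * p)) - Re (h (x (Suc r))))) \<le> K / W"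
  proof -
    have "(w p)\<^sup>2 * (Re (h (x (Suc r) * p)) - Re (h (x (Suc r)))) \<le> Re (h (x (Suc r))) * L * ((1 / \<Phi> p) / W\<^sup>2)"
      if p: "p \<in> F" and r: "r < q" for r p
    proof -
      have "(w p)\<^sup>2 * (Re (h (x (Suc r) * p)) - Re (h (x (Suc r)))) = (w p)\<^sup>2 * (Re (h (x (Suc r))) * (Re (h p) - 1))"
        unfolding hmp[OF p r] by (simp add: algebra_simps)
      also have "\<dots> \<le> (w p)\<^sup>2 * (Re (h (x (Suc r))) * (L * \<Phi> p))"
        using F(3)[OF p] hr by (intro mult_left_mono) auto
      also have "\<dots> = Re (h (x (Suc r))) * L * ((1 / \<Phi> p) / W\<^sup>2)"
        using F(2)[OF p] W0 by (simp add: w_def power2_eq_square field_simps)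
      finally show ?thesis .
    qed
    then have "(\<Sum>r<q. \<Sum>p\<in>F. (w p)\<^sup>2 * (Re (h (x (Suc r) * p)) - Re (h (x (Suc r)))))
        \<le> (\<Sum>r<q. \<Sum>p\<in>F. Re (h (x (Suc r))) * L * ((1 / \<Phi> p) / W\<^sup>2))"
      by (intro sum_mono) auto
    also have "\<dots> = (\<Sum>r<q. Re (h (x (Suc r))) * L * (W / W\<^sup>2))"
      unfolding sum_distrib_left[symmetric] sum_divide_distrib[symmetric] W_def ..
    also have "\<dots> = K / W"
      using W0 by (simp add: K_def sum_distrib_left sum_divide_distrib power2_eq_square mult.commute)
    finally show ?thesis .
  qed
  have KW: "K / W < \<epsilon>"
  proof -
    have "K / \<epsilon> < W" using W by simp
    then show ?thesis using \<epsilon> W0 by (simp add: field_simps)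
  qed
  show "\<exists>n0. \<forall>n\<ge>n0. norm (ordered_eigenvalues (gcd_matrix h x n) ! (q - 1) - 0) < \<epsilon>"
  proof (intro exI allI impI)
    fix n assume n: "n \<ge> q + (\<Sum>r<q. \<Sum>p\<in>F. \<sigma> r p) + 1"
    have "\<sigma> r p < n" if "r < q" "p \<in> F" for r p
    proof -
      have "\<sigma> r p \<le> (\<Sum>p\<in>F. \<sigma> r p)" using that finF by (intro member_le_sum) auto
      also have "\<dots> \<le> (\<Sum>r<q. \<Sum>p\<in>F. \<sigma> r p)" using that
        by (intro member_le_sum[of r "{..<q}" "\<lambda>r. \<Sum>p\<in>F. \<sigma> r p"]) auto
      finally show ?thesis using n by simp
    qed
    then have "ordered_eigenvalues (gcd_matrix h x n) ! (q - 1) \<le>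
        (\<Sum>r<q. \<Sum>p\<in>F. (w p)\<^sup>2 * (Re (h (x (Suc r) * p)) - Re (h (x (Suc r)))))"
      using n \<sigma>x \<sigma>q F(1) by (intro ordered_eigenvalues_gcd_matrix_le[OF q _ finF _ w1, where \<sigma> = \<sigma>]) auto
    also have "\<dots> < \<epsilon>" using sum_le KW by linarith
    finally show "norm (ordered_eigenvalues (gcd_matrix h x n) ! (q - 1) - 0) < \<epsilon>"
      using ordered_eigenvalues_gcd_matrix_nonneg[of "q - 1" n] n q by simp
  qed
qed

theorem theorem1p6:
  fixes a b c q d e :: nat
    and x l :: "nat \<Rightarrow> nat"
    and f :: "nat \<Rightarrow> nat \<Rightarrow> complex"
    and h :: "nat \<Rightarrow> complex"
    and lam :: "nat \<Rightarrow> real"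
  assumes "a \<ge> 1" and "b \<ge> 1" and "c \<ge> 1" and "q \<ge> 1"
    and x_def: "x = (\<lambda>i. a + b * (e + i - 1))"
    and l_pos: "\<forall>j\<in>{1..c}. l j \<ge> 1"
    and l_sum: "(\<Sum>j=1..c. l j) > d"
    and f_class: "\<forall>j\<in>{1..c}. f j \<in> class_C x"
    and f_distinct: "\<forall>i\<in>{1..c}. \<forall>j\<in>{1..c}. i \<noteq> j \<longrightarrow> (\<exists>m>0. f i m \<noteq> f j m)"
    and f_mult: "\<forall>j\<in>{1..c}. multiplicative (f j)"
    and f_incr: "\<forall>j\<in>{1..c}. increasing_on_seq (ap_prime b) (f j)"
    and h_def: "h = foldr dirichlet_conv (map (\<lambda>j. dirichlet_power (f j) (l j)) [1..<Suc c])
                      (dirichlet_power moebius_mu d)"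
    and lam_def: "lam = (\<lambda>n. ordered_eigenvalues (gcd_matrix h x n) ! (q - 1))"
  shows "((\<exists>i\<ge>1. h (ap_prime b i) = 0) \<longrightarrow> (\<forall>\<^sub>F n in sequentially. lam n = 0))
    \<and> ((\<forall>i\<ge>1. h (ap_prime b i) \<noteq> 0)
         \<and> filterlim (\<lambda>N. \<Sum>i=1..N. 1 / (\<Sum>j=1..c. Re (f j (ap_prime b i)))) at_top sequentially
         \<longrightarrow> lam \<longlonglongrightarrow> 0)
    \<and> ((\<forall>j\<in>{1..c}. \<exists>C>0. \<forall>i\<ge>1. f j (ap_prime b i) \<le> complex_of_real (C * real (ap_prime b i)))
         \<longrightarrow> lam \<longlonglongrightarrow> 0)"
proof (cases "\<exists>j\<in>{1..c}. f j 1 \<noteq> 1")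
  \<comment> \<open>Some \<open>f j\<close> vanishes at all positive arguments and takes
    \<open>h\<close> with it, since \<open>l j \<ge> 1\<close>. The matrices are then zero and all
    three claims hold at once.\<close>
  case True
  then obtain j where j: "j \<in> {1..c}" "f j 1 \<noteq> 1" by blast
  then have zero: "f j n = 0" if "n > 0" for n
    using multiplicative_1_cases[of "f j"] f_mult that by blast
  have "l j \<ge> 1" using l_pos j(1) by blast
  then obtain k where "l j = Suc k" by (cases "l j") auto
  then have "dirichlet_power (f j) (l j) n = 0" for n
    using dirichlet_conv_zero[of "f j"] zero by simp
  moreover have "dirichlet_power (f j) (l j) \<in> set (map (\<lambda>j. dirichlet_power (f j) (l j)) [1..<Suc c])"
    using j(1) by (auto simp del: upt_Suc)
  ultimately have h0: "h m = 0" for m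
    unfolding h_def by (intro foldr_dirichlet_conv_zero[where f = "dirichlet_power (f j) (l j)"])
  have "gcd_matrix h x n = 0\<^sub>m n n" for n
    by (rule eq_matI) (simp_all add: gcd_matrix_def h0)
  then have "lam n = 0" if "n \<ge> q" for n
    using that \<open>q \<ge> 1\<close> by (simp add: lam_def ordered_eigenvalues_zero_matrix)
  then have ev: "\<forall>\<^sub>F n in sequentially. lam n = 0" by (rule eventually_sequentiallyI)
  then have "lam \<longlonglongrightarrow> 0" by (rule tendsto_eventually)
  with ev show ?thesis by blast
next
  case False
  then have f1: "f j 1 = 1" if "j \<in> {1..c}" for j using that by blast
  have b0: "b > 0" using \<open>b \<ge> 1\<close> by simp
  let ?fs = "map (\<lambda>j. dirichlet_power (f j) (l j)) [1..<Suc c]"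
  define D where "D = divisors_of_seq x"
  have pos: "x i > 0" if "i \<ge> 1" for i using \<open>a \<ge> 1\<close> by (simp add: x_def)
  have D: "divisor_closed D" unfolding D_def by (rule divisor_closed_divisors_of_seq[OF pos])
  have set_upt: "set [1..<Suc c] = {1..c}" by auto
  have fD: "nonneg_on D (dirichlet_conv (f j) moebius_mu)" if "j \<in> {1..c}" for j
    using f_class that unfolding D_def nonneg_on_def divisors_of_seq_def class_C_def by blast
  have fM: "moebius_nonneg D 1 (f j)" if "j \<in> {1..c}" for j
    by (rule moebius_nonneg_1I[OF D fD[OF that]])
  have "nonneg_on D (dirichlet_conv h moebius_mu)"
    unfolding h_def
  proof (rule nonneg_on_foldr_dirichlet_conv[OF D, where l = l])
    show "moebius_nonneg D (l j) (dirichlet_power (f j) (l j))" if "j \<in> set [1..<Suc c]" for j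
      using fM that unfolding set_upt by (intro moebius_nonneg_dirichlet_power[OF D])
    show "d < sum_list (map l [1..<Suc c])"
      using l_sum unfolding interv_sum_list_conv_sum_set_nat set_upt .
  qed
  then interpret moebius_nonneg_seq h x
    using pos unfolding D_def by unfold_locales
  have mult: "multiplicative h"
    unfolding h_def using f_mult
    by (intro multiplicative_foldr_dirichlet_conv multiplicative_dirichlet_power multiplicative_moebius)
       (auto simp del: upt_Suc intro: multiplicative_dirichlet_power)
  \<comment> \<open>With \<open>p = 1 + b * k\<close>, the multiple \<open>x 1 * p\<close> is again
    a term of the sequence, at index \<open>k * x 1 + 1\<close>.\<close>
  have pD: "ap_prime b i \<in> D" for i
  proof -
    obtain k where "ap_prime b i = 1 + b * k" using ap_prime_in(2)[OF b0] by blast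
    then have "x (Suc (k * x 1)) = x 1 * ap_prime b i" by (simp add: x_def algebra_simps)
    then have "ap_prime b i dvd x (Suc (k * x 1))" by simp
    moreover have "Suc (k * x 1) \<ge> 1" by simp
    ultimately show ?thesis unfolding D_def divisors_of_seq_def mem_Collect_eq by (intro exI conjI)
  qed
  have hp: "h p = (\<Sum>j=1..c. of_nat (l j) * f j p) - of_nat d" if p: "prime p" for p
  proof -
    have "h p = (\<Sum>g\<leftarrow>?fs. g p) + dirichlet_power moebius_mu d p"
      unfolding h_def
    proof (rule foldr_dirichlet_conv_prime[OF _ _ p])
      show "g 1 = 1" if "g \<in> set ?fs" for g
        using that f1 dirichlet_power_1 by (auto simp del: upt_Suc)
      show "dirichlet_power moebius_mu d 1 = 1" using dirichlet_power_1[of moebius_mu d] by simp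
    qed
    also have "(\<Sum>g\<leftarrow>?fs. g p) = (\<Sum>j\<leftarrow>[1..<Suc c]. dirichlet_power (f j) (l j) p)"
      by (simp add: o_def del: upt_Suc)
    also have "\<dots> = (\<Sum>j=1..c. dirichlet_power (f j) (l j) p)"
      unfolding interv_sum_list_conv_sum_set_nat set_upt ..
    also have "\<dots> = (\<Sum>j=1..c. of_nat (l j) * f j p)"
      using f1 p by (intro sum.cong) (auto simp: dirichlet_power_prime)
    also have "dirichlet_power moebius_mu d p = - of_nat d"
      using p by (simp add: dirichlet_power_prime moebius_prime)
    finally show ?thesis by simp
  qed
  \<comment> \<open>At a prime \<open>p\<close> the convolution with \<open>moebius_mu\<close> has
    the value \<open>f j p - f j 1\<close>, and \<open>f j 1 = 1\<close> in this case.\<close>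
  have f_ge: "f j (ap_prime b i) \<ge> 1" if j: "j \<in> {1..c}" for j i
  proof -
    have "dirichlet_conv (f j) moebius_mu (ap_prime b i) \<ge> 0"
      using fD[OF j] pD by (simp add: nonneg_on_def)
    then have "f j (ap_prime b i) - 1 \<ge> 0"
      using f1[OF j] ap_prime_in(1)[OF b0, of i] by (simp add: dirichlet_conv_prime moebius_prime)
    then show ?thesis by (simp add: less_eq_complex_def)
  qed
  have Re_ge: "Re (f j (ap_prime b i)) \<ge> 1" if "j \<in> {1..c}" for j i
    using f_ge[OF that, of i] by (simp add: less_eq_complex_def)
  define L where "L = real (\<Sum>j=1..c. l j)"
  define \<Phi> where "\<Phi> p = (\<Sum>j=1..c. Re (f j p))" for p
  have L_ge: "real d + 1 \<le> L"
    unfolding L_def using of_nat_mono[OF Suc_leI[OF l_sum], where 'a = real] by (simp only: of_nat_Suc add.commute)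
  then have L0: "L > 0" by linarith
  have \<Phi>1: "\<Phi> (ap_prime b i) \<ge> 1" for i
  proof -
    have "1 \<le> (\<Sum>j=1..c. 1 :: real)" using \<open>c \<ge> 1\<close> by simp
    also have "\<dots> \<le> \<Phi> (ap_prime b i)" unfolding \<Phi>_def by (intro sum_mono Re_ge)
    finally show ?thesis .
  qed
  have Re_h: "Re (h (ap_prime b i)) = (\<Sum>j=1..c. real (l j) * Re (f j (ap_prime b i))) - real d" for i
    using hp[OF ap_prime_in(1)[OF b0]] by simp
  \<comment> \<open>The coefficients \<open>l j\<close> sum to at least \<open>d + 1\<close> and
    each value of \<open>f j\<close> is at least 1, so subtracting \<open>d\<close> leaves at least
    1.\<close>
  have h_ge: "Re (h (ap_prime b i)) \<ge> 1" for i
  proof -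
    have "L \<le> (\<Sum>j=1..c. real (l j) * Re (f j (ap_prime b i)))"
      unfolding L_def of_nat_sum
    proof (rule sum_mono)
      fix j assume "j \<in> {1..c}"
      then show "real (l j) \<le> real (l j) * Re (f j (ap_prime b i))"
        using mult_left_mono[OF Re_ge, of j "real (l j)" i] by simp
    qed
    then show ?thesis using L_ge unfolding Re_h by linarith
  qed
  have h_le: "Re (h (ap_prime b i)) - 1 \<le> L * \<Phi> (ap_prime b i)" for i
  proof -
    have "Re (h (ap_prime b i)) - 1 \<le> (\<Sum>j=1..c. real (l j) * Re (f j (ap_prime b i)))" unfolding Re_h by simp
    also have "\<dots> \<le> (\<Sum>j=1..c. L * Re (f j (ap_prime b i)))"
    proof (intro sum_mono mult_right_mono)
      fix j assume j: "j \<in> {1..c}"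
      have "l j \<le> (\<Sum>j=1..c. l j)" using j by (intro member_le_sum) auto
      then show "real (l j) \<le> L" unfolding L_def by linarith
      show "Re (f j (ap_prime b i)) \<ge> 0" using Re_ge[OF j, of i] by simp
    qed
    finally show ?thesis by (simp add: \<Phi>_def sum_distrib_left)
  qed
  have main: "lam \<longlonglongrightarrow> 0" if "filterlim (\<lambda>N. \<Sum>i=1..N. 1 / \<Phi> (ap_prime b i)) at_top sequentially"
    unfolding lam_def
    by (rule ordered_eigenvalues_gcd_matrix_tendsto_0[OF \<open>a \<ge> 1\<close> \<open>b \<ge> 1\<close> \<open>q \<ge> 1\<close> x_def mult L0 _ h_le that])
       (use \<Phi>1 in \<open>auto intro: less_le_trans[of 0 1]\<close>)
  \<comment> \<open>Hence the premise of the first claim cannot hold in this case.\<close>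
  have "h (ap_prime b i) \<noteq> 0" for i using h_ge[of i] by auto
  moreover have "lam \<longlonglongrightarrow> 0"
    if linear: "\<forall>j\<in>{1..c}. \<exists>C>0. \<forall>i\<ge>1. f j (ap_prime b i) \<le> complex_of_real (C * real (ap_prime b i))"
  proof (rule main)
    obtain C where C: "\<And>j. j \<in> {1..c} \<Longrightarrow> C j > 0"
      "\<And>j i. j \<in> {1..c} \<Longrightarrow> i \<ge> 1 \<Longrightarrow> f j (ap_prime b i) \<le> complex_of_real (C j * real (ap_prime b i))"
      using bchoice[OF linear] by blast
    define S where "S = (\<Sum>j=1..c. C j)"
    have S0: "S > 0" unfolding S_def using C(1) \<open>c \<ge> 1\<close> by (intro sum_pos) auto
    have \<Phi>_le: "\<Phi> (ap_prime b i) \<le> S * real (ap_prime b i)" if "i \<ge> 1" for i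
      unfolding \<Phi>_def S_def sum_distrib_right using C(2)[OF _ that]
      by (intro sum_mono) (simp add: less_eq_complex_def)
    have "filterlim (\<lambda>N. 1 / S * (\<Sum>i=1..N. 1 / real (ap_prime b i))) at_top sequentially"
      using S0 by (intro filterlim_tendsto_pos_mult_at_top[OF tendsto_const _ sum_inverse_ap_primes_at_top[OF b0]]) simp
    then show "filterlim (\<lambda>N. \<Sum>i=1..N. 1 / \<Phi> (ap_prime b i)) at_top sequentially"
    proof (rule filterlim_at_top_mono)
      show "\<forall>\<^sub>F N in sequentially. 1 / S * (\<Sum>i=1..N. 1 / real (ap_prime b i)) \<le> (\<Sum>i=1..N. 1 / \<Phi> (ap_prime b i))"
      proof (intro always_eventually allI)
        fix N
        show "1 / S * (\<Sum>i=1..N. 1 / real (ap_prime b i)) \<le> (\<Sum>i=1..N. 1 / \<Phi> (ap_prime b i))"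
          unfolding sum_distrib_left
        proof (rule sum_mono)
          fix i assume i: "i \<in> {1..N}"
          have "1 / (S * real (ap_prime b i)) \<le> 1 / \<Phi> (ap_prime b i)"
            using \<Phi>_le[of i] \<Phi>1[of i] i by (intro divide_left_mono) (auto intro!: mult_pos_pos)
          then show "1 / S * (1 / real (ap_prime b i)) \<le> 1 / \<Phi> (ap_prime b i)" by simp
        qed
      qed
    qed
  qed
  ultimately show ?thesis using main unfolding \<Phi>_def by blast
qed

end
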